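(* Let $m\in\mathbb N$ be even, $\alpha\ge\frac2m$, let $\tau\in S_m$ be a permutation of $\{1,\ldots,m\}$, and let $\Psi_1,\ldots,\Psi_m$ be bounded sets of nonnegative matrices that define operators on $l^2(R)$. For $j=1,\ldots,\frac m2$ let $\Sigma_j=\Psi_{\tau(2j-1)}^*\Psi_{\tau(2j)}$ and $\Sigma_{\frac m2+j}=\Psi_{\tau(2j)}^*\Psi_{\tau(2j-1)}=\Sigma_j^*$, and for $i=1,\ldots,\frac m2$ let $\Theta_i=\Sigma_i\cdots\Sigma_{\frac m2}\Sigma_1\cdots\Sigma_{i-1}$. If $r\in\{\rho,\hat\rho\}$, then $$\big\|\Psi_1^{(\alpha)}\circ\cdots\circ\Psi_m^{(\alpha)}\big\|\le r\big(\Sigma_1^{(\alpha)}\circ\cdots\circ\Sigma_m^{(\alpha)}\big)^{\frac12}\le r\big(\Sigma_1^{(\alpha)}\circ\cdots\circ\Sigma_{\frac m2}^{(\alpha)}\big)$$ $$=r\big((\Psi_{\tau(1)}^*\Psi_{\tau(2)})^{(\alpha)}\circ(\Psi_{\tau(3)}^*\Psi_{\tau(4)})^{(\alpha)}\circ\cdots\circ(\Psi_{\tau(m-1)}^*\Psi_{\tau(m)})^{(\alpha)}\big)$$ $$\le r\big(\Theta_1^{(\alpha)}\circ\Theta_2^{(\alpha)}\circ\cdots\circ\Theta_{\frac m2}^{(\alpha)}\big)^{\frac2m}\le r\big(\Psi_{\tau(1)}^*\Psi_{\tau(2)}\Psi_{\tau(3)}^*\Psi_{\tau(4)}\cdots\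Psi_{\tau(m-1)}^*\Psi_{\tau(m)}\big)^{\alpha}.$$
   Context: $R$ is $\mathbb N$ or $\{1,\ldots,N\}$ for some $N\in\mathbb N$, and $l^2(R)$ is the complex Hilbert space. A matrix $A=[a_{ij}]_{i,j\in R}$ is nonnegative if all $a_{ij}\ge0$; it defines an operator on $l^2(R)$ if $Ax\in l^2(R)$ for all $x\in l^2(R)$, where $(Ax)_i=\sum_j a_{ij}x_j$ (the operator is then positive and bounded). Matrices are identified with the operators they define; "bounded set" means bounded in operator norm. For nonnegative matrices $A_j=[a^{(j)}_{ik}]$ and positive $\alpha_j$, $A_1^{(\alpha_1)}\circ\cdots\circ A_m^{(\alpha_m)}$ is the matrix with entries $\prod_j (a^{(j)}_{ik})^{\alpha_j}$ (if $\sum_j\alpha_j\ge1$ and the $A_j$ define operators on $l^2(R)$, it defines an operator on $l^2(R)$). For bounded sets: $\Psi_1\cdots\Psi_k=\{A_1\cdots A_k: A_i\in\Psi_i\}$, $\Sigma^k=\{A_1\cdots A_k:A_i\in\Sigma\}$, $\Psi^*=\{A^*:A\in\Psi\}$ ($A^*$ the adjoint), $\|\Psi\|=\sup_{A\in\Psi}\|A\|$, and $\Psi_1^{(\alpha_1)}\circ\cdots\circ\Psi_m^{(\alpha_m)}=\{A_1^{(\alpha_1)}\circ\cdots\circ A_m^{(\alpha_m)}:A_j\in\Psi_j\}$ (elements chosen independently from each factor). With $\rho(A)$ the spectral radius of an operator, for a bounded set $\Sigma$ of bounded operators: $\rho(\Sigma)=\limsup_{k\to\infty}[\sup_{A\in\Sigma^k}\rho(A)]^{1/k}$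 and $\hat\rho(\Sigma)=\lim_{k\to\infty}[\sup_{A\in\Sigma^k}\|A\|]^{1/k}$. *)

theory Defs
  imports "HOL-Analysis.Analysis" "HOL-Combinatorics.Permutations"
begin

section \<open>The space \<open>l\<^sup>2(R)\<close> and its operators\<close>

text \<open>The index set is an explicit set of natural numbers, either all positive naturals or an
  initial segment of them. Vectors and matrices over it are functions that vanish outside of it,
  so that equality of functions is equality of vectors and matrices.\<close>

definition index_set :: "nat set \<Rightarrow> bool" where
  "index_set R \<longleftrightarrow> R = {1..} \<or> (\<exists>N\<ge>1. R = {1..N})"

type_synonym vec = "nat \<Rightarrow> complex"
type_synonym rmat = "nat \<Rightarrow> nat \<Rightarrow> real"

definition l2 :: "nat set \<Rightarrow> vec set" where
  "l2 R = {x. (\<forall>i. i \<notin> R \<longrightarrow> x i = 0) \<and> (\<lambda>i. (cmod (x i))\<^sup>2) summable_on R}"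

definition l2_inner :: "nat set \<Rightarrow> vec \<Rightarrow> vec \<Rightarrow> complex" where
  "l2_inner R x y = (\<Sum>\<^sub>\<infinity>i\<in>R. x i * cnj (y i))"

definition l2_norm :: "nat set \<Rightarrow> vec \<Rightarrow> real" where
  "l2_norm R x = sqrt (\<Sum>\<^sub>\<infinity>i\<in>R. (cmod (x i))\<^sup>2)"

text \<open>The value is infinite iff \<open>T\<close> does not map \<open>l\<^sup>2(R)\<close> boundedly into itself.\<close>

definition op_norm :: "nat set \<Rightarrow> (vec \<Rightarrow> vec) \<Rightarrow> ennreal" where
  "op_norm R T =
     Inf {ennreal C |C. 0 \<le> C \<and> (\<forall>x\<in>l2 R. T x \<in> l2 R \<and> l2_norm R (T x) \<le> C * l2_norm R x)}"

definition bounded_operator :: "nat set \<Rightarrow> (vec \<Rightarrow> vec) \<Rightarrow> bool" where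
  "bounded_operator R T \<longleftrightarrow>
     (\<forall>x\<in>l2 R. \<forall>y\<in>l2 R. T (\<lambda>i. x i + y i) = (\<lambda>i. T x i + T y i)) \<and>
     (\<forall>c. \<forall>x\<in>l2 R. T (\<lambda>i. c * x i) = (\<lambda>i. c * T x i)) \<and>
     op_norm R T < top"

definition op_spectrum :: "nat set \<Rightarrow> (vec \<Rightarrow> vec) \<Rightarrow> complex set" where
  "op_spectrum R T =
     {z. \<not> (\<exists>S. bounded_operator R S \<and>
            (\<forall>x\<in>l2 R. S (\<lambda>i. z * x i - T x i) = x \<and>
                       (\<lambda>i. z * S x i - T (S x) i) = x))}"

definition spectral_radius :: "nat set \<Rightarrow> (vec \<Rightarrow> vec) \<Rightarrow> ennreal" where
  "spectral_radius R T = (SUP z\<in>op_spectrum R T. ennreal (cmod z))"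

section \<open>Nonnegative matrices\<close>

definition mat_op :: "nat set \<Rightarrow> rmat \<Rightarrow> vec \<Rightarrow> vec" where
  "mat_op R A x = (\<lambda>i. \<Sum>\<^sub>\<infinity>j\<in>R. complex_of_real (A i j) * x j)"

text \<open>The summability condition is needed because \<open>infsum\<close> is 0 for a divergent sum.\<close>

definition defines_operator :: "nat set \<Rightarrow> rmat \<Rightarrow> bool" where
  "defines_operator R A \<longleftrightarrow>
     (\<forall>x\<in>l2 R. (\<forall>i\<in>R. (\<lambda>j. complex_of_real (A i j) * x j) summable_on R) \<and>
                mat_op R A x \<in> l2 R)"

definition nonneg_operator_matrices :: "nat set \<Rightarrow> rmat set" where
  "nonneg_operator_matrices R =
     {A. (\<forall>i j. i \<notin> R \<or> j \<notin> R \<longrightarrow> A i j = 0) \<and> (\<forall>i\<in>R. \<forall>j\<in>R. 0 \<le> A i j) \<and>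
         defines_operator R A}"

definition mat_one :: "nat set \<Rightarrow> rmat" where
  "mat_one R = (\<lambda>i j. if i = j \<and> i \<in> R then 1 else 0)"

definition mat_mult :: "nat set \<Rightarrow> rmat \<Rightarrow> rmat \<Rightarrow> rmat" where
  "mat_mult R A B = (\<lambda>i k. \<Sum>\<^sub>\<infinity>j\<in>R. A i j * B j k)"

definition mat_prod :: "nat set \<Rightarrow> rmat list \<Rightarrow> rmat" where
  "mat_prod R As = foldr (mat_mult R) As (mat_one R)"

text \<open>Matrices are real, so the conjugate transpose is the transpose; that it is the Hilbert
  space adjoint is lemma \<open>mat_adjoint_correct\<close> below.\<close>

definition mat_adjoint :: "rmat \<Rightarrow> rmat" where
  "mat_adjoint A = (\<lambda>i j. A j i)"

definition hadamard :: "nat set \<Rightarrow> (nat \<Rightarrow> real) \<Rightarrow> (nat \<Rightarrow> rmat) \<Rightarrow> rmat" where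
  "hadamard J \<alpha> A = (\<lambda>i k. \<Prod>j\<in>J. A j i k powr \<alpha> j)"

section \<open>Sets of matrices\<close>

definition set_norm :: "nat set \<Rightarrow> rmat set \<Rightarrow> ennreal" where
  "set_norm R \<Sigma> = (SUP A\<in>\<Sigma>. op_norm R (mat_op R A))"

definition bounded_set :: "nat set \<Rightarrow> rmat set \<Rightarrow> bool" where
  "bounded_set R \<Sigma> \<longleftrightarrow> set_norm R \<Sigma> < top"

definition set_prod :: "nat set \<Rightarrow> rmat set list \<Rightarrow> rmat set" where
  "set_prod R \<Psi>s = {mat_prod R As |As. list_all2 (\<in>) As \<Psi>s}"

definition set_power :: "nat set \<Rightarrow> rmat set \<Rightarrow> nat \<Rightarrow> rmat set" where
  "set_power R \<Sigma> k = {mat_prod R As |As. length As = k \<and> set As \<subseteq> \<Sigma>}"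

definition set_adjoint :: "rmat set \<Rightarrow> rmat set" where
  "set_adjoint \<Psi> = mat_adjoint ` \<Psi>"

definition set_hadamard :: "nat set \<Rightarrow> (nat \<Rightarrow> real) \<Rightarrow> (nat \<Rightarrow> rmat set) \<Rightarrow> rmat set" where
  "set_hadamard J \<alpha> \<Psi> = {hadamard J \<alpha> A |A. \<forall>j\<in>J. A j \<in> \<Psi> j}"

text \<open>Real powers on \<open>[0, \<infinity>]\<close>, used for positive exponents only. Suprema are taken in
  \<open>[0, \<infinity>]\<close>, so the supremum over an empty set of matrices is 0.\<close>

definition epowr :: "ennreal \<Rightarrow> real \<Rightarrow> ennreal" (infixr "epowr" 80) where
  "x epowr a = (if x = top then top else ennreal (enn2real x powr a))"

definition generalized_spectral_radius :: "nat set \<Rightarrow> rmat set \<Rightarrow> ennreal" where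
  "generalized_spectral_radius R \<Sigma> =
     limsup (\<lambda>k. (SUP A\<in>set_power R \<Sigma> k. spectral_radius R (mat_op R A)) epowr (1 / real k))"

definition joint_spectral_radius :: "nat set \<Rightarrow> rmat set \<Rightarrow> ennreal" where
  "joint_spectral_radius R \<Sigma> =
     lim (\<lambda>k. (SUP A\<in>set_power R \<Sigma> k. op_norm R (mat_op R A)) epowr (1 / real k))"

section \<open>The transpose is the adjoint\<close>

lemma l2_mult_abs_summable:
  assumes "x \<in> l2 R" "y \<in> l2 R"
  shows "(\<lambda>i. cmod (x i) * cmod (y i)) summable_on R"
proof (rule summable_on_comparison_test)
  show "(\<lambda>i. (cmod (x i))\<^sup>2 + (cmod (y i))\<^sup>2) summable_on R"
    using assms by (intro summable_on_add) (auto simp: l2_def)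
  show "cmod (x i) * cmod (y i) \<le> (cmod (x i))\<^sup>2 + (cmod (y i))\<^sup>2" for i
    using sum_squares_bound[of "cmod (x i)" "cmod (y i)"]
      mult_nonneg_nonneg[OF norm_ge_zero[of "x i"] norm_ge_zero[of "y i"]] by linarith
qed auto

lemma nonneg_operator_matricesD:
  assumes "A \<in> nonneg_operator_matrices R" "x \<in> l2 R"
  shows "i \<in> R \<Longrightarrow> (\<lambda>j. complex_of_real (A i j) * x j) summable_on R"
    and "mat_op R A x \<in> l2 R"
  using assms by (auto simp: nonneg_operator_matrices_def defines_operator_def)

lemma l2_cmod: "x \<in> l2 R \<Longrightarrow> (\<lambda>i. complex_of_real (cmod (x i))) \<in> l2 R"
  by (auto simp: l2_def)

lemma l2_finite_support:
  assumes "finite F" "F \<subseteq> R"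
  shows "(\<lambda>i. if i \<in> F then f i else 0) \<in> l2 R"
proof -
  have "(\<lambda>i. (cmod (if i \<in> F then f i else 0))\<^sup>2) summable_on R \<longleftrightarrow>
        (\<lambda>i. (cmod (if i \<in> F then f i else 0))\<^sup>2) summable_on F"
    using assms by (intro summable_on_cong_neutral) auto
  then show ?thesis using assms by (auto simp: l2_def)
qed

lemma mat_op_real_row:
  assumes A: "A \<in> nonneg_operator_matrices R" and x: "x \<in> l2 R" and i: "i \<in> R"
  shows "(\<lambda>j. A i j * cmod (x j)) summable_on R"
    and "cmod (mat_op R A (\<lambda>i. complex_of_real (cmod (x i))) i) = (\<Sum>\<^sub>\<infinity>j\<in>R. A i j * cmod (x j))"
proof -
  have "(\<lambda>j. complex_of_real (A i j) * complex_of_real (cmod (x j))) summable_on R"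
    using nonneg_operator_matricesD(1)[OF A l2_cmod[OF x] i] .
  then have *: "(\<lambda>j. complex_of_real (A i j * cmod (x j))) summable_on R" by simp
  then show s: "(\<lambda>j. A i j * cmod (x j)) summable_on R"
    using summable_on_bounded_linear[OF bounded_linear_Re *] by simp
  have "(\<Sum>\<^sub>\<infinity>j\<in>R. complex_of_real (A i j * cmod (x j))) =
        complex_of_real (\<Sum>\<^sub>\<infinity>j\<in>R. A i j * cmod (x j))"
    using infsumI[OF has_sum_of_real[OF has_sum_infsum[OF s]]] .
  moreover  have "(\<Sum>\<^sub>\<infinity>j\<in>R. A i j * cmod (x j)) \<ge> 0"
    using A i by (intro infsum_nonneg) (auto simp: nonneg_operator_matrices_def)
  ultimately show "cmod (mat_op R A (\<lambda>i. complex_of_real (cmod (x i))) i) = (\<Sum>\<^sub>\<infinity>j\<in>R. A i j * cmod (x j))"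
    by (simp add: mat_op_def)
qed

lemma mat_form_summable:
  assumes A: "A \<in> nonneg_operator_matrices R" and x: "x \<in> l2 R" and y: "y \<in> l2 R"
  shows "(\<lambda>p. norm ((\<lambda>(i, j). complex_of_real (A i j) * x j * cnj (y i)) p)) summable_on R \<times> R"
proof -
  let ?f = "\<lambda>(i, j). complex_of_real (A i j) * x j * cnj (y i)"
  have n: "norm (?f (i, j)) = A i j * cmod (x j) * cmod (y i)" if "i \<in> R" "j \<in> R" for i j
    using A that by (auto simp: nonneg_operator_matrices_def norm_mult)
  have row: "(\<lambda>j. norm (?f (i, j))) summable_on R" if "i \<in> R" for i
  proof -
    have "(\<lambda>j. A i j * cmod (x j) * cmod (y i)) summable_on R"
      by (intro summable_on_cmult_left mat_op_real_row[OF A x that])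
    then show ?thesis using n that by (simp cong: summable_on_cong)
  qed
  have col: "(\<Sum>\<^sub>\<infinity>j\<in>R. norm (?f (i, j))) =
      cmod (mat_op R A (\<lambda>i. complex_of_real (cmod (x i))) i) * cmod (y i)" if "i \<in> R" for i
  proof -
    have "(\<Sum>\<^sub>\<infinity>j\<in>R. norm (?f (i, j))) = (\<Sum>\<^sub>\<infinity>j\<in>R. A i j * cmod (x j) * cmod (y i))"
      using n that by (intro infsum_cong) auto
    also have "\<dots> = (\<Sum>\<^sub>\<infinity>j\<in>R. A i j * cmod (x j)) * cmod (y i)"
      by (intro infsum_cmult_left mat_op_real_row[OF A x that])
    finally show ?thesis using mat_op_real_row(2)[OF A x that] by simp
  qed
  have "mat_op R A (\<lambda>i. complex_of_real (cmod (x i))) \<in> l2 R"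
    using nonneg_operator_matricesD(2)[OF A l2_cmod[OF x]] .
  then have "(\<lambda>i. cmod (mat_op R A (\<lambda>i. complex_of_real (cmod (x i))) i) * cmod (y i))
      summable_on R"
    using y by (rule l2_mult_abs_summable)
  then have "(\<lambda>i. \<Sum>\<^sub>\<infinity>j\<in>R. norm (?f (i, j))) summable_on R"
    using col by (simp cong: summable_on_cong)
  then have "(\<lambda>i. norm (\<Sum>\<^sub>\<infinity>j\<in>R. norm (?f (i, j)))) summable_on R"
    by (simp add: infsum_nonneg)
  then show ?thesis
    using row unfolding Infinite_Sum.abs_summable_on_Sigma_iff by blast
qed

lemma mat_adjoint_row:
  assumes A: "A \<in> nonneg_operator_matrices R" and y: "y \<in> l2 R" and j: "j \<in> R"
  shows "(\<lambda>i. norm (complex_of_real (A i j) * y i)) summable_on R"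
proof -
  let ?e = "\<lambda>i. if i \<in> {j} then 1 else 0 :: complex"
  have e: "?e \<in> l2 R" using j by (intro l2_finite_support) auto
  have "(\<lambda>(i, k). norm (complex_of_real (A i k) * ?e k * cnj (y i))) summable_on R \<times> R"
    using mat_form_summable[OF A e y] by (simp add: case_prod_unfold)
  then have "(\<lambda>(k, i). norm (complex_of_real (A i k) * ?e k * cnj (y i))) summable_on R \<times> R"
    by (subst summable_on_swap) simp
  from summable_on_SigmaD1[OF this j]
  show ?thesis by (simp add: norm_mult)
qed

lemma mat_adjoint_inner:
  assumes A: "A \<in> nonneg_operator_matrices R" and x: "x \<in> l2 R" and y: "y \<in> l2 R"
  shows "l2_inner R (mat_op R A x) y = l2_inner R x (mat_op R (mat_adjoint A) y)"
proof -
  have s: "(\<lambda>(i, j). complex_of_real (A i j) * x j * cnj (y i)) summable_on R \<times> R"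
    using mat_form_summable[OF A x y] by (rule abs_summable_summable)
  have row: "(\<lambda>j. complex_of_real (A i j) * x j) summable_on R" if "i \<in> R" for i
    using A x that by (auto simp: nonneg_operator_matrices_def defines_operator_def)
  have "l2_inner R (mat_op R A x) y = (\<Sum>\<^sub>\<infinity>i\<in>R. \<Sum>\<^sub>\<infinity>j\<in>R. complex_of_real (A i j) * x j * cnj (y i))"
    unfolding l2_inner_def mat_op_def
    by (intro infsum_cong infsum_cmult_left[symmetric] row)
  also have "\<dots> = (\<Sum>\<^sub>\<infinity>j\<in>R. \<Sum>\<^sub>\<infinity>i\<in>R. complex_of_real (A i j) * x j * cnj (y i))"
    using s by (rule infsum_swap_banach)
  also have "\<dots> = (\<Sum>\<^sub>\<infinity>j\<in>R. x j * cnj (\<Sum>\<^sub>\<infinity>i\<in>R. complex_of_real (A i j) * y i))"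
  proof (rule infsum_cong)
    fix j assume j: "j \<in> R"
    have c: "(\<lambda>i. cnj (complex_of_real (A i j) * y i)) summable_on R"
      using abs_summable_summable[OF mat_adjoint_row[OF A y j]]
      by (simp only: summable_on_cnj_iff)
    have "(\<Sum>\<^sub>\<infinity>i\<in>R. complex_of_real (A i j) * x j * cnj (y i)) =
          (\<Sum>\<^sub>\<infinity>i\<in>R. x j * cnj (complex_of_real (A i j) * y i))"
      by (intro infsum_cong) simp
    also have "\<dots> = x j * (\<Sum>\<^sub>\<infinity>i\<in>R. cnj (complex_of_real (A i j) * y i))"
      using c by (rule infsum_cmult_right)
    also have "\<dots> = x j * cnj (\<Sum>\<^sub>\<infinity>i\<in>R. complex_of_real (A i j) * y i)"
      by (simp only: infsum_cnj)
    finally show "(\<Sum>\<^sub>\<infinity>i\<in>R. complex_of_real (A i j) * x j * cnj (y i)) =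
        x j * cnj (\<Sum>\<^sub>\<infinity>i\<in>R. complex_of_real (A i j) * y i)" .
  qed
  finally show ?thesis by (simp add: l2_inner_def mat_op_def mat_adjoint_def)
qed

text \<open>The transpose of a bounded nonnegative matrix operator is again one, and is its adjoint.\<close>

lemma mat_adjoint_correct:
  assumes A: "A \<in> nonneg_operator_matrices R" and bdd: "op_norm R (mat_op R A) < top"
  shows "mat_adjoint A \<in> nonneg_operator_matrices R"
    and "\<And>x y. x \<in> l2 R \<Longrightarrow> y \<in> l2 R \<Longrightarrow>
           l2_inner R (mat_op R A x) y = l2_inner R x (mat_op R (mat_adjoint A) y)"
proof -
  obtain C0 where C0: "C0 \<ge> 0"
    "\<And>x. x \<in> l2 R \<Longrightarrow> l2_norm R (mat_op R A x) \<le> C0 * l2_norm R x"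
    using bdd unfolding op_norm_def Inf_less_iff by blast
  define C where "C = C0 + 1"
  have C: "C > 0" using C0 by (simp add: C_def)
  have norm_le: "l2_norm R (mat_op R A x) \<le> C * l2_norm R x" if "x \<in> l2 R" for x
  proof -
    have "l2_norm R x \<ge> 0" by (auto simp: l2_norm_def infsum_nonneg)
    then show ?thesis using C0(2)[OF that] by (simp add: C_def algebra_simps)
  qed
  have op: "mat_op R A x \<in> l2 R" if "x \<in> l2 R" for x
    using A that by (auto simp: nonneg_operator_matrices_def defines_operator_def)
  have l2_norm_sq: "(l2_norm R x)\<^sup>2 = (\<Sum>\<^sub>\<infinity>i\<in>R. (cmod (x i))\<^sup>2)" for x
    by (simp add: l2_norm_def infsum_nonneg)
  have inner_le: "cmod (l2_inner R u v) \<le> ((l2_norm R u)\<^sup>2 / C\<^sup>2 + C\<^sup>2 * (l2_norm R v)\<^sup>2) / 2"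
    if u: "u \<in> l2 R" and v: "v \<in> l2 R" for u v
  proof -
    have su: "(\<lambda>i. (cmod (u i))\<^sup>2 * (1 / (2 * C\<^sup>2))) summable_on R"
      using u by (intro summable_on_cmult_left) (auto simp: l2_def)
    have sv: "(\<lambda>i. (cmod (v i))\<^sup>2 * (C\<^sup>2 / 2)) summable_on R"
      using v by (intro summable_on_cmult_left) (auto simp: l2_def)
    have "cmod (l2_inner R u v) \<le> (\<Sum>\<^sub>\<infinity>i\<in>R. cmod (u i * cnj (v i)))"
      unfolding l2_inner_def using l2_mult_abs_summable[OF u v]
      by (intro norm_infsum_bound) (simp add: norm_mult)
    also have "\<dots> \<le> (\<Sum>\<^sub>\<infinity>i\<in>R. (cmod (u i))\<^sup>2 * (1 / (2 * C\<^sup>2)) + (cmod (v i))\<^sup>2 * (C\<^sup>2 / 2))"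
    proof (rule infsum_mono)
      show "(\<lambda>i. cmod (u i * cnj (v i))) summable_on R"
        using l2_mult_abs_summable[OF u v] by (simp add: norm_mult)
      show "(\<lambda>i. (cmod (u i))\<^sup>2 * (1 / (2 * C\<^sup>2)) + (cmod (v i))\<^sup>2 * (C\<^sup>2 / 2)) summable_on R"
        using su sv by (rule summable_on_add)
      show "cmod (u i * cnj (v i)) \<le> (cmod (u i))\<^sup>2 * (1 / (2 * C\<^sup>2)) + (cmod (v i))\<^sup>2 * (C\<^sup>2 / 2)"
        for i
        using sum_squares_bound[of "cmod (u i) / C" "C * cmod (v i)"] C
        by (simp add: norm_mult power_mult_distrib power_divide field_simps)
    qed
    also have "\<dots> = (\<Sum>\<^sub>\<infinity>i\<in>R. (cmod (u i))\<^sup>2 * (1 / (2 * C\<^sup>2))) +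
                 (\<Sum>\<^sub>\<infinity>i\<in>R. (cmod (v i))\<^sup>2 * (C\<^sup>2 / 2))"
      using su sv by (rule infsum_add)
    also have "\<dots> = ((l2_norm R u)\<^sup>2 / C\<^sup>2 + C\<^sup>2 * (l2_norm R v)\<^sup>2) / 2"
      by (simp only: infsum_cmult_left' l2_norm_sq) (use C in \<open>simp add: field_simps\<close>)
    finally show ?thesis .
  qed
  have l2T: "mat_op R (mat_adjoint A) y \<in> l2 R" if y: "y \<in> l2 R" for y
  proof -
    define z where "z = mat_op R (mat_adjoint A) y"
    have "(\<Sum>i\<in>F. (cmod (z i))\<^sup>2) \<le> C\<^sup>2 * (l2_norm R y)\<^sup>2" if F: "finite F" "F \<subseteq> R" for F
    proof -
      define x where "x = (\<lambda>i. if i \<in> F then z i else 0)"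
      define s where "s = (\<Sum>i\<in>F. (cmod (z i))\<^sup>2)"
      have x: "x \<in> l2 R" unfolding x_def by (rule l2_finite_support[OF F])
      have "(l2_norm R x)\<^sup>2 = (\<Sum>\<^sub>\<infinity>i\<in>F. (cmod (x i))\<^sup>2)"
        unfolding l2_norm_sq using F by (intro infsum_cong_neutral) (auto simp: x_def)
      also have "\<dots> = s" using F by (simp add: x_def s_def)
      finally have nx: "(l2_norm R x)\<^sup>2 = s" .
      have "l2_inner R x z = (\<Sum>\<^sub>\<infinity>i\<in>F. x i * cnj (z i))"
        unfolding l2_inner_def using F by (intro infsum_cong_neutral) (auto simp: x_def)
      also have "\<dots> = complex_of_real s"
        using F by (simp add: x_def s_def flip: complex_norm_square)
      finally have "cmod (l2_inner R x z) = s"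
        by (simp only: norm_of_real) (simp add: s_def sum_nonneg)
      then have "s = cmod (l2_inner R (mat_op R A x) y)"
        using mat_adjoint_inner[OF A x y] by (simp add: z_def)
      also have "\<dots> \<le> ((l2_norm R (mat_op R A x))\<^sup>2 / C\<^sup>2 + C\<^sup>2 * (l2_norm R y)\<^sup>2) / 2"
        by (rule inner_le[OF op[OF x] y])
      also have "(l2_norm R (mat_op R A x))\<^sup>2 \<le> (C * l2_norm R x)\<^sup>2"
        by (intro power_mono norm_le x) (simp add: l2_norm_def infsum_nonneg)
      then have "((l2_norm R (mat_op R A x))\<^sup>2 / C\<^sup>2 + C\<^sup>2 * (l2_norm R y)\<^sup>2) / 2 \<le>
                 (s + C\<^sup>2 * (l2_norm R y)\<^sup>2) / 2"
        using C by (simp add: power_mult_distrib nx divide_le_eq mult.commute)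
      finally show ?thesis by (simp add: s_def)
    qed
    then have "(\<lambda>i. (cmod (z i))\<^sup>2) summable_on R"
      by (intro nonneg_bdd_above_summable_on bdd_aboveI2[where M = "C\<^sup>2 * (l2_norm R y)\<^sup>2"]) auto
    moreover have "z i = 0" if "i \<notin> R" for i
      using A that by (auto simp: z_def mat_op_def mat_adjoint_def nonneg_operator_matrices_def)
    ultimately show ?thesis unfolding z_def l2_def by blast
  qed
  have "(\<lambda>i. complex_of_real (mat_adjoint A j i) * y i) summable_on R"
    if "y \<in> l2 R" "j \<in> R" for y j
    using abs_summable_summable[OF mat_adjoint_row[OF A that]] by (simp add: mat_adjoint_def)
  then have "defines_operator R (mat_adjoint A)"
    using l2T by (auto simp: defines_operator_def)
  then show "mat_adjoint A \<in> nonneg_operator_matrices R"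
    using A by (auto simp: nonneg_operator_matrices_def mat_adjoint_def)
  show "l2_inner R (mat_op R A x) y = l2_inner R x (mat_op R (mat_adjoint A) y)"
    if "x \<in> l2 R" "y \<in> l2 R" for x y
    using mat_adjoint_inner[OF A that] .
qed

end

theory Submission
  imports Defs
begin

text \<open>Hoelder's inequality gives, entrywise and for equal exponents of sum at least 1, that a product of
  Hadamard products is dominated by the Hadamard product of the products; together with
  \<open>\<parallel>A\<parallel>\<^sup>2 = \<rho>(A\<^sup>*A)\<close> and the freedom to permute the Hadamard factors this yields the chain.
  The exponent sum only enters through AM-GM: matrices of norm at most 1 have entries at most 1, so
  their Hadamard product with exponents of sum at least 1 is dominated by their arithmetic mean.
  The norm of a nonnegative matrix is handled through its finite sections, and the spectral radius
  formula is proved for nonnegative matrices only, where it needs no complex analysis. It makes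
  \<open>\<rho>(A)\<close> the joint spectral radius of \<open>{A}\<close>, so that the facts about \<open>\<rho>\<close> follow from those about the norm.\<close>

text \<open>Matrices are chosen independently in every Hadamard factor, so a product of Hadamard
  products and the Hadamard product of the products are not comparable as sets. What survives is
  \<open>dominated\<close>: every member of the first lies entrywise below some member of the
  second, and growth rates are monotone under this relation. Both radii are limits of k-th roots of
  suprema over k-fold products, of the norm or of the spectral radius, so the chain is proved once,
  for any \<open>\<phi>\<close> with the laws of \<open>matrix_gauge\<close>. Put n = m/2. A matrix
  A of the first set can be written twice, with its factors ordered differently in A^T and in A, so
  that A^T A lies below a member of the Hadamard product of all m sets \<open>\<Sigma> j\<close>.
  The sets \<open>\<Sigma> (n + j)\<close> are the adjoints of \<open>\<Sigma> j\<close> and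
  contribute no more than those, hence the square root. In an n-fold product the l-th copy is
  shifted cyclically by l, so that slot i collects \<open>\<Theta> i\<close>; all
  \<open>\<Theta> i\<close> are rotations of one product and are bounded by its radius. The
  condition on \<open>\<alpha>\<close> says n \<open>\<alpha>\<close> \<ge> 1, which the Hadamard
  products of n factors need.\<close>

section \<open>Nonnegative matrices with a norm bound\<close>

text \<open>The norm bound of a nonnegative matrix, tested on finite sections and nonnegative
  vectors only, so that entrywise comparison is a termwise estimate; \<open>op_norm_le_iff\<close>
  identifies it with \<open>op_norm\<close>. \<open>F\<close> and \<open>G\<close> may leave
  \<open>R\<close>, where all entries vanish.\<close>

definition op_bound :: "nat set \<Rightarrow> rmat \<Rightarrow> real \<Rightarrow> bool" where
  "op_bound R A c \<longleftrightarrow> 0 \<le> c \<and> (\<forall>i j. 0 \<le> A i j) \<and> (\<forall>i j. A i j \<noteq> 0 \<longrightarrow> i \<in> R \<and> j \<in> R) \<and>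
     (\<forall>F G u. finite F \<longrightarrow> finite G \<longrightarrow> (\<forall>j. 0 \<le> u j) \<longrightarrow>
        L2_set (\<lambda>i. \<Sum>j\<in>G. A i j * u j) F \<le> c * L2_set u G)"

lemma op_boundI:
  assumes "0 \<le> c" "\<And>i j. 0 \<le> A i j" "\<And>i j. A i j \<noteq> 0 \<Longrightarrow> i \<in> R \<and> j \<in> R"
    and "\<And>F G u. finite F \<Longrightarrow> finite G \<Longrightarrow> (\<And>j. 0 \<le> u j) \<Longrightarrow>
        L2_set (\<lambda>i. \<Sum>j\<in>G. A i j * u j) F \<le> c * L2_set u G"
  shows "op_bound R A c"
  using assms unfolding op_bound_def by blast

lemma op_boundD:
  assumes "op_bound R A c"
  shows "0 \<le> c" "0 \<le> A i j" "A i j \<noteq> 0 \<Longrightarrow> i \<in> R \<and> j \<in> R"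
    "finite F \<Longrightarrow> finite G \<Longrightarrow> (\<And>j. 0 \<le> u j) \<Longrightarrow>
        L2_set (\<lambda>i. \<Sum>j\<in>G. A i j * u j) F \<le> c * L2_set u G"
  using assms unfolding op_bound_def by blast+

lemma op_bound_outside:
  assumes "op_bound R A c" "i \<notin> R \<or> j \<notin> R"
  shows "A i j = 0"
  using assms unfolding op_bound_def by blast

lemma op_bound_mono:
  assumes B: "op_bound R B c" and le: "\<And>i j. 0 \<le> A i j" "\<And>i j. A i j \<le> B i j" and cd: "c \<le> d"
  shows "op_bound R A d"
proof (rule op_boundI)
  show "0 \<le> d" using op_boundD(1)[OF B] cd by simp
  show "0 \<le> A i j" for i j by (rule le)
  show "i \<in> R \<and> j \<in> R" if "A i j \<noteq> 0" for i j
    using that le[of i j] op_boundD(3)[OF B, of i j] by fastforce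
  fix F G :: "nat set" and u :: "nat \<Rightarrow> real"
  assume F: "finite F" "finite G" and u: "\<And>j. 0 \<le> u j"
  have "L2_set (\<lambda>i. \<Sum>j\<in>G. A i j * u j) F \<le> L2_set (\<lambda>i. \<Sum>j\<in>G. B i j * u j) F"
    by (intro L2_set_mono sum_mono mult_right_mono sum_nonneg mult_nonneg_nonneg le u)
  also have "\<dots> \<le> c * L2_set u G" by (rule op_boundD(4)[OF B F u])
  also have "\<dots> \<le> d * L2_set u G" by (intro mult_right_mono cd) simp
  finally show "L2_set (\<lambda>i. \<Sum>j\<in>G. A i j * u j) F \<le> d * L2_set u G" .
qed

lemma op_bound_weaken: "op_bound R A c \<Longrightarrow> c \<le> d \<Longrightarrow> op_bound R A d"
  by (rule op_bound_mono) (auto dest: op_boundD)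

lemma op_bound_entry:
  assumes "op_bound R A c" shows "A i j \<le> c"
  using op_boundD(4)[OF assms, of "{i}" "{j}" "\<lambda>_. 1"] op_boundD(2)[OF assms, of i j]
  by (simp add: L2_set_def)

text \<open>Infima and limsups yield a bound only for each \<open>d\<close> above \<open>c\<close>;
  since every section inequality is finite, \<open>d\<close> can decrease to
  \<open>c\<close>.\<close>

lemma op_bound_closed:
  assumes "\<And>d. c < d \<Longrightarrow> op_bound R A d" and "0 \<le> c"
  shows "op_bound R A c"
proof (rule op_boundI)
  note A = assms(1)[of "c + 1", simplified]
  show "0 \<le> A i j" "A i j \<noteq> 0 \<Longrightarrow> i \<in> R \<and> j \<in> R" for i j
    using op_boundD(2,3)[OF A] by auto
  fix F G :: "nat set" and u :: "nat \<Rightarrow> real"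
  assume F: "finite F" "finite G" and u: "\<And>j. 0 \<le> u j"
  have "((\<lambda>d. d * L2_set u G) \<longlongrightarrow> c * L2_set u G) (at_right c)"
    by (intro tendsto_intros)
  moreover have "\<forall>\<^sub>F d in at_right c. L2_set (\<lambda>i. \<Sum>j\<in>G. A i j * u j) F \<le> d * L2_set u G"
    using op_boundD(4)[OF assms(1) F u] by (auto simp: eventually_at_right_less intro: eventually_mono[OF eventually_at_right_less])
  ultimately show "L2_set (\<lambda>i. \<Sum>j\<in>G. A i j * u j) F \<le> c * L2_set u G"
    by (rule tendsto_lowerbound) simp
qed fact

lemma op_bound_add:
  assumes A: "op_bound R A c" and B: "op_bound R B d"
  shows "op_bound R (\<lambda>i j. A i j + B i j) (c + d)"
proof (rule op_boundI)
  show "0 \<le> c + d" using op_boundD(1)[OF A] op_boundD(1)[OF B] by simp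
  show "0 \<le> A i j + B i j" for i j using op_boundD(2)[OF A] op_boundD(2)[OF B] by simp
  show "i \<in> R \<and> j \<in> R" if "A i j + B i j \<noteq> 0" for i j
    using that op_boundD(3)[OF A, of i j] op_boundD(3)[OF B, of i j] by (cases "A i j = 0") auto
  fix F G :: "nat set" and u :: "nat \<Rightarrow> real"
  assume F: "finite F" "finite G" and u: "\<And>j. 0 \<le> u j"
  have "L2_set (\<lambda>i. \<Sum>j\<in>G. (A i j + B i j) * u j) F
      \<le> L2_set (\<lambda>i. \<Sum>j\<in>G. A i j * u j) F + L2_set (\<lambda>i. \<Sum>j\<in>G. B i j * u j) F"
    using L2_set_triangle_ineq by (simp add: distrib_right sum.distrib)
  also have "\<dots> \<le> c * L2_set u G + d * L2_set u G"
    by (intro add_mono op_boundD(4)[OF A] op_boundD(4)[OF B] F u)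
  finally show "L2_set (\<lambda>i. \<Sum>j\<in>G. (A i j + B i j) * u j) F \<le> (c + d) * L2_set u G"
    by (simp add: distrib_right)
qed

lemma op_bound_scale:
  assumes A: "op_bound R A c" and t: "0 \<le> t"
  shows "op_bound R (\<lambda>i j. t * A i j) (t * c)"
proof (rule op_boundI)
  show "0 \<le> t * c" "0 \<le> t * A i j" for i j using op_boundD(1,2)[OF A] t by simp_all
  show "i \<in> R \<and> j \<in> R" if "t * A i j \<noteq> 0" for i j
    using that op_boundD(3)[OF A] by auto
  fix F G :: "nat set" and u :: "nat \<Rightarrow> real"
  assume F: "finite F" "finite G" and u: "\<And>j. 0 \<le> u j"
  have "L2_set (\<lambda>i. \<Sum>j\<in>G. t * A i j * u j) F = t * L2_set (\<lambda>i. \<Sum>j\<in>G. A i j * u j) F"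
    using t by (simp add: L2_set_right_distrib sum_distrib_left mult.assoc)
  then show "L2_set (\<lambda>i. \<Sum>j\<in>G. t * A i j * u j) F \<le> t * c * L2_set u G"
    using mult_left_mono[OF op_boundD(4)[OF A F u] t] by (simp add: mult.assoc)
qed

lemma op_bound_zero: "op_bound R (\<lambda>_ _. 0) 0"
  by (rule op_boundI) (auto simp: L2_set_def)

lemma op_bound_sum:
  assumes "finite J" "\<And>l. l \<in> J \<Longrightarrow> op_bound R (A l) (c l)"
  shows "op_bound R (\<lambda>i j. \<Sum>l\<in>J. A l i j) (\<Sum>l\<in>J. c l)"
  using assms by (induction J) (auto intro: op_bound_zero op_bound_add)

lemma op_bound_one: "op_bound R (mat_one R) 1"
proof (rule op_boundI)
  fix F G :: "nat set" and u :: "nat \<Rightarrow> real"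
  assume F: "finite F" "finite G" and u: "\<And>j. 0 \<le> u j"
  have *: "(\<Sum>j\<in>G. mat_one R i j * u j) = (if i \<in> G \<inter> R then u i else 0)" for i
  proof -
    have "(\<Sum>j\<in>G. mat_one R i j * u j) = (\<Sum>j\<in>G. if i = j then (if i \<in> R then u i else 0) else 0)"
      by (intro sum.cong) (auto simp: mat_one_def)
    then show ?thesis using F(2) by simp
  qed
  have "(\<Sum>i\<in>F. (if i \<in> G \<inter> R then u i else 0)\<^sup>2) = (\<Sum>i\<in>F \<inter> (G \<inter> R). (u i)\<^sup>2)"
    using F(1) by (intro sum.mono_neutral_cong_right) auto
  also have "\<dots> \<le> (\<Sum>i\<in>G. (u i)\<^sup>2)" using F(2) by (intro sum_mono2) auto
  finally show "L2_set (\<lambda>i. \<Sum>j\<in>G. mat_one R i j * u j) F \<le> 1 * L2_set u G"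
    by (simp add: * L2_set_def)
qed (auto simp: mat_one_def split: if_splits)

section \<open>Adjoints, products and the C*-identity for norm bounds\<close>

lemma sum_mult_le_L2_set:
  assumes "\<And>i. 0 \<le> f i" "\<And>i. 0 \<le> g i"
  shows "(\<Sum>i\<in>F. f i * g i) \<le> L2_set f F * L2_set g F"
  using L2_set_mult_ineq[of f g F] assms by simp

lemma L2_set_power2: "finite F \<Longrightarrow> (L2_set f F)\<^sup>2 = (\<Sum>i\<in>F. (f i)\<^sup>2)"
  by (simp add: L2_set_def sum_nonneg)

lemma le_of_square_le_mult:
  fixes x b :: real
  assumes "x\<^sup>2 \<le> b * x" "0 \<le> b" "0 \<le> x"
  shows "x \<le> b"
  using assms by (cases "x = 0") (auto simp: power2_eq_square)

text \<open>With w = A^T u cut to \<open>F\<close>, |w|^2 = <u, A w> \<le> c |u| |w|, and one factor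
  |w| cancels.\<close>

lemma op_bound_adjoint:
  assumes A: "op_bound R A c"
  shows "op_bound R (mat_adjoint A) c"
proof (rule op_boundI)
  show "0 \<le> c" "0 \<le> mat_adjoint A i j" "mat_adjoint A i j \<noteq> 0 \<Longrightarrow> i \<in> R \<and> j \<in> R" for i j
    using op_boundD(1-3)[OF A] by (auto simp: mat_adjoint_def)
  fix F G :: "nat set" and u :: "nat \<Rightarrow> real"
  assume F: "finite F" "finite G" and u: "\<And>j. 0 \<le> u j"
  define w where "w = (\<lambda>i. \<Sum>j\<in>G. mat_adjoint A i j * u j)"
  have w: "0 \<le> w i" for i
    unfolding w_def mat_adjoint_def by (intro sum_nonneg mult_nonneg_nonneg op_boundD(2)[OF A] u)
  have "(L2_set w F)\<^sup>2 = (\<Sum>i\<in>F. w i * (\<Sum>j\<in>G. A j i * u j))"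
    unfolding L2_set_power2[OF F(1)] by (simp add: power2_eq_square w_def mat_adjoint_def)
  also have "\<dots> = (\<Sum>j\<in>G. u j * (\<Sum>i\<in>F. A j i * w i))"
    unfolding sum_distrib_left by (subst sum.swap) (simp add: mult_ac)
  also have "\<dots> \<le> L2_set u G * L2_set (\<lambda>j. \<Sum>i\<in>F. A j i * w i) G"
    by (intro sum_mult_le_L2_set u sum_nonneg mult_nonneg_nonneg op_boundD(2)[OF A] w)
  also have "\<dots> \<le> L2_set u G * (c * L2_set w F)"
    by (intro mult_left_mono op_boundD(4)[OF A] F w) simp
  finally have "(L2_set w F)\<^sup>2 \<le> (c * L2_set u G) * L2_set w F" by (simp add: mult_ac)
  then show "L2_set (\<lambda>i. \<Sum>j\<in>G. mat_adjoint A i j * u j) F \<le> c * L2_set u G"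
    unfolding w_def[symmetric] by (rule le_of_square_le_mult) (simp_all add: op_boundD(1)[OF A])
qed

text \<open>A partial sum is entry \<open>i\<close> of \<open>A\<close> applied to column
  \<open>k\<close> of \<open>B\<close> cut to \<open>G\<close>, and a column of \<open>B\<close> has
  norm at most \<open>d\<close>.\<close>

lemma mat_mult_summable:
  assumes A: "op_bound R A c" and B: "op_bound R B d"
  shows "(\<lambda>j. A i j * B j k) summable_on R"
proof (rule nonneg_bdd_above_summable_on)
  show "0 \<le> A i j * B j k" for j using op_boundD(2)[OF A] op_boundD(2)[OF B] by simp
  have "(\<Sum>j\<in>G. A i j * B j k) \<le> c * d" if "finite G" for G
  proof -
    have "(\<Sum>j\<in>G. A i j * B j k) \<le> L2_set (\<lambda>i. \<Sum>j\<in>G. A i j * B j k) {i}"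
      by (intro member_le_L2_set) auto
    also have "\<dots> \<le> c * L2_set (\<lambda>j. \<Sum>k\<in>{k}. B j k * 1) G"
      using op_boundD(4)[OF A, of "{i}" G "\<lambda>j. B j k"] that op_boundD(2)[OF B] by simp
    also have "\<dots> \<le> c * (d * L2_set (\<lambda>_. 1) {k})"
      using op_boundD(4)[OF B, of G "{k}" "\<lambda>_. 1"] that op_boundD(1)[OF A] by (intro mult_left_mono) auto
    finally show ?thesis by simp
  qed
  then show "bdd_above (sum (\<lambda>j. A i j * B j k) ` {F. F \<subseteq> R \<and> finite F})"
    by (intro bdd_aboveI2[where M = "c * d"]) auto
qed

text \<open>With the inner index cut to a finite \<open>H\<close>, a section of the product is a
  section of \<open>A\<close> after one of \<open>B\<close>; the bound does not depend on
  \<open>H\<close> and passes to the limit.\<close>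

lemma op_bound_mult:
  assumes A: "op_bound R A c" and B: "op_bound R B d"
  shows "op_bound R (mat_mult R A B) (c * d)"
proof (rule op_boundI)
  show "0 \<le> c * d" using op_boundD(1)[OF A] op_boundD(1)[OF B] by simp
  show "0 \<le> mat_mult R A B i j" for i j
    unfolding mat_mult_def by (intro infsum_nonneg mult_nonneg_nonneg op_boundD(2)[OF A] op_boundD(2)[OF B])
  show "i \<in> R \<and> k \<in> R" if "mat_mult R A B i k \<noteq> 0" for i k
  proof (rule ccontr)
    assume "\<not> (i \<in> R \<and> k \<in> R)"
    then have "A i j * B j k = 0" for j
      using op_bound_outside[OF A, of i j] op_bound_outside[OF B, of j k] by auto
    then have "mat_mult R A B i k = (\<Sum>\<^sub>\<infinity>j\<in>R. 0)"
      unfolding mat_mult_def by (simp only:)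
    then show False using that by simp
  qed
  fix F G :: "nat set" and u :: "nat \<Rightarrow> real"
  assume F: "finite F" "finite G" and u: "\<And>j. 0 \<le> u j"
  have lim: "((\<lambda>H. \<Sum>j\<in>H. A i j * B j k) \<longlongrightarrow> mat_mult R A B i k) (finite_subsets_at_top R)" for i k
    unfolding mat_mult_def by (rule infsum_tendsto[OF mat_mult_summable[OF A B]])
  have "((\<lambda>H. L2_set (\<lambda>i. \<Sum>k\<in>G. (\<Sum>j\<in>H. A i j * B j k) * u k) F) \<longlongrightarrow>
      L2_set (\<lambda>i. \<Sum>k\<in>G. mat_mult R A B i k * u k) F) (finite_subsets_at_top R)"
    unfolding L2_set_def by (intro tendsto_intros lim)
  moreover have "\<forall>\<^sub>F H in finite_subsets_at_top R.
      L2_set (\<lambda>i. \<Sum>k\<in>G. (\<Sum>j\<in>H. A i j * B j k) * u k) F \<le> c * d * L2_set u G"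
  proof (rule eventually_finite_subsets_at_top_weakI)
    fix H assume H: "finite H" "H \<subseteq> R"
    have "(\<Sum>k\<in>G. (\<Sum>j\<in>H. A i j * B j k) * u k) = (\<Sum>j\<in>H. A i j * (\<Sum>k\<in>G. B j k * u k))" for i
      unfolding sum_distrib_left sum_distrib_right by (subst sum.swap) (simp add: mult_ac)
    then have "L2_set (\<lambda>i. \<Sum>k\<in>G. (\<Sum>j\<in>H. A i j * B j k) * u k) F
        = L2_set (\<lambda>i. \<Sum>j\<in>H. A i j * (\<Sum>k\<in>G. B j k * u k)) F" by simp
    also have "\<dots> \<le> c * L2_set (\<lambda>j. \<Sum>k\<in>G. B j k * u k) H"
      by (intro op_boundD(4)[OF A] F H sum_nonneg mult_nonneg_nonneg op_boundD(2)[OF B] u)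
    also have "\<dots> \<le> c * (d * L2_set u G)"
      by (intro mult_left_mono op_boundD(4)[OF B] F H u op_boundD(1)[OF A])
    finally show "L2_set (\<lambda>i. \<Sum>k\<in>G. (\<Sum>j\<in>H. A i j * B j k) * u k) F \<le> c * d * L2_set u G"
      by (simp add: mult.assoc)
  qed
  ultimately show "L2_set (\<lambda>i. \<Sum>k\<in>G. mat_mult R A B i k * u k) F \<le> c * d * L2_set u G"
    by (rule tendsto_upperbound) simp
qed

lemma mat_mult_mono:
  assumes "op_bound R A' c" "op_bound R B' d" "\<And>i j. 0 \<le> A i j" "\<And>i j. A i j \<le> A' i j"
    "\<And>i j. 0 \<le> B i j" "\<And>i j. B i j \<le> B' i j"
  shows "mat_mult R A B i k \<le> mat_mult R A' B' i k"
proof -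
  have "op_bound R A c" "op_bound R B d" using assms op_bound_mono by blast+
  then show ?thesis unfolding mat_mult_def
    by (intro infsum_mono mat_mult_summable mult_mono assms order_trans[OF assms(3,4)])
       (assumption | rule assms)+
qed

lemma mat_adjoint_mult: "mat_adjoint (mat_mult R A B) = mat_mult R (mat_adjoint B) (mat_adjoint A)"
  by (simp add: mat_adjoint_def mat_mult_def mult.commute)

lemma mat_adjoint_adjoint [simp]: "mat_adjoint (mat_adjoint A) = A"
  by (simp add: mat_adjoint_def)

lemma mat_adjoint_one [simp]: "mat_adjoint (mat_one R) = mat_one R"
  by (auto simp: mat_adjoint_def mat_one_def fun_eq_iff)

text \<open>|A u|^2 = <u, A^T A u>, the nontrivial half of the C*-identity. Summing over the rows in
  \<open>F\<close> alone gives entries below those of A^T A, which is harmless since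
  \<open>u\<close> is nonnegative. The value of \<open>d\<close> does not enter the result; it
  guarantees that the entries of A^T A converge.\<close>

lemma op_bound_cstar:
  assumes A: "op_bound R A d" and AA: "op_bound R (mat_mult R (mat_adjoint A) A) (c\<^sup>2)" and c: "0 \<le> c"
  shows "op_bound R A c"
proof (rule op_boundI)
  show "0 \<le> A i j" "A i j \<noteq> 0 \<Longrightarrow> i \<in> R \<and> j \<in> R" for i j
    using op_boundD(2,3)[OF A] by auto
  fix F G :: "nat set" and u :: "nat \<Rightarrow> real"
  assume F: "finite F" "finite G" and u: "\<And>j. 0 \<le> u j"
  let ?S = "mat_mult R (mat_adjoint A) A"
  have S: "(\<Sum>i\<in>F. A i j * A i k) \<le> ?S j k" for j k
  proof -
    have "(\<Sum>i\<in>F. A i j * A i k) = (\<Sum>i\<in>F \<inter> R. A i j * A i k)"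
      using F(1) op_bound_outside[OF A] by (intro sum.mono_neutral_right) auto
    also have "\<dots> \<le> ?S j k"
      using F(1) mat_mult_summable[OF op_bound_adjoint[OF A] A, of j k] op_boundD(2)[OF A]
      unfolding mat_mult_def mat_adjoint_def by (intro finite_sum_le_infsum) auto
    finally show ?thesis .
  qed
  have "(L2_set (\<lambda>i. \<Sum>j\<in>G. A i j * u j) F)\<^sup>2 = (\<Sum>i\<in>F. \<Sum>j\<in>G. \<Sum>k\<in>G. u j * (A i j * A i k * u k))"
    unfolding L2_set_power2[OF F(1)] by (simp add: power2_eq_square sum_product mult_ac)
  also have "\<dots> = (\<Sum>j\<in>G. u j * (\<Sum>k\<in>G. (\<Sum>i\<in>F. A i j * A i k) * u k))"
    unfolding sum_distrib_left sum_distrib_right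
    by (rule trans[OF sum.swap], rule sum.cong[OF refl], rule sum.swap)
  also have "\<dots> \<le> (\<Sum>j\<in>G. u j * (\<Sum>k\<in>G. ?S j k * u k))"
    by (intro sum_mono mult_left_mono mult_right_mono S u)
  also have "\<dots> \<le> L2_set u G * L2_set (\<lambda>j. \<Sum>k\<in>G. ?S j k * u k) G"
    by (intro sum_mult_le_L2_set u sum_nonneg mult_nonneg_nonneg op_boundD(2)[OF AA])
  also have "\<dots> \<le> L2_set u G * (c\<^sup>2 * L2_set u G)"
    by (intro mult_left_mono op_boundD(4)[OF AA] F u) simp
  also have "\<dots> = (c * L2_set u G)\<^sup>2" by (simp add: power2_eq_square mult_ac)
  finally show "L2_set (\<lambda>i. \<Sum>j\<in>G. A i j * u j) F \<le> c * L2_set u G"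
    by (rule power2_le_imp_le) (simp add: c)
qed fact

section \<open>Vectors of l2 and the operators of bounded matrices\<close>

lemma l2_norm_nonneg [simp]: "0 \<le> l2_norm R x"
  by (simp add: l2_norm_def infsum_nonneg)

lemma l2I:
  assumes "\<And>i. i \<notin> R \<Longrightarrow> x i = 0" and C: "\<And>F. finite F \<Longrightarrow> L2_set (\<lambda>i. cmod (x i)) F \<le> C"
  shows "x \<in> l2 R" "l2_norm R x \<le> C"
proof -
  have C0: "0 \<le> C" using C[of "{}"] by simp
  have le: "(\<Sum>i\<in>F. (cmod (x i))\<^sup>2) \<le> C\<^sup>2" if "finite F" for F
    using power_mono[OF C[OF that], of 2] that by (simp add: L2_set_power2)
  then have s: "(\<lambda>i. (cmod (x i))\<^sup>2) summable_on R"
    by (intro nonneg_bdd_above_summable_on bdd_aboveI2[where M = "C\<^sup>2"]) auto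
  then show "x \<in> l2 R" using assms(1) by (auto simp: l2_def)
  have "(\<Sum>\<^sub>\<infinity>i\<in>R. (cmod (x i))\<^sup>2) \<le> C\<^sup>2"
    using le by (intro infsum_le_finite_sums[OF s])
  then show "l2_norm R x \<le> C" unfolding l2_norm_def using C0 by (intro real_le_lsqrt) (auto simp: infsum_nonneg)
qed

lemma L2_set_le_l2_norm:
  assumes x: "x \<in> l2 R" and F: "finite F"
  shows "L2_set (\<lambda>i. cmod (x i)) F \<le> l2_norm R x"
proof -
  have "(\<Sum>i\<in>F. (cmod (x i))\<^sup>2) = (\<Sum>i\<in>F \<inter> R. (cmod (x i))\<^sup>2)"
    using x F by (intro sum.mono_neutral_right) (auto simp: l2_def)
  also have "\<dots> \<le> (\<Sum>\<^sub>\<infinity>i\<in>R. (cmod (x i))\<^sup>2)"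
    using x F by (intro finite_sum_le_infsum) (auto simp: l2_def)
  finally show ?thesis by (simp add: L2_set_def l2_norm_def)
qed

lemma l2_outside: "x \<in> l2 R \<Longrightarrow> i \<notin> R \<Longrightarrow> x i = 0"
  by (simp add: l2_def)

lemma cmod_le_l2_norm: "x \<in> l2 R \<Longrightarrow> cmod (x i) \<le> l2_norm R x"
  using L2_set_le_l2_norm[of x R "{i}"] by (simp add: L2_set_def)

lemma l2_zero: "(\<lambda>_. 0) \<in> l2 R" "l2_norm R (\<lambda>_. 0) = 0"
  by (auto simp: l2_def l2_norm_def)

lemma l2_add:
  assumes "x \<in> l2 R" "y \<in> l2 R"
  shows "(\<lambda>i. x i + y i) \<in> l2 R" "l2_norm R (\<lambda>i. x i + y i) \<le> l2_norm R x + l2_norm R y"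
proof -
  have le: "L2_set (\<lambda>i. cmod (x i + y i)) F \<le> l2_norm R x + l2_norm R y" if F: "finite F" for F
  proof -
    have "L2_set (\<lambda>i. cmod (x i + y i)) F \<le> L2_set (\<lambda>i. cmod (x i) + cmod (y i)) F"
      by (intro L2_set_mono norm_triangle_ineq) simp
    also have "\<dots> \<le> L2_set (\<lambda>i. cmod (x i)) F + L2_set (\<lambda>i. cmod (y i)) F"
      by (rule L2_set_triangle_ineq)
    finally show ?thesis using assms[THEN L2_set_le_l2_norm, OF F] by linarith
  qed
  show "(\<lambda>i. x i + y i) \<in> l2 R" "l2_norm R (\<lambda>i. x i + y i) \<le> l2_norm R x + l2_norm R y"
    by (rule l2I; use assms le in \<open>auto simp: l2_outside\<close>)+
qed

lemma l2_scale:
  assumes "x \<in> l2 R"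
  shows "(\<lambda>i. c * x i) \<in> l2 R" "l2_norm R (\<lambda>i. c * x i) \<le> cmod c * l2_norm R x"
proof -
  have le: "L2_set (\<lambda>i. cmod (c * x i)) F \<le> cmod c * l2_norm R x" if F: "finite F" for F
    using mult_left_mono[OF L2_set_le_l2_norm[OF assms F] norm_ge_zero[of c]]
    by (simp add: norm_mult L2_set_right_distrib)
  show "(\<lambda>i. c * x i) \<in> l2 R" "l2_norm R (\<lambda>i. c * x i) \<le> cmod c * l2_norm R x"
    by (rule l2I; use assms le in \<open>auto simp: l2_outside\<close>)+
qed

lemma l2_diff:
  assumes "x \<in> l2 R" "y \<in> l2 R"
  shows "(\<lambda>i. x i - y i) \<in> l2 R" "l2_norm R (\<lambda>i. x i - y i) \<le> l2_norm R x + l2_norm R y"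
  using l2_add[OF assms(1) l2_scale(1)[OF assms(2), of "-1"]] l2_scale(2)[OF assms(2), of "-1"] by auto

lemma l2_sum:
  assumes "finite L" "\<And>l. l \<in> L \<Longrightarrow> x l \<in> l2 R"
  shows "(\<lambda>i. \<Sum>l\<in>L. x l i) \<in> l2 R" "l2_norm R (\<lambda>i. \<Sum>l\<in>L. x l i) \<le> (\<Sum>l\<in>L. l2_norm R (x l))"
proof -
  have "(\<lambda>i. \<Sum>l\<in>L. x l i) \<in> l2 R \<and> l2_norm R (\<lambda>i. \<Sum>l\<in>L. x l i) \<le> (\<Sum>l\<in>L. l2_norm R (x l))"
    using assms
  proof (induction L)
    case empty
    then show ?case by (simp add: l2_zero)
  next
    case (insert l L)
    then show ?case
      using l2_add[of "x l" R "\<lambda>i. \<Sum>l\<in>L. x l i"] by auto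
  qed
  then show "(\<lambda>i. \<Sum>l\<in>L. x l i) \<in> l2 R" "l2_norm R (\<lambda>i. \<Sum>l\<in>L. x l i) \<le> (\<Sum>l\<in>L. l2_norm R (x l))"
    by auto
qed

lemma op_bound_row_summable:
  assumes A: "op_bound R A c" and x: "x \<in> l2 R"
  shows "(\<lambda>j. norm (complex_of_real (A i j) * x j)) summable_on R"
    and "(\<lambda>j. complex_of_real (A i j) * x j) summable_on R"
proof -
  have "(\<Sum>j\<in>G. A i j * cmod (x j)) \<le> c * l2_norm R x" if "finite G" for G
  proof -
    have "(\<Sum>j\<in>G. A i j * cmod (x j)) \<le> L2_set (\<lambda>i. \<Sum>j\<in>G. A i j * cmod (x j)) {i}"
      by (intro member_le_L2_set) auto
    also have "\<dots> \<le> c * L2_set (\<lambda>j. cmod (x j)) G"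
      using that by (intro op_boundD(4)[OF A]) auto
    also have "\<dots> \<le> c * l2_norm R x"
      by (intro mult_left_mono L2_set_le_l2_norm x that op_boundD(1)[OF A])
    finally show ?thesis .
  qed
  then show 1: "(\<lambda>j. norm (complex_of_real (A i j) * x j)) summable_on R"
    using op_boundD(2)[OF A]
    by (intro nonneg_bdd_above_summable_on bdd_aboveI2[where M = "c * l2_norm R x"]) (auto simp: norm_mult)
  then show "(\<lambda>j. complex_of_real (A i j) * x j) summable_on R"
    by (rule abs_summable_summable)
qed

text \<open>On a finite index set \<open>G\<close> the vector may be replaced by its moduli, a
  nonnegative test vector; the resulting bound does not depend on \<open>G\<close> and passes to the
  limit.\<close>

lemma op_bound_mat_op:
  assumes A: "op_bound R A c" and x: "x \<in> l2 R"
  shows "mat_op R A x \<in> l2 R" "l2_norm R (mat_op R A x) \<le> c * l2_norm R x"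
proof -
  have le: "L2_set (\<lambda>i. cmod (mat_op R A x i)) F \<le> c * l2_norm R x" if F: "finite F" for F
  proof -
    have lim: "((\<lambda>G. \<Sum>j\<in>G. complex_of_real (A i j) * x j) \<longlongrightarrow> mat_op R A x i) (finite_subsets_at_top R)" for i
      unfolding mat_op_def by (rule infsum_tendsto[OF op_bound_row_summable(2)[OF A x]])
    have "((\<lambda>G. L2_set (\<lambda>i. cmod (\<Sum>j\<in>G. complex_of_real (A i j) * x j)) F) \<longlongrightarrow>
        L2_set (\<lambda>i. cmod (mat_op R A x i)) F) (finite_subsets_at_top R)"
      unfolding L2_set_def by (intro tendsto_intros lim)
    moreover have "\<forall>\<^sub>F G in finite_subsets_at_top R.
        L2_set (\<lambda>i. cmod (\<Sum>j\<in>G. complex_of_real (A i j) * x j)) F \<le> c * l2_norm R x"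
    proof (rule eventually_finite_subsets_at_top_weakI)
      fix G assume G: "finite G" "G \<subseteq> R"
      have "L2_set (\<lambda>i. cmod (\<Sum>j\<in>G. complex_of_real (A i j) * x j)) F \<le>
          L2_set (\<lambda>i. \<Sum>j\<in>G. A i j * cmod (x j)) F"
        by (intro L2_set_mono order_trans[OF norm_sum] sum_mono) (auto simp: norm_mult op_boundD(2)[OF A])
      also have "\<dots> \<le> c * L2_set (\<lambda>j. cmod (x j)) G"
        using G by (intro op_boundD(4)[OF A] F) auto
      also have "\<dots> \<le> c * l2_norm R x"
        by (intro mult_left_mono L2_set_le_l2_norm x G op_boundD(1)[OF A])
      finally show "L2_set (\<lambda>i. cmod (\<Sum>j\<in>G. complex_of_real (A i j) * x j)) F \<le> c * l2_norm R x" .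
    qed
    ultimately show ?thesis by (rule tendsto_upperbound) simp
  qed
  have out: "mat_op R A x i = 0" if "i \<notin> R" for i
    using op_bound_outside[OF A, of i] that by (simp add: mat_op_def)
  show "mat_op R A x \<in> l2 R" "l2_norm R (mat_op R A x) \<le> c * l2_norm R x"
    by (rule l2I; use out le in auto)+
qed

lemma mat_op_finite_support:
  assumes "finite G" "G \<subseteq> R"
  shows "mat_op R A (\<lambda>j. if j \<in> G then complex_of_real (u j) else 0) i = complex_of_real (\<Sum>j\<in>G. A i j * u j)"
proof -
  have "mat_op R A (\<lambda>j. if j \<in> G then complex_of_real (u j) else 0) i =
      (\<Sum>\<^sub>\<infinity>j\<in>G. complex_of_real (A i j * u j))"
    unfolding mat_op_def using assms by (intro infsum_cong_neutral) auto
  then show ?thesis using assms by simp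
qed

lemma op_boundI_mat_op:
  assumes "0 \<le> c" "\<And>i j. 0 \<le> A i j" "\<And>i j. A i j \<noteq> 0 \<Longrightarrow> i \<in> R \<and> j \<in> R"
    and A: "\<And>x. x \<in> l2 R \<Longrightarrow> mat_op R A x \<in> l2 R \<and> l2_norm R (mat_op R A x) \<le> c * l2_norm R x"
  shows "op_bound R A c"
proof (rule op_boundI)
  fix F G :: "nat set" and u :: "nat \<Rightarrow> real"
  assume F: "finite F" "finite G" and u: "\<And>j. 0 \<le> u j"
  define x where "x = (\<lambda>j. if j \<in> G \<inter> R then complex_of_real (u j) else 0)"
  have x: "x \<in> l2 R" unfolding x_def using F by (intro l2_finite_support) auto
  have Ax: "mat_op R A x i = complex_of_real (\<Sum>j\<in>G. A i j * u j)" for i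
  proof -
    have "mat_op R A x i = complex_of_real (\<Sum>j\<in>G \<inter> R. A i j * u j)"
      unfolding x_def using F by (intro mat_op_finite_support) auto
    also have "(\<Sum>j\<in>G \<inter> R. A i j * u j) = (\<Sum>j\<in>G. A i j * u j)"
      by (rule sum.mono_neutral_left) (use F assms(3)[of i] in auto)
    finally show ?thesis .
  qed
  have "l2_norm R x \<le> L2_set u G"
  proof (rule l2I(2))
    show "x i = 0" if "i \<notin> R" for i using that by (simp add: x_def)
    fix H :: "nat set" assume H: "finite H"
    have "(\<Sum>i\<in>H. (cmod (x i))\<^sup>2) = (\<Sum>i\<in>H \<inter> (G \<inter> R). (u i)\<^sup>2)"
      using H u by (intro sum.mono_neutral_cong_right) (auto simp: x_def)
    also have "\<dots> \<le> (\<Sum>i\<in>G. (u i)\<^sup>2)" using F by (intro sum_mono2) auto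
    finally show "L2_set (\<lambda>i. cmod (x i)) H \<le> L2_set u G" by (simp add: L2_set_def)
  qed
  have "L2_set (\<lambda>i. \<Sum>j\<in>G. A i j * u j) F = L2_set (\<lambda>i. cmod (mat_op R A x i)) F"
    by (simp only: Ax L2_set_def norm_of_real power2_abs)
  also have "\<dots> \<le> l2_norm R (mat_op R A x)" using A[OF x] F by (intro L2_set_le_l2_norm) auto
  also have "\<dots> \<le> c * l2_norm R x" using A[OF x] by blast
  also have "\<dots> \<le> c * L2_set u G" by (intro mult_left_mono) fact+
  finally show "L2_set (\<lambda>i. \<Sum>j\<in>G. A i j * u j) F \<le> c * L2_set u G" .
qed (use assms in auto)

text \<open>The bridge between the extended norm of the definitions and real bounds: every later
  passage between the two for matrices rests on it.\<close>

lemma op_norm_le_iff: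
  assumes "\<And>i j. 0 \<le> A i j" "\<And>i j. A i j \<noteq> 0 \<Longrightarrow> i \<in> R \<and> j \<in> R" "0 \<le> c"
  shows "op_norm R (mat_op R A) \<le> ennreal c \<longleftrightarrow> op_bound R A c"
proof
  assume "op_bound R A c"
  then show "op_norm R (mat_op R A) \<le> ennreal c"
    unfolding op_norm_def using assms(3) op_bound_mat_op[of R A c]
    by (intro Inf_lower) blast
next
  assume le: "op_norm R (mat_op R A) \<le> ennreal c"
  show "op_bound R A c"
  proof (rule op_bound_closed)
    fix d assume d: "c < d"
    then have "op_norm R (mat_op R A) < ennreal d" using le assms(3) 
      by (meson ennreal_lessI le_less_trans less_trans order_le_less_trans)
    then obtain C where C: "0 \<le> C" "ennreal C < ennreal d"
      "\<And>x. x \<in> l2 R \<Longrightarrow> mat_op R A x \<in> l2 R \<and> l2_norm R (mat_op R A x) \<le> C * l2_norm R x"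
      unfolding op_norm_def Inf_less_iff by blast
    then have "op_bound R A C" by (intro op_boundI_mat_op assms)
    then show "op_bound R A d" using C by (auto simp: ennreal_less_iff intro: op_bound_weaken)
  qed fact
qed

lemma op_norm_le:
  assumes "op_bound R A c" shows "op_norm R (mat_op R A) \<le> ennreal c"
  using assms op_norm_le_iff[of A R c] by (auto dest: op_boundD)

lemma op_bound_iff_op_norm:
  assumes A: "op_bound R A d" and c: "0 \<le> c"
  shows "op_bound R A c \<longleftrightarrow> op_norm R (mat_op R A) \<le> ennreal c"
  using op_norm_le_iff[of A R c] op_boundD(2,3)[OF A] c by blast

lemma mat_op_add:
  assumes "op_bound R A c" "x \<in> l2 R" "y \<in> l2 R"
  shows "mat_op R A (\<lambda>i. x i + y i) = (\<lambda>i. mat_op R A x i + mat_op R A y i)"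
  unfolding mat_op_def distrib_left
  using op_bound_row_summable(2)[OF assms(1)] assms(2,3) by (intro ext infsum_add) auto

lemma mat_op_scale: "mat_op R A (\<lambda>i. c * x i) = (\<lambda>i. c * mat_op R A x i)"
  by (simp add: mat_op_def mult.left_commute[of _ c] infsum_cmult_right')

lemma mat_op_diff:
  assumes "op_bound R A c" "x \<in> l2 R" "y \<in> l2 R"
  shows "mat_op R A (\<lambda>i. x i - y i) = (\<lambda>i. mat_op R A x i - mat_op R A y i)"
  using mat_op_add[OF assms(1,2) l2_scale(1)[OF assms(3), of "-1"]] mat_op_scale[of R A "-1" y] by simp

lemma mat_op_sum:
  assumes "op_bound R A c" "finite L" "\<And>l. l \<in> L \<Longrightarrow> x l \<in> l2 R"
  shows "mat_op R A (\<lambda>i. \<Sum>l\<in>L. x l i) = (\<lambda>i. \<Sum>l\<in>L. mat_op R A (x l) i)"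
  using assms(2,3)
proof (induction L)
  case empty
  then show ?case by (simp add: mat_op_def)
next
  case (insert l L)
  then show ?case
    using mat_op_add[OF assms(1), of "x l" "\<lambda>i. \<Sum>l\<in>L. x l i"] l2_sum(1)[of L x R] by simp
qed

text \<open>Fubini. The double series converges absolutely because a finite set of index pairs lies
  in the rectangle of its projections, where the sum is a section of \<open>A\<close> after one of
  \<open>B\<close>, applied to the moduli of \<open>x\<close>.\<close>

lemma mat_op_mult:
  assumes A: "op_bound R A c" and B: "op_bound R B d" and x: "x \<in> l2 R"
  shows "mat_op R (mat_mult R A B) x = mat_op R A (mat_op R B x)"
proof
  fix i
  let ?f = "\<lambda>k j. complex_of_real (A i j) * (complex_of_real (B j k) * x k)"
  have "(\<lambda>(k, j). ?f k j) summable_on R \<times> R"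
  proof (rule abs_summable_summable, rule nonneg_bdd_above_summable_on)
    have "sum (\<lambda>p. norm ((\<lambda>(k, j). ?f k j) p)) P \<le> c * (d * l2_norm R x)"
      if P: "P \<subseteq> R \<times> R" "finite P" for P
    proof -
      let ?K = "fst ` P" and ?H = "snd ` P"
      have "sum (\<lambda>p. norm ((\<lambda>(k, j). ?f k j) p)) P \<le> sum (\<lambda>p. norm ((\<lambda>(k, j). ?f k j) p)) (?K \<times> ?H)"
        using P by (intro sum_mono2) force+
      also have "\<dots> = (\<Sum>j\<in>?H. A i j * (\<Sum>k\<in>?K. B j k * cmod (x k)))"
        unfolding sum_distrib_left
        by (subst sum.swap) (simp add: sum.cartesian_product norm_mult op_boundD(2)[OF A] op_boundD(2)[OF B] case_prod_unfold)
      also have "\<dots> \<le> L2_set (\<lambda>i. \<Sum>j\<in>?H. A i j * (\<Sum>k\<in>?K. B j k * cmod (x k))) {i}"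
        by (intro member_le_L2_set) auto
      also have "\<dots> \<le> c * L2_set (\<lambda>j. \<Sum>k\<in>?K. B j k * cmod (x k)) ?H"
        using P by (intro op_boundD(4)[OF A]) (auto intro!: sum_nonneg mult_nonneg_nonneg op_boundD(2)[OF B])
      also have "\<dots> \<le> c * (d * L2_set (\<lambda>k. cmod (x k)) ?K)"
        using P by (intro mult_left_mono op_boundD(4)[OF B] op_boundD(1)[OF A]) auto
      also have "\<dots> \<le> c * (d * l2_norm R x)"
        using P by (intro mult_left_mono L2_set_le_l2_norm x op_boundD(1)[OF A] op_boundD(1)[OF B]) auto
      finally show ?thesis .
    qed
    then show "bdd_above (sum (\<lambda>p. norm ((\<lambda>(k, j). ?f k j) p)) ` {F. F \<subseteq> R \<times> R \<and> finite F})"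
      by (intro bdd_aboveI2[where M = "c * (d * l2_norm R x)"]) auto
  qed auto
  then have "(\<Sum>\<^sub>\<infinity>k\<in>R. \<Sum>\<^sub>\<infinity>j\<in>R. ?f k j) = (\<Sum>\<^sub>\<infinity>j\<in>R. \<Sum>\<^sub>\<infinity>k\<in>R. ?f k j)"
    by (rule infsum_swap_banach)
  also have "\<dots> = mat_op R A (mat_op R B x) i"
    by (simp add: mat_op_def infsum_cmult_right')
  also have "(\<Sum>\<^sub>\<infinity>k\<in>R. \<Sum>\<^sub>\<infinity>j\<in>R. ?f k j) = mat_op R (mat_mult R A B) x i"
  proof -
    have "(\<Sum>\<^sub>\<infinity>j\<in>R. ?f k j) = complex_of_real (mat_mult R A B i k) * x k" for k
    proof -
      have "(\<Sum>\<^sub>\<infinity>j\<in>R. ?f k j) = (\<Sum>\<^sub>\<infinity>j\<in>R. complex_of_real (A i j * B j k)) * x k"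
        by (simp add: infsum_cmult_left'[symmetric] mult.assoc)
      also have "(\<Sum>\<^sub>\<infinity>j\<in>R. complex_of_real (A i j * B j k)) = complex_of_real (mat_mult R A B i k)"
        unfolding mat_mult_def
        using infsumI[OF has_sum_of_real[OF has_sum_infsum[OF mat_mult_summable[OF A B]]]] .
      finally show ?thesis .
    qed
    then show ?thesis by (simp add: mat_op_def)
  qed
  finally show "mat_op R (mat_mult R A B) x i = mat_op R A (mat_op R B x) i" .
qed

lemma mat_op_column:
  assumes "k \<in> R"
  shows "mat_op R A (\<lambda>j. if j \<in> {k} then complex_of_real 1 else 0) i = complex_of_real (A i k)"
  using mat_op_finite_support[of "{k}" R A "\<lambda>_. 1" i] assms by simp

text \<open>Unit vectors recover the columns. Identities of matrices can thus be checked on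
  operators, and \<open>mat_mult_assoc\<close> becomes associativity of composition, without
  rearranging triple sums.\<close>

lemma mat_eqI:
  assumes A: "op_bound R A c" and B: "op_bound R B d"
    and eq: "\<And>x. x \<in> l2 R \<Longrightarrow> mat_op R A x = mat_op R B x"
  shows "A = B"
proof (intro ext)
  fix i k
  show "A i k = B i k"
  proof (cases "k \<in> R")
    case True
    then have "(\<lambda>j. if j \<in> {k} then complex_of_real 1 else 0) \<in> l2 R"
      by (intro l2_finite_support) auto
    from eq[OF this] mat_op_column[OF True] show ?thesis by (metis of_real_eq_iff)
  qed (use op_bound_outside[OF A] op_bound_outside[OF B] in auto)
qed

lemma mat_mult_assoc:
  assumes A: "op_bound R A a" and B: "op_bound R B b" and C: "op_bound R C c"
  shows "mat_mult R (mat_mult R A B) C = mat_mult R A (mat_mult R B C)"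
proof (rule mat_eqI)
  show "op_bound R (mat_mult R (mat_mult R A B) C) (a * b * c)"
    "op_bound R (mat_mult R A (mat_mult R B C)) (a * (b * c))"
    by (intro op_bound_mult assms)+
  show "mat_op R (mat_mult R (mat_mult R A B) C) x = mat_op R (mat_mult R A (mat_mult R B C)) x"
    if x: "x \<in> l2 R" for x
    using mat_op_mult[OF op_bound_mult[OF A B] C x] mat_op_mult[OF A B op_bound_mat_op(1)[OF C x]]
      mat_op_mult[OF A op_bound_mult[OF B C] x] mat_op_mult[OF B C x] by simp
qed

lemma mat_op_one:
  assumes "x \<in> l2 R" shows "mat_op R (mat_one R) x = x"
proof
  fix i
  have "mat_op R (mat_one R) x i = (\<Sum>\<^sub>\<infinity>j\<in>{i}. if i \<in> R then x j else 0)"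
    unfolding mat_op_def by (intro infsum_cong_neutral) (auto simp: mat_one_def)
  then show "mat_op R (mat_one R) x i = x i" using assms by (simp add: l2_outside)
qed

lemma mat_mult_one:
  assumes A: "op_bound R A a"
  shows "mat_mult R (mat_one R) A = A" "mat_mult R A (mat_one R) = A"
proof -
  show "mat_mult R (mat_one R) A = A"
    using mat_op_mult[OF op_bound_one A] op_bound_mat_op(1)[OF A]
    by (intro mat_eqI[OF op_bound_mult[OF op_bound_one A] A]) (simp add: mat_op_one)
  show "mat_mult R A (mat_one R) = A"
    using mat_op_mult[OF A op_bound_one]
    by (intro mat_eqI[OF op_bound_mult[OF A op_bound_one] A]) (simp add: mat_op_one)
qed

section \<open>Hadamard powers\<close>

text \<open>The quotients \<open>a j / c j\<close> lie in \<open>[0, 1]\<close>, so raising the exponents from \<open>1 / card J\<close> to \<open>\<beta>\<close>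
  decreases their product, and AM-GM applies.\<close>

lemma prod_powr_le_mean:
  fixes a c :: "'a \<Rightarrow> real"
  assumes J: "finite J" "J \<noteq> {}" and \<beta>: "1 \<le> real (card J) * \<beta>"
    and a: "\<And>j. j \<in> J \<Longrightarrow> 0 \<le> a j" "\<And>j. j \<in> J \<Longrightarrow> a j \<le> c j" and c: "\<And>j. j \<in> J \<Longrightarrow> 0 < c j"
  shows "(\<Prod>j\<in>J. a j powr \<beta>) \<le> (\<Prod>j\<in>J. c j powr \<beta>) * (\<Sum>j\<in>J. a j / c j / card J)"
proof -
  define b where "b = (\<lambda>j. a j / c j)"
  have b: "0 \<le> b j" "b j \<le> 1" if "j \<in> J" for j using a c that by (auto simp: b_def divide_le_eq_1 less_imp_le)
  have n: "0 < card J" using J by (simp add: card_gt_0_iff)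
  have "(\<Prod>j\<in>J. a j powr \<beta>) = (\<Prod>j\<in>J. c j powr \<beta> * b j powr \<beta>)"
    using a c by (intro prod.cong) (auto simp: b_def powr_divide less_imp_le dual_order.strict_implies_not_eq)
  also have "\<dots> = (\<Prod>j\<in>J. c j powr \<beta>) * (\<Prod>j\<in>J. b j powr \<beta>)" by (rule prod.distrib)
  also have "(\<Prod>j\<in>J. b j powr \<beta>) = (\<Prod>j\<in>J. b j) powr \<beta>" using b by (simp add: prod_powr_distrib)
  also have "\<dots> \<le> (\<Prod>j\<in>J. b j) powr (1 / card J)"
    using b n \<beta> by (intro powr_mono' prod_nonneg prod_le_1) (auto simp: divide_le_eq mult.commute)
  also have "\<dots> \<le> (\<Sum>j\<in>J. b j / card J)" using b by (intro arith_geom_mean J) auto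
  finally show ?thesis by (simp add: b_def mult_left_mono prod_nonneg)
qed

lemma hadamard_nonneg: "0 \<le> hadamard J (\<lambda>_. \<beta>) A i j"
  by (simp add: hadamard_def prod_nonneg)

text \<open>A norm bound \<open>c\<close> also bounds all entries. The Hadamard product therefore
  lies below c^(n \<open>\<beta>\<close>), n = \<open>card J\<close>, times the arithmetic mean of
  the matrices \<open>A j\<close> divided by \<open>c\<close>, a mean of norm at most 1.\<close>

lemma op_bound_hadamard:
  assumes J: "finite J" "J \<noteq> {}" and \<beta>: "1 \<le> real (card J) * \<beta>" and c: "0 < c"
    and A: "\<And>j. j \<in> J \<Longrightarrow> op_bound R (A j) c"
  shows "op_bound R (hadamard J (\<lambda>_. \<beta>) A) (c powr (real (card J) * \<beta>))"
proof (rule op_bound_mono)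
  have n: "0 < card J" using J by (simp add: card_gt_0_iff)
  let ?B = "\<lambda>i k. c powr (real (card J) * \<beta>) * (\<Sum>j\<in>J. (1 / (c * card J)) * A j i k)"
  have "op_bound R ?B (c powr (real (card J) * \<beta>) * (\<Sum>j\<in>J. (1 / (c * card J)) * c))"
    using c by (intro op_bound_scale op_bound_sum J A) auto
  then show "op_bound R ?B (c powr (real (card J) * \<beta>))" using c n by simp
  have "(\<Prod>j\<in>J. A j i k powr \<beta>) \<le> (\<Prod>j\<in>J. c powr \<beta>) * (\<Sum>j\<in>J. A j i k / c / card J)" for i k
    using c op_bound_entry[OF A] op_boundD(2)[OF A] by (intro prod_powr_le_mean J \<beta>) auto
  then show "hadamard J (\<lambda>_. \<beta>) A i k \<le> ?B i k" for i k
    using c by (simp add: hadamard_def powr_powr[symmetric] powr_realpow mult.commute[of _ \<beta>] divide_divide_eq_left)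
qed (auto simp: hadamard_nonneg)

text \<open>Hoelder's inequality from the same AM-GM bound: \<open>f j l\<close> are the terms of
  the series \<open>S j\<close> for entry (i, k) of the j-th product, so the quotients
  \<open>f j l / S j\<close> are at most 1 and, for each \<open>j\<close>, sum over \<open>l\<close>
  to at most 1.\<close>

lemma hadamard_mult_le:
  assumes J: "finite J" "J \<noteq> {}" and \<beta>: "1 \<le> real (card J) * \<beta>"
    and A: "\<And>j. j \<in> J \<Longrightarrow> op_bound R (A j) a" and B: "\<And>j. j \<in> J \<Longrightarrow> op_bound R (B j) b"
  shows "mat_mult R (hadamard J (\<lambda>_. \<beta>) A) (hadamard J (\<lambda>_. \<beta>) B) i k
    \<le> hadamard J (\<lambda>_. \<beta>) (\<lambda>j. mat_mult R (A j) (B j)) i k"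
proof -
  define S where "S = (\<lambda>j. mat_mult R (A j) (B j) i k)"
  define f where "f = (\<lambda>j l. A j i l * B j l k)"
  have f0: "0 \<le> f j l" if "j \<in> J" for j l
    using op_boundD(2)[OF A[OF that]] op_boundD(2)[OF B[OF that]] by (simp add: f_def)
  have sum_le: "(\<Sum>l\<in>F. f j l) \<le> S j" if "j \<in> J" "finite F" "F \<subseteq> R" for j F
    unfolding S_def mat_mult_def f_def
    by (intro finite_sum_le_infsum mat_mult_summable[OF A B]) (use f0 that in \<open>auto simp: f_def\<close>)
  have le: "f j l \<le> S j" if "j \<in> J" "l \<in> R" for j l
    using sum_le[of j "{l}"] that by simp
  have prod: "hadamard J (\<lambda>_. \<beta>) A i l * hadamard J (\<lambda>_. \<beta>) B l k = (\<Prod>j\<in>J. f j l powr \<beta>)" for l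
    using op_boundD(2)[OF A] op_boundD(2)[OF B]
    by (simp add: hadamard_def f_def powr_mult flip: prod.distrib)
  have S0: "0 \<le> S j" if "j \<in> J" for j
    unfolding S_def using op_boundD(2)[OF op_bound_mult[OF A B]] that by blast
  have "mat_mult R (hadamard J (\<lambda>_. \<beta>) A) (hadamard J (\<lambda>_. \<beta>) B) i k \<le> (\<Prod>j\<in>J. S j powr \<beta>)"
    unfolding mat_mult_def
  proof (rule infsum_le_finite_sums)
    \<comment> \<open>\<open>a\<close> and \<open>b\<close> may be 0, but
      \<open>op_bound_hadamard\<close> divides by its constant.\<close>
    have "op_bound R (A j) (max 1 a)" "op_bound R (B j) (max 1 b)" if "j \<in> J" for j
      using A[OF that] B[OF that] by (auto intro: op_bound_weaken)
    then have "op_bound R (hadamard J (\<lambda>_. \<beta>) A) (max 1 a powr (real (card J) * \<beta>))"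
      "op_bound R (hadamard J (\<lambda>_. \<beta>) B) (max 1 b powr (real (card J) * \<beta>))"
      using J \<beta> by (auto intro!: op_bound_hadamard)
    then show "(\<lambda>l. hadamard J (\<lambda>_. \<beta>) A i l * hadamard J (\<lambda>_. \<beta>) B l k) summable_on R"
      by (rule mat_mult_summable)
    fix F assume F: "finite F" "F \<subseteq> R"
    show "(\<Sum>l\<in>F. hadamard J (\<lambda>_. \<beta>) A i l * hadamard J (\<lambda>_. \<beta>) B l k) \<le> (\<Prod>j\<in>J. S j powr \<beta>)"
    \<comment> \<open>The quotients need every \<open>S j\<close> positive. If one of them vanishes,
      so do all of its terms, and with them every product, because 0 powr \<open>\<beta>\<close> is
      0.\<close>
    proof (cases "\<exists>j\<in>J. S j = 0")
      case True
      then obtain j where j: "j \<in> J" "S j = 0" by blast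
      have "f j l = 0" if "l \<in> F" for l using le[of j l] f0[of j l] j F that by auto
      then have "(\<Prod>j\<in>J. f j l powr \<beta>) = 0" if "l \<in> F" for l
        using that j(1) J by (auto intro!: prod_zero)
      then show ?thesis by (simp add: prod prod_nonneg)
    next
      case False
      then have S: "0 < S j" if "j \<in> J" for j using S0[OF that] that by force
      have "(\<Sum>l\<in>F. hadamard J (\<lambda>_. \<beta>) A i l * hadamard J (\<lambda>_. \<beta>) B l k)
          \<le> (\<Sum>l\<in>F. (\<Prod>j\<in>J. S j powr \<beta>) * (\<Sum>j\<in>J. f j l / S j / card J))"
        unfolding prod using F by (intro sum_mono prod_powr_le_mean J \<beta> f0 le S) auto
      also have "\<dots> = (\<Prod>j\<in>J. S j powr \<beta>) * (\<Sum>j\<in>J. (\<Sum>l\<in>F. f j l) / S j / card J)"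
        by (simp add: sum_distrib_left[symmetric] sum_divide_distrib) (subst sum.swap, simp)
      also have "\<dots> \<le> (\<Prod>j\<in>J. S j powr \<beta>) * (\<Sum>j\<in>J. 1 / card J)"
        using sum_le F S by (intro mult_left_mono sum_mono divide_right_mono prod_nonneg) (auto simp: divide_le_eq_1)
      also have "\<dots> = (\<Prod>j\<in>J. S j powr \<beta>)" using J by simp
      finally show ?thesis .
    qed
  qed
  then show ?thesis by (simp add: hadamard_def S_def)
qed

lemma hadamard_one:
  assumes "finite J" "J \<noteq> {}"
  shows "hadamard J (\<lambda>_. \<beta>) (\<lambda>_. mat_one R) = mat_one R"
  using assms by (auto simp: hadamard_def mat_one_def fun_eq_iff power_0_left card_gt_0_iff)

section \<open>Bounded sets of nonnegative matrices\<close>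

text \<open>A uniform \<open>op_bound\<close> carries nonnegativity and support in \<open>R\<close>
  along with boundedness, so this one predicate is what all constructions on sets have to
  preserve.\<close>

definition bdd_mats :: "nat set \<Rightarrow> rmat set \<Rightarrow> bool" where
  "bdd_mats R \<Phi> \<longleftrightarrow> (\<exists>c. \<forall>A\<in>\<Phi>. op_bound R A c)"

definition set_mult :: "nat set \<Rightarrow> rmat set \<Rightarrow> rmat set \<Rightarrow> rmat set" where
  "set_mult R \<Phi> \<Psi> = {mat_mult R A B |A B. A \<in> \<Phi> \<and> B \<in> \<Psi>}"

text \<open>The order on matrices is the pointwise order of functions. The relation replaces set
  inclusion, which Hoelder's inequality cannot give.\<close>

definition dominated :: "rmat set \<Rightarrow> rmat set \<Rightarrow> bool" where
  "dominated \<Phi> \<Psi> \<longleftrightarrow> (\<forall>A\<in>\<Phi>. \<exists>B\<in>\<Psi>. A \<le> B)"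

lemma bdd_matsE:
  assumes "bdd_mats R \<Phi>"
  obtains c where "0 < c" "\<And>A. A \<in> \<Phi> \<Longrightarrow> op_bound R A c"
proof -
  obtain c where c: "\<And>A. A \<in> \<Phi> \<Longrightarrow> op_bound R A c" using assms unfolding bdd_mats_def by blast
  show thesis
    by (rule that[of "max c 1"]) (auto intro: op_bound_weaken[OF c])
qed

lemma bdd_mats_subset: "bdd_mats R \<Psi> \<Longrightarrow> \<Phi> \<subseteq> \<Psi> \<Longrightarrow> bdd_mats R \<Phi>"
  unfolding bdd_mats_def by blast

lemma bdd_mats_bounded_set:
  assumes \<Phi>: "\<Phi> \<subseteq> nonneg_operator_matrices R" "bounded_set R \<Phi>"
  shows "bdd_mats R \<Phi>"
proof -
  obtain c where c: "0 \<le> c" "set_norm R \<Phi> = ennreal c"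
    using \<Phi>(2) unfolding bounded_set_def by (cases "set_norm R \<Phi>") auto
  have "op_bound R A c" if A: "A \<in> \<Phi>" for A
  proof -
    have "op_norm R (mat_op R A) \<le> ennreal c"
      using A unfolding c(2)[symmetric] set_norm_def by (rule SUP_upper)
    moreover have out: "A i j \<noteq> 0 \<Longrightarrow> i \<in> R \<and> j \<in> R" for i j
      using \<Phi>(1) A unfolding nonneg_operator_matrices_def by blast
    moreover have "0 \<le> A i j" for i j
      using \<Phi>(1) A out[of i j] unfolding nonneg_operator_matrices_def by (cases "A i j = 0") auto
    ultimately show ?thesis using op_norm_le_iff[of A R c] c(1) by blast
  qed
  then show ?thesis unfolding bdd_mats_def by blast
qed

lemma bdd_mats_mult:
  assumes "bdd_mats R \<Phi>" "bdd_mats R \<Psi>"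
  shows "bdd_mats R (set_mult R \<Phi> \<Psi>)"
proof -
  obtain c d where c: "\<And>A. A \<in> \<Phi> \<Longrightarrow> op_bound R A c" and d: "\<And>A. A \<in> \<Psi> \<Longrightarrow> op_bound R A d"
    using assms unfolding bdd_mats_def by blast
  have "\<forall>A\<in>set_mult R \<Phi> \<Psi>. op_bound R A (c * d)"
    unfolding set_mult_def by (auto intro!: op_bound_mult c d)
  then show ?thesis unfolding bdd_mats_def ..
qed

lemma bdd_mats_one: "bdd_mats R {mat_one R}"
  unfolding bdd_mats_def using op_bound_one by blast

lemma bdd_mats_adjoint: "bdd_mats R \<Phi> \<Longrightarrow> bdd_mats R (set_adjoint \<Phi>)"
  unfolding bdd_mats_def set_adjoint_def using op_bound_adjoint by blast

lemma bdd_mats_uniform: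
  assumes "finite J" "\<And>j. j \<in> J \<Longrightarrow> bdd_mats R (\<Phi> j)"
  shows "\<exists>c>0. \<forall>j\<in>J. \<forall>A\<in>\<Phi> j. op_bound R A c"
proof -
  have "\<exists>c. \<forall>A\<in>\<Phi> j. op_bound R A c" if "j \<in> J" for j using assms(2)[OF that] unfolding bdd_mats_def .
  then obtain c where c: "\<And>j A. j \<in> J \<Longrightarrow> A \<in> \<Phi> j \<Longrightarrow> op_bound R A (c j)" by metis
  have "0 < Max (insert 1 (c ` J))" using assms(1) by (auto simp: Max_gr_iff)
  moreover have "op_bound R A (Max (insert 1 (c ` J)))" if "j \<in> J" "A \<in> \<Phi> j" for j A
    using assms(1) that by (intro op_bound_weaken[OF c] Max_ge) auto
  ultimately show ?thesis by blast
qed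

lemma bdd_mats_hadamard:
  assumes J: "finite J" "J \<noteq> {}" and \<beta>: "1 \<le> real (card J) * \<beta>"
    and \<Phi>: "\<And>j. j \<in> J \<Longrightarrow> bdd_mats R (\<Phi> j)"
  shows "bdd_mats R (set_hadamard J (\<lambda>_. \<beta>) \<Phi>)"
proof -
  obtain c where c: "0 < c" "\<And>j A. j \<in> J \<Longrightarrow> A \<in> \<Phi> j \<Longrightarrow> op_bound R A c"
    using bdd_mats_uniform[of J R \<Phi>, OF J(1) \<Phi>] by blast
  have "\<forall>A\<in>set_hadamard J (\<lambda>_. \<beta>) \<Phi>. op_bound R A (c powr (real (card J) * \<beta>))"
    unfolding set_hadamard_def using c by (auto intro!: op_bound_hadamard J \<beta>)
  then show ?thesis unfolding bdd_mats_def ..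
qed

lemma set_mult_assoc:
  assumes "bdd_mats R \<Phi>" "bdd_mats R \<Psi>" "bdd_mats R \<Xi>"
  shows "set_mult R (set_mult R \<Phi> \<Psi>) \<Xi> = set_mult R \<Phi> (set_mult R \<Psi> \<Xi>)"
proof -
  obtain a b c where *: "\<And>A. A \<in> \<Phi> \<Longrightarrow> op_bound R A a" "\<And>A. A \<in> \<Psi> \<Longrightarrow> op_bound R A b"
    "\<And>A. A \<in> \<Xi> \<Longrightarrow> op_bound R A c"
    using assms unfolding bdd_mats_def by metis
  have "mat_mult R (mat_mult R A B) C = mat_mult R A (mat_mult R B C)"
    if "A \<in> \<Phi>" "B \<in> \<Psi>" "C \<in> \<Xi>" for A B C
    by (rule mat_mult_assoc[OF *(1)[OF that(1)] *(2)[OF that(2)] *(3)[OF that(3)]])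
  then show ?thesis unfolding set_mult_def by (intro set_eqI iffI; clarsimp; metis)
qed

lemma set_mult_one:
  assumes "bdd_mats R \<Phi>"
  shows "set_mult R {mat_one R} \<Phi> = \<Phi>" "set_mult R \<Phi> {mat_one R} = \<Phi>"
proof -
  have "mat_mult R (mat_one R) A = A" "mat_mult R A (mat_one R) = A" if "A \<in> \<Phi>" for A
    using assms that mat_mult_one unfolding bdd_mats_def by blast+
  then show "set_mult R {mat_one R} \<Phi> = \<Phi>" "set_mult R \<Phi> {mat_one R} = \<Phi>"
    unfolding set_mult_def by force+
qed

lemma set_prod_Nil [simp]: "set_prod R [] = {mat_one R}"
  by (simp add: set_prod_def mat_prod_def)

lemma set_prod_Cons [simp]: "set_prod R (\<Phi> # \<Phi>s) = set_mult R \<Phi> (set_prod R \<Phi>s)"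
  unfolding set_prod_def set_mult_def
proof (intro set_eqI iffI; clarsimp simp: list_all2_Cons2)
  show "\<exists>A B. mat_prod R (z # zs) = mat_mult R A B \<and> A \<in> \<Phi> \<and> (\<exists>As. B = mat_prod R As \<and> list_all2 (\<in>) As \<Phi>s)"
    if "z \<in> \<Phi>" "list_all2 (\<in>) zs \<Phi>s" for z zs
    using that by (auto simp: mat_prod_def)
  show "\<exists>As. mat_mult R A (mat_prod R Bs) = mat_prod R As \<and> (\<exists>z zs. As = z # zs \<and> z \<in> \<Phi> \<and> list_all2 (\<in>) zs \<Phi>s)"
    if "A \<in> \<Phi>" "list_all2 (\<in>) Bs \<Phi>s" for A Bs
    using that by (intro exI[of _ "A # Bs"]) (auto simp: mat_prod_def)
qed

lemma set_power_eq_set_prod: "set_power R \<Phi> k = set_prod R (replicate k \<Phi>)"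
proof -
  have "list_all2 (\<in>) As (replicate k \<Phi>) \<longleftrightarrow> length As = k \<and> set As \<subseteq> \<Phi>" for As
    by (auto simp: list_all2_conv_all_nth subset_eq all_set_conv_all_nth)
  then show ?thesis by (simp add: set_power_def set_prod_def)
qed

lemma bdd_mats_prod:
  assumes "\<And>\<Phi>. \<Phi> \<in> set \<Phi>s \<Longrightarrow> bdd_mats R \<Phi>"
  shows "bdd_mats R (set_prod R \<Phi>s)"
  using assms by (induction \<Phi>s) (auto intro: bdd_mats_one bdd_mats_mult)

lemma bdd_mats_power: "bdd_mats R \<Phi> \<Longrightarrow> bdd_mats R (set_power R \<Phi> k)"
  unfolding set_power_eq_set_prod by (intro bdd_mats_prod) auto

lemma set_prod_append:
  assumes "\<And>\<Phi>. \<Phi> \<in> set \<Phi>s \<union> set \<Psi>s \<Longrightarrow> bdd_mats R \<Phi>"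
  shows "set_prod R (\<Phi>s @ \<Psi>s) = set_mult R (set_prod R \<Phi>s) (set_prod R \<Psi>s)"
  using assms
  by (induction \<Phi>s) (simp_all add: set_mult_one bdd_mats_prod set_mult_assoc)

lemma set_prod_concat:
  assumes "\<And>\<Phi>s \<Phi>. \<Phi>s \<in> set \<Phi>ss \<Longrightarrow> \<Phi> \<in> set \<Phi>s \<Longrightarrow> bdd_mats R \<Phi>"
  shows "set_prod R (map (set_prod R) \<Phi>ss) = set_prod R (concat \<Phi>ss)"
  using assms
proof (induction \<Phi>ss)
  case (Cons \<Phi>s \<Phi>ss)
  have "set_prod R (concat (\<Phi>s # \<Phi>ss)) = set_mult R (set_prod R \<Phi>s) (set_prod R (concat \<Phi>ss))"
    unfolding concat.simps using Cons.prems by (intro set_prod_append) auto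
  moreover have "set_prod R (map (set_prod R) \<Phi>ss) = set_prod R (concat \<Phi>ss)"
    using Cons.prems by (intro Cons.IH) auto
  ultimately show ?case by simp
qed simp

lemma set_power_0 [simp]: "set_power R \<Phi> 0 = {mat_one R}"
  by (simp add: set_power_eq_set_prod)

lemma set_power_Suc: "set_power R \<Phi> (Suc k) = set_mult R \<Phi> (set_power R \<Phi> k)"
  by (simp add: set_power_eq_set_prod)

lemma set_power_1: "bdd_mats R \<Phi> \<Longrightarrow> set_power R \<Phi> 1 = \<Phi>"
  by (simp add: set_power_Suc set_mult_one)

lemma set_power_add:
  assumes "bdd_mats R \<Phi>"
  shows "set_power R \<Phi> (k + l) = set_mult R (set_power R \<Phi> k) (set_power R \<Phi> l)"
  unfolding set_power_eq_set_prod replicate_add using assms by (intro set_prod_append) auto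

lemma set_power_power:
  assumes "bdd_mats R \<Phi>"
  shows "set_power R (set_power R \<Phi> n) k = set_power R \<Phi> (n * k)"
proof (induction k)
  case (Suc k)
  then show ?case using set_power_add[OF assms, of n "n * k"] by (simp add: set_power_Suc)
qed simp

lemma set_mult_mono: "\<Phi> \<subseteq> \<Phi>' \<Longrightarrow> \<Psi> \<subseteq> \<Psi>' \<Longrightarrow> set_mult R \<Phi> \<Psi> \<subseteq> set_mult R \<Phi>' \<Psi>'"
  unfolding set_mult_def by blast

lemma set_power_mono: "\<Phi> \<subseteq> \<Psi> \<Longrightarrow> set_power R \<Phi> k \<subseteq> set_power R \<Psi> k"
  by (induction k) (auto simp: set_power_Suc intro: set_mult_mono[THEN subsetD])

lemma set_adjoint_mult: "set_adjoint (set_mult R \<Phi> \<Psi>) = set_mult R (set_adjoint \<Psi>) (set_adjoint \<Phi>)"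
proof -
  have "set_mult R (set_adjoint \<Psi>) (set_adjoint \<Phi>) = {mat_adjoint (mat_mult R A B) |A B. A \<in> \<Phi> \<and> B \<in> \<Psi>}"
    unfolding set_adjoint_def set_mult_def mat_adjoint_mult by blast
  then show ?thesis unfolding set_adjoint_def set_mult_def by blast
qed

lemma set_adjoint_adjoint [simp]: "set_adjoint (set_adjoint \<Phi>) = \<Phi>"
  by (simp add: set_adjoint_def image_image)

lemma set_adjoint_power:
  assumes "bdd_mats R \<Phi>"
  shows "set_adjoint (set_power R \<Phi> k) = set_power R (set_adjoint \<Phi>) k"
proof (induction k)
  case (Suc k)
  have "set_power R (set_adjoint \<Phi>) (k + 1) = set_mult R (set_power R (set_adjoint \<Phi>) k) (set_adjoint \<Phi>)"
    using set_power_add[OF bdd_mats_adjoint[OF assms], of k 1] set_power_1[OF bdd_mats_adjoint[OF assms]] by simp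
  then show ?case by (simp add: set_power_Suc set_adjoint_mult Suc)
qed (simp add: set_adjoint_def)

section \<open>Entrywise domination and Hadamard products of sets\<close>

lemma dominated_subset: "\<Phi> \<subseteq> \<Psi> \<Longrightarrow> dominated \<Phi> \<Psi>"
  unfolding dominated_def by blast

lemma dominated_trans: "dominated \<Phi> \<Psi> \<Longrightarrow> dominated \<Psi> \<Xi> \<Longrightarrow> dominated \<Phi> \<Xi>"
  unfolding dominated_def by (meson order_trans)

lemma dominated_mult:
  assumes bdd: "bdd_mats R \<Phi>" "bdd_mats R \<Phi>'" "bdd_mats R \<Psi>" "bdd_mats R \<Psi>'"
    and dom: "dominated \<Phi> \<Phi>'" "dominated \<Psi> \<Psi>'"
  shows "dominated (set_mult R \<Phi> \<Psi>) (set_mult R \<Phi>' \<Psi>')"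
  unfolding dominated_def
proof
  fix X assume "X \<in> set_mult R \<Phi> \<Psi>"
  then obtain A B where AB: "A \<in> \<Phi>" "B \<in> \<Psi>" "X = mat_mult R A B" unfolding set_mult_def by blast
  then obtain A' B' where *: "A' \<in> \<Phi>'" "A \<le> A'" "B' \<in> \<Psi>'" "B \<le> B'"
    using dom unfolding dominated_def by meson
  obtain c d where "op_bound R A' c" "op_bound R B' d"
    using bdd * unfolding bdd_mats_def by metis
  moreover have "0 \<le> A i j" "0 \<le> B i j" for i j
    using bdd(1,3) AB op_boundD(2) unfolding bdd_mats_def by blast+
  ultimately have "X \<le> mat_mult R A' B'"
    unfolding AB(3) using * by (auto simp: le_fun_def intro!: mat_mult_mono)
  then show "\<exists>Y\<in>set_mult R \<Phi>' \<Psi>'. X \<le> Y" using * unfolding set_mult_def by blast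
qed

lemma dominated_power:
  assumes "bdd_mats R \<Phi>" "bdd_mats R \<Psi>" "dominated \<Phi> \<Psi>"
  shows "dominated (set_power R \<Phi> k) (set_power R \<Psi> k)"
  by (induction k) (auto simp: set_power_Suc intro: dominated_subset dominated_mult bdd_mats_power assms)

lemma dominated_hadamard_mult:
  assumes J: "finite J" "J \<noteq> {}" and \<beta>: "1 \<le> real (card J) * \<beta>"
    and \<Phi>: "\<And>j. j \<in> J \<Longrightarrow> bdd_mats R (\<Phi> j)" "\<And>j. j \<in> J \<Longrightarrow> bdd_mats R (\<Psi> j)"
  shows "dominated (set_mult R (set_hadamard J (\<lambda>_. \<beta>) \<Phi>) (set_hadamard J (\<lambda>_. \<beta>) \<Psi>))
    (set_hadamard J (\<lambda>_. \<beta>) (\<lambda>j. set_mult R (\<Phi> j) (\<Psi> j)))"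
  unfolding dominated_def
proof
  obtain c d where c: "\<And>j A. j \<in> J \<Longrightarrow> A \<in> \<Phi> j \<Longrightarrow> op_bound R A c" and d: "\<And>j A. j \<in> J \<Longrightarrow> A \<in> \<Psi> j \<Longrightarrow> op_bound R A d"
    using bdd_mats_uniform[of J R \<Phi>, OF J(1) \<Phi>(1)] bdd_mats_uniform[of J R \<Psi>, OF J(1) \<Phi>(2)] by metis
  fix X assume "X \<in> set_mult R (set_hadamard J (\<lambda>_. \<beta>) \<Phi>) (set_hadamard J (\<lambda>_. \<beta>) \<Psi>)"
  then obtain A B where *: "\<forall>j\<in>J. A j \<in> \<Phi> j" "\<forall>j\<in>J. B j \<in> \<Psi> j"
    "X = mat_mult R (hadamard J (\<lambda>_. \<beta>) A) (hadamard J (\<lambda>_. \<beta>) B)"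
    unfolding set_mult_def set_hadamard_def by blast
  then have "X \<le> hadamard J (\<lambda>_. \<beta>) (\<lambda>j. mat_mult R (A j) (B j))"
    using hadamard_mult_le[OF J \<beta>, of R A c B d] c d by (auto simp: le_fun_def)
  moreover have "hadamard J (\<lambda>_. \<beta>) (\<lambda>j. mat_mult R (A j) (B j)) \<in> set_hadamard J (\<lambda>_. \<beta>) (\<lambda>j. set_mult R (\<Phi> j) (\<Psi> j))"
    using * unfolding set_mult_def set_hadamard_def by blast
  ultimately show "\<exists>Y\<in>set_hadamard J (\<lambda>_. \<beta>) (\<lambda>j. set_mult R (\<Phi> j) (\<Psi> j)). X \<le> Y" by blast
qed

text \<open>Hoelder's inequality for longer products, by induction. The family
  \<open>\<Phi> l\<close> may change from one factor to the next: it is constant when powers are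
  estimated and permuted by \<open>l\<close> when the slots are shuffled.\<close>

lemma dominated_hadamard_prod:
  assumes J: "finite J" "J \<noteq> {}" and \<beta>: "1 \<le> real (card J) * \<beta>"
    and \<Phi>: "\<And>l j. l \<in> set ls \<Longrightarrow> j \<in> J \<Longrightarrow> bdd_mats R (\<Phi> l j)"
  shows "dominated (set_prod R (map (\<lambda>l. set_hadamard J (\<lambda>_. \<beta>) (\<Phi> l)) ls))
    (set_hadamard J (\<lambda>_. \<beta>) (\<lambda>j. set_prod R (map (\<lambda>l. \<Phi> l j) ls)))"
  using \<Phi>
proof (induction ls)
  case Nil
  have "mat_one R \<in> set_hadamard J (\<lambda>_. \<beta>) (\<lambda>_. {mat_one R})"
    unfolding set_hadamard_def using hadamard_one[OF J, of \<beta> R, symmetric] by blast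
  then show ?case by (auto intro!: dominated_subset)
next
  case (Cons l ls)
  have b: "bdd_mats R (set_prod R (map (\<lambda>l. \<Phi> l j) ls))" if "j \<in> J" for j
    using Cons that by (intro bdd_mats_prod) auto
  have h: "bdd_mats R (set_hadamard J (\<lambda>_. \<beta>) (\<Phi> l'))" if "l' \<in> set (l # ls)" for l'
    using that Cons by (intro bdd_mats_hadamard J \<beta>) auto
  have "dominated (set_prod R (map (\<lambda>l. set_hadamard J (\<lambda>_. \<beta>) (\<Phi> l)) (l # ls)))
     (set_mult R (set_hadamard J (\<lambda>_. \<beta>) (\<Phi> l)) (set_hadamard J (\<lambda>_. \<beta>) (\<lambda>j. set_prod R (map (\<lambda>l. \<Phi> l j) ls))))"
    unfolding list.map set_prod_Cons
  proof (rule dominated_mult)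
    show "bdd_mats R (set_prod R (map (\<lambda>l. set_hadamard J (\<lambda>_. \<beta>) (\<Phi> l)) ls))"
      using h by (intro bdd_mats_prod) auto
    show "bdd_mats R (set_hadamard J (\<lambda>_. \<beta>) (\<lambda>j. set_prod R (map (\<lambda>l. \<Phi> l j) ls)))"
      by (intro bdd_mats_hadamard J \<beta> b)
  qed (use Cons h in \<open>auto intro: dominated_subset\<close>)
  also have "dominated \<dots> (set_hadamard J (\<lambda>_. \<beta>) (\<lambda>j. set_mult R (\<Phi> l j) (set_prod R (map (\<lambda>l. \<Phi> l j) ls))))"
    using Cons b by (intro dominated_hadamard_mult J \<beta>) auto
  finally (dominated_trans) show ?case by simp
qed

text \<open>With one common exponent the entrywise product does not see the order of its factors;
  this is the source of the freedom to choose \<open>\<tau>\<close> and to shift cyclically.\<close>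

lemma set_hadamard_reindex:
  assumes "bij_betw \<pi> J' J"
  shows "set_hadamard J (\<lambda>_. \<beta>) \<Phi> \<subseteq> set_hadamard J' (\<lambda>_. \<beta>) (\<lambda>j. \<Phi> (\<pi> j))"
proof
  fix X assume "X \<in> set_hadamard J (\<lambda>_. \<beta>) \<Phi>"
  then obtain A where A: "\<forall>j\<in>J. A j \<in> \<Phi> j" "X = hadamard J (\<lambda>_. \<beta>) A" unfolding set_hadamard_def by blast
  have "X = hadamard J' (\<lambda>_. \<beta>) (\<lambda>j. A (\<pi> j))"
    unfolding A(2) hadamard_def by (intro ext prod.reindex_bij_betw[OF assms, symmetric])
  moreover have "\<forall>j\<in>J'. A (\<pi> j) \<in> \<Phi> (\<pi> j)" using A(1) bij_betwE[OF assms] by blast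
  ultimately show "X \<in> set_hadamard J' (\<lambda>_. \<beta>) (\<lambda>j. \<Phi> (\<pi> j))" unfolding set_hadamard_def by blast
qed

lemma set_adjoint_hadamard:
  "set_adjoint (set_hadamard J \<alpha> \<Phi>) = set_hadamard J \<alpha> (\<lambda>j. set_adjoint (\<Phi> j))"
proof -
  have 1: "mat_adjoint (hadamard J \<alpha> A) = hadamard J \<alpha> (\<lambda>j. mat_adjoint (A j))" for A
    by (simp add: mat_adjoint_def hadamard_def)
  have "hadamard J \<alpha> A \<in> set_adjoint (set_hadamard J \<alpha> \<Phi>)" if "\<forall>j\<in>J. A j \<in> set_adjoint (\<Phi> j)" for A
  proof -
    have "\<forall>j\<in>J. mat_adjoint (A j) \<in> \<Phi> j" using that by (auto simp: set_adjoint_def)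
    then have "hadamard J \<alpha> (\<lambda>j. mat_adjoint (A j)) \<in> set_hadamard J \<alpha> \<Phi>" unfolding set_hadamard_def by blast
    then show ?thesis using 1[of "\<lambda>j. mat_adjoint (A j)"] unfolding set_adjoint_def by force
  qed
  then show ?thesis unfolding set_hadamard_def[of J \<alpha> "\<lambda>j. set_adjoint (\<Phi> j)"]
    by (auto simp: set_adjoint_def set_hadamard_def 1)
qed

lemma set_hadamard_cong: "(\<And>j. j \<in> J \<Longrightarrow> \<Phi> j = \<Psi> j) \<Longrightarrow> set_hadamard J \<alpha> \<Phi> = set_hadamard J \<alpha> \<Psi>"
  unfolding set_hadamard_def by auto

section \<open>Growth rates\<close>

definition mat_norm :: "nat set \<Rightarrow> rmat \<Rightarrow> ennreal" where
  "mat_norm R A = op_norm R (mat_op R A)"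

text \<open>The common shape of both radii: the spectral radius as \<open>\<phi>\<close> gives
  \<open>generalized_spectral_radius\<close>, and the norm gives
  \<open>joint_spectral_radius\<close> with limsup in place of \<open>lim\<close>. The degenerate
  root at \<open>k = 0\<close> does not affect a limsup.\<close>

definition growth :: "(rmat \<Rightarrow> ennreal) \<Rightarrow> nat set \<Rightarrow> rmat set \<Rightarrow> ennreal" where
  "growth \<phi> R \<Phi> = limsup (\<lambda>k. (SUP A\<in>set_power R \<Phi> k. \<phi> A) epowr (1 / real k))"

lemma epowr_ennreal: "0 \<le> c \<Longrightarrow> ennreal c epowr a = ennreal (c powr a)"
  by (simp add: epowr_def)

lemma epowr_mono:
  assumes "x \<le> y" "0 \<le> a"
  shows "x epowr a \<le> y epowr a"
proof (cases "y = top")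
  case False
  then have "x \<noteq> top" using assms by (auto simp: top_unique)
  moreover have "enn2real x \<le> enn2real y" using assms False by (simp add: enn2real_mono top.not_eq_extremum)
  ultimately show ?thesis using False assms by (simp add: epowr_def ennreal_leI powr_mono2)
qed (simp add: epowr_def)

lemma le_ennreal_of_gt:
  assumes "\<And>s. t < s \<Longrightarrow> x \<le> ennreal s" "0 \<le> t"
  shows "x \<le> ennreal t"
proof (rule dense_ge)
  fix y assume "ennreal t < y"
  then show "x \<le> y"
    using assms by (cases y) (auto simp: ennreal_less_iff)
qed

text \<open>The constant \<open>C\<close> is harmless because C^(1/k) tends to 1.\<close>

lemma growth_le:
  assumes t: "0 < t" and C: "0 < C"
    and ev: "\<forall>\<^sub>F k in sequentially. \<forall>A\<in>set_power R \<Phi> k. \<phi> A \<le> ennreal (C * t ^ k)"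
  shows "growth \<phi> R \<Phi> \<le> ennreal t"
proof -
  have "(\<lambda>k. C powr (1 / real k)) \<longlonglongrightarrow> C powr 0"
    using C by (intro tendsto_intros lim_1_over_n) auto
  then have lim: "(\<lambda>k. ennreal (C powr (1 / real k) * t)) \<longlonglongrightarrow> ennreal t"
    using C by (intro tendsto_ennrealI tendsto_eq_intros refl) (auto intro: tendsto_eq_rhs)
  have "growth \<phi> R \<Phi> \<le> limsup (\<lambda>k. ennreal (C powr (1 / real k) * t))"
    unfolding growth_def
  proof (rule Limsup_mono)
    show "\<forall>\<^sub>F k in sequentially. (SUP A\<in>set_power R \<Phi> k. \<phi> A) epowr (1 / real k)
        \<le> ennreal (C powr (1 / real k) * t)"
      using ev eventually_gt_at_top[of 0]
    proof eventually_elim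
      case (elim k)
      have "(SUP A\<in>set_power R \<Phi> k. \<phi> A) epowr (1 / real k) \<le> ennreal (C * t ^ k) epowr (1 / real k)"
        using elim by (intro epowr_mono SUP_least) auto
      also have "\<dots> = ennreal (C powr (1 / real k) * t)"
        using C t elim by (simp add: epowr_ennreal powr_mult powr_powr flip: powr_realpow)
      finally show ?case .
    qed
  qed
  also have "\<dots> = ennreal t" using lim by (intro lim_imp_Limsup) auto
  finally show ?thesis .
qed

lemma le_power_of_epowr_le:
  assumes "x epowr (1 / real k) \<le> ennreal t" "0 < k" "0 < t"
  shows "x \<le> ennreal (t ^ k)"
proof (cases x)
  case (real c)
  then have "c powr (1 / real k) \<le> t" using assms by (simp add: epowr_ennreal)
  then have "(c powr (1 / real k)) powr real k \<le> t powr real k" by (intro powr_mono2) auto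
  then have "c \<le> t ^ k" using assms real by (simp add: powr_powr powr_realpow)
  then show ?thesis using real by (simp add: ennreal_leI)
qed (use assms in \<open>simp add: epowr_def top_unique\<close>)

text \<open>The strict gap turns a limsup of extended roots into real bounds on all late powers, the
  form in which growth rates are used from here on.\<close>

lemma growth_less:
  assumes "growth \<phi> R \<Phi> < ennreal t" "0 < t"
  shows "\<forall>\<^sub>F k in sequentially. \<forall>A\<in>set_power R \<Phi> k. \<phi> A \<le> ennreal (t ^ k)"
  using Limsup_lessD[OF assms(1)[unfolded growth_def]] eventually_gt_at_top[of 0]
proof eventually_elim
  case (elim k)
  then have "(SUP A\<in>set_power R \<Phi> k. \<phi> A) \<le> ennreal (t ^ k)"
    using assms(2) by (intro le_power_of_epowr_le) auto
  then show ?case by (meson SUP_le_iff)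
qed

lemma op_bound_set_power:
  assumes "\<And>A. A \<in> \<Phi> \<Longrightarrow> op_bound R A c" "A \<in> set_power R \<Phi> k"
  shows "op_bound R A (c ^ k)"
  using assms(2)
proof (induction k arbitrary: A)
  case 0
  then show ?case by (simp add: op_bound_one)
next
  case (Suc k)
  then show ?case using assms(1) by (auto simp: set_power_Suc set_mult_def intro!: op_bound_mult)
qed

lemma bdd_mats_op_bound_iff:
  assumes "bdd_mats R \<Phi>" "A \<in> \<Phi>" "0 \<le> c"
  shows "op_bound R A c \<longleftrightarrow> mat_norm R A \<le> ennreal c"
  using assms op_bound_iff_op_norm unfolding bdd_mats_def mat_norm_def by metis

text \<open>Fekete's argument: for k = n q + r a product of length k consists of q blocks of length
  n, each bounded by t^n, and of r < n leftover factors bounded by \<open>c\<close>. The constant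
  \<open>C\<close> absorbs the ratio (c / t)^r of every possible leftover.\<close>

lemma set_power_submult:
  assumes \<Phi>: "bdd_mats R \<Phi>" and n: "0 < n" and t: "0 < t"
    and bound: "\<And>A. A \<in> set_power R \<Phi> n \<Longrightarrow> op_bound R A (t ^ n)"
  shows "\<exists>C>0. \<forall>k. \<forall>A\<in>set_power R \<Phi> k. op_bound R A (C * t ^ k)"
proof -
  obtain c where c: "0 < c" "\<And>A. A \<in> \<Phi> \<Longrightarrow> op_bound R A c" using \<Phi> by (rule bdd_matsE) blast
  define C where "C = (\<Sum>r<n. (c / t) ^ r)"
  have "op_bound R A (C * t ^ k)" if A: "A \<in> set_power R \<Phi> k" for A k
  proof -
    define q r where qr: "q = k div n" "r = k mod n"
    have k: "k = n * q + r" by (simp add: qr)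
    have "r < n" using n by (simp add: qr)
    obtain B D where BD: "B \<in> set_power R (set_power R \<Phi> n) q" "D \<in> set_power R \<Phi> r" "A = mat_mult R B D"
      using A unfolding k set_power_add[OF \<Phi>] set_power_power[OF \<Phi>] set_mult_def by blast
    have "op_bound R A ((t ^ n) ^ q * c ^ r)"
      unfolding BD(3) using op_bound_set_power[OF bound BD(1)] op_bound_set_power[OF c(2) BD(2)] by (intro op_bound_mult)
    moreover have "(t ^ n) ^ q * c ^ r = (c / t) ^ r * t ^ k"
      using t by (simp add: k power_add power_mult power_divide)
    moreover have "(c / t) ^ r \<le> C"
      unfolding C_def using \<open>r < n\<close> c t by (intro member_le_sum) auto
    ultimately show ?thesis using t by (auto elim!: op_bound_weaken intro!: mult_right_mono)
  qed
  moreover have "0 < C" unfolding C_def using n c t by (intro sum_pos) auto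
  ultimately show ?thesis by blast
qed

text \<open>For the norm one good power is enough, by submultiplicativity. So the norm growth rate
  lies below each of its own roots, which makes it a limit and a lower bound at once.\<close>

lemma growth_norm_le:
  assumes "bdd_mats R \<Phi>" "0 < n" "0 < t" "\<And>A. A \<in> set_power R \<Phi> n \<Longrightarrow> op_bound R A (t ^ n)"
  shows "growth (mat_norm R) R \<Phi> \<le> ennreal t"
proof -
  obtain C where C: "0 < C" "\<And>k A. A \<in> set_power R \<Phi> k \<Longrightarrow> op_bound R A (C * t ^ k)"
    using set_power_submult[OF assms] by blast
  show ?thesis
    by (rule growth_le[OF assms(3) C(1)]) (intro always_eventually allI ballI, simp add: mat_norm_def op_norm_le C)
qed

lemma growth_norm_less:
  assumes "bdd_mats R \<Phi>" "growth (mat_norm R) R \<Phi> < ennreal t" "0 < t"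
  shows "\<forall>\<^sub>F k in sequentially. \<forall>A\<in>set_power R \<Phi> k. op_bound R A (t ^ k)"
  using growth_less[OF assms(2,3)]
  by eventually_elim (use assms in \<open>auto simp: bdd_mats_op_bound_iff[OF bdd_mats_power]\<close>)

lemma growth_norm_le_bound:
  assumes "\<And>A. A \<in> \<Phi> \<Longrightarrow> op_bound R A c" "0 < c"
  shows "growth (mat_norm R) R \<Phi> \<le> ennreal c"
proof -
  have "bdd_mats R \<Phi>" using assms(1) unfolding bdd_mats_def by blast
  then show ?thesis
    using assms by (intro growth_norm_le[of _ _ 1]) (auto simp: set_power_1[unfolded One_nat_def])
qed

text \<open>\<open>lim\<close> carries information only if the sequence converges. It does: each
  \<open>X k\<close> with k > 0 lies above the limsup, and hence so does the liminf.\<close>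

lemma joint_spectral_radius_eq_growth:
  assumes \<Phi>: "bdd_mats R \<Phi>"
  shows "joint_spectral_radius R \<Phi> = growth (mat_norm R) R \<Phi>"
proof -
  define X where "X = (\<lambda>k. (SUP A\<in>set_power R \<Phi> k. mat_norm R A) epowr (1 / real k))"
  define L where "L = growth (mat_norm R) R \<Phi>"
  have "L \<le> X k" if k: "0 < k" for k
  proof (rule dense_ge)
    fix y assume y: "X k < y"
    show "L \<le> y"
    proof (cases y)
      case (real s)
      then have s: "0 < s" using y by (metis ennreal_eq_0_iff gr_zeroI not_less_zero not_le)
      have "(SUP A\<in>set_power R \<Phi> k. mat_norm R A) \<le> ennreal (s ^ k)"
        using y k s by (intro le_power_of_epowr_le) (auto simp: X_def real)
      then have "op_bound R A (s ^ k)" if "A \<in> set_power R \<Phi> k" for A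
        using that s by (simp add: bdd_mats_op_bound_iff[OF bdd_mats_power[OF \<Phi>] that] SUP_le_iff)
      then show ?thesis unfolding L_def real using growth_norm_le[OF \<Phi> k s] by simp
    qed simp
  qed
  then have "L \<le> liminf X" by (intro Liminf_bounded) (auto simp: eventually_at_top_dense)
  moreover have "limsup X = L" unfolding X_def L_def growth_def ..
  moreover have "liminf X \<le> limsup X" by (rule Liminf_le_Limsup) simp
  ultimately have "X \<longlonglongrightarrow> L" by (intro Liminf_eq_Limsup) auto
  then show ?thesis unfolding joint_spectral_radius_def L_def[symmetric] X_def mat_norm_def
    by (rule limI)
qed

section \<open>The spectral radius formula\<close>

definition mat_power :: "nat set \<Rightarrow> rmat \<Rightarrow> nat \<Rightarrow> rmat" where
  "mat_power R A k = mat_prod R (replicate k A)"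

lemma mat_power_0 [simp]: "mat_power R A 0 = mat_one R"
  by (simp add: mat_power_def mat_prod_def)

lemma mat_power_Suc: "mat_power R A (Suc k) = mat_mult R A (mat_power R A k)"
  by (simp add: mat_power_def mat_prod_def)

lemma set_power_singleton: "set_power R {A} k = {mat_power R A k}"
  by (induction k) (simp_all add: set_power_Suc mat_power_Suc set_mult_def)

lemma bdd_mats_singleton: "op_bound R A c \<Longrightarrow> bdd_mats R {A}"
  unfolding bdd_mats_def by blast

lemma op_bound_mat_power: "op_bound R A c \<Longrightarrow> op_bound R (mat_power R A k) (c ^ k)"
  by (induction k) (simp_all add: op_bound_one mat_power_Suc op_bound_mult)

lemma mat_power_add:
  assumes "op_bound R A c"
  shows "mat_power R A (k + l) = mat_mult R (mat_power R A k) (mat_power R A l)"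
  using set_power_add[OF bdd_mats_singleton[OF assms], of k l]
  by (simp add: set_power_singleton set_mult_def)

lemma mat_power_Suc2:
  assumes "op_bound R A c"
  shows "mat_power R A (Suc k) = mat_mult R (mat_power R A k) A"
  using mat_power_add[OF assms, of k 1] by (simp add: mat_power_Suc mat_mult_one[OF assms])

lemma mat_op_mat_power:
  assumes A: "op_bound R A c" and x: "x \<in> l2 R"
  shows "mat_op R (mat_power R A (Suc k)) x = mat_op R A (mat_op R (mat_power R A k) x)"
    "mat_op R (mat_power R A (Suc k)) x = mat_op R (mat_power R A k) (mat_op R A x)"
  using mat_op_mult[OF A op_bound_mat_power[OF A] x] mat_op_mult[OF op_bound_mat_power[OF A] A x]
  by (simp add: mat_power_Suc, simp add: mat_power_Suc2[OF A])

lemma mat_op_matrix_sum: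
  assumes A: "\<And>l. l \<in> L \<Longrightarrow> op_bound R (A l) (c l)" and x: "x \<in> l2 R" and L: "finite L"
  shows "mat_op R (\<lambda>i j. \<Sum>l\<in>L. t l * A l i j) x i = (\<Sum>l\<in>L. complex_of_real (t l) * mat_op R (A l) x i)"
proof -
  have "((\<lambda>F. \<Sum>l\<in>L. complex_of_real (t l) * (\<Sum>j\<in>F. complex_of_real (A l i j) * x j)) \<longlongrightarrow>
      (\<Sum>l\<in>L. complex_of_real (t l) * mat_op R (A l) x i)) (finite_subsets_at_top R)"
    unfolding mat_op_def
    by (intro tendsto_intros infsum_tendsto op_bound_row_summable(2)[OF A x])
  moreover have "(\<Sum>l\<in>L. complex_of_real (t l) * (\<Sum>j\<in>F. complex_of_real (A l i j) * x j)) =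
      (\<Sum>j\<in>F. complex_of_real (\<Sum>l\<in>L. t l * A l i j) * x j)" for F
    by (simp add: sum_distrib_left sum_distrib_right mult.assoc) (rule sum.swap)
  ultimately have "((\<lambda>j. complex_of_real (\<Sum>l\<in>L. t l * A l i j) * x j) has_sum
      (\<Sum>l\<in>L. complex_of_real (t l) * mat_op R (A l) x i)) R"
    unfolding has_sum_def by simp
  then show ?thesis unfolding mat_op_def[of R "\<lambda>i j. \<Sum>l\<in>L. t l * A l i j"] by (rule infsumI)
qed

text \<open>If \<open>g > 0\<close> is not in the spectrum, the resolvent stays bounded by \<open>4 M\<close> as \<open>s\<close> decreases to
  \<open>g\<close>, and hence so do the partial sums \<open>N\<close> of its Neumann series. All entries being nonnegative,
  the square of \<open>N\<close> dominates each of the \<open>k + 1\<close> equal terms \<open>A\<^sup>k / s\<^sup>k\<^sup>+\<^sup>2\<close>.\<close>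

lemma resolvent_bounds_powers:
  assumes A: "op_bound R A c" and g: "0 < g" "growth (mat_norm R) R {A} = ennreal g" and M: "0 < M"
    and S: "\<And>x. x \<in> l2 R \<Longrightarrow> S x \<in> l2 R \<and> l2_norm R (S x) \<le> M * l2_norm R x"
    and inv: "\<And>x. x \<in> l2 R \<Longrightarrow> S (\<lambda>i. complex_of_real g * x i - mat_op R A x i) = x"
  shows "op_bound R (mat_power R A k) (g ^ (k + 2) * (16 * M\<^sup>2) / real (k + 1))"
proof -
  let ?P = "mat_power R A"
  note P = op_bound_mat_power[OF A]
  \<comment> \<open>Work at some \<open>s\<close> above \<open>g\<close>, where late powers of A / s
    are bounded by 1; the closeness of \<open>s\<close> to \<open>g\<close> makes an error term at
    most half of the left side, which absorbs it.\<close>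
  have P_s: "op_bound R (?P k) (s ^ (k + 2) * (16 * M\<^sup>2) / real (k + 1))"
    if s: "g < s" "(s - g) * M \<le> 1 / 2" for s
  proof -
    have s0: "0 < s" using g s by simp
    have "\<forall>\<^sub>F K in sequentially. op_bound R (?P K) (s ^ K)"
      using growth_norm_less[OF bdd_mats_singleton[OF A], of s] g s
      by (simp add: set_power_singleton ennreal_less_iff)
    \<comment> \<open>\<open>K\<close> exceeds \<open>k\<close> so that \<open>N\<close> contains
      all terms up to A^k, and the bound on A^K keeps the truncation remainder \<open>w\<close> no
      larger than \<open>x\<close>.\<close>
    then obtain K where K: "k < K" "op_bound R (?P K) (s ^ K)"
      by (metis (no_types, lifting) eventually_at_top_linorder eventually_gt_at_top eventually_conj_iff order_refl)
    define N where "N = (\<lambda>i j. \<Sum>l<K. (1 / s ^ (l + 1)) * ?P l i j)"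
    \<comment> \<open>A crude bound depending on \<open>K\<close>, used only to know that
      \<open>N\<close> is an operator on l2 with nonnegative entries supported in
      \<open>R\<close>.\<close>
    have N_bdd: "op_bound R N (\<Sum>l<K. (1 / s ^ (l + 1)) * c ^ l)"
      unfolding N_def using s0 by (intro op_bound_sum op_bound_scale P) auto
    have N: "op_bound R N (4 * M)"
    proof (rule op_boundI_mat_op)
      fix x assume x: "x \<in> l2 R"
      define y where "y = mat_op R N x"
      have y: "y \<in> l2 R" unfolding y_def by (rule op_bound_mat_op(1)[OF N_bdd x])
      have y_eq: "y = (\<lambda>i. \<Sum>l<K. complex_of_real (1 / s ^ (l + 1)) * mat_op R (?P l) x i)"
        unfolding y_def N_def by (intro ext mat_op_matrix_sum[OF P x]) auto
      have Ay: "mat_op R A y = (\<lambda>i. \<Sum>l<K. complex_of_real (1 / s ^ (l + 1)) * mat_op R (?P (Suc l)) x i)"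
        unfolding y_eq mat_op_mat_power(1)[OF A x]
        by (rule trans[OF mat_op_sum[OF A]]) (simp_all only: mat_op_scale finite_lessThan l2_scale(1)[OF op_bound_mat_op(1)[OF P x]])
      define w where "w = (\<lambda>i. complex_of_real (1 / s ^ K) * mat_op R (?P K) x i)"
      have w: "w \<in> l2 R" "l2_norm R w \<le> l2_norm R x"
      proof -
        have "l2_norm R w \<le> cmod (complex_of_real (1 / s ^ K)) * l2_norm R (mat_op R (?P K) x)"
          unfolding w_def by (intro l2_scale op_bound_mat_op(1)[OF P x])
        also have "\<dots> \<le> cmod (complex_of_real (1 / s ^ K)) * (s ^ K * l2_norm R x)"
          by (intro mult_left_mono op_bound_mat_op(2)[OF K(2) x]) simp
        also have "\<dots> = l2_norm R x" using s0 by (simp add: norm_divide norm_power)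
        finally show "l2_norm R w \<le> l2_norm R x" .
        show "w \<in> l2 R" unfolding w_def by (intro l2_scale op_bound_mat_op(1)[OF P x])
      qed
      \<comment> \<open>Applying s - A telescopes the truncated Neumann series.\<close>
      have tele: "complex_of_real s * y i - mat_op R A y i = x i - w i" for i
      proof -
        define a where "a = (\<lambda>l. complex_of_real (1 / s ^ l) * mat_op R (?P l) x i)"
        have "complex_of_real s * y i - mat_op R A y i = (\<Sum>l<K. a l - a (Suc l))"
          unfolding Ay unfolding y_eq sum_distrib_left sum_subtractf[symmetric] a_def using s0
          by (intro sum.cong) auto
        also have "\<dots> = a 0 - a K" by (rule sum_lessThan_telescope')
        finally show ?thesis using x by (simp add: a_def w_def mat_op_one)
      qed
      \<comment> \<open>\<open>S\<close> maps (g - A) y back to \<open>y\<close>, and (g - A) y = x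
        - w - (s - g) y. So |y| \<le> M (2 |x| + (s - g) |y|) \<le> 2 M |x| + |y| / 2, whence the
        factor 4.\<close>
      let ?u = "\<lambda>i. complex_of_real g * y i - mat_op R A y i"
      have u: "?u = (\<lambda>i. (x i - w i) - complex_of_real (s - g) * y i)"
        using tele by (auto simp: fun_eq_iff algebra_simps)
      have "l2_norm R ?u \<le> (l2_norm R x + l2_norm R w) + cmod (complex_of_real (s - g)) * l2_norm R y"
        unfolding u using x w y l2_diff[of x R w] l2_scale[OF y, of "complex_of_real (s - g)"]
          l2_diff(2)[of "\<lambda>i. x i - w i" R "\<lambda>i. complex_of_real (s - g) * y i"] by linarith
      then have "l2_norm R ?u \<le> 2 * l2_norm R x + (s - g) * l2_norm R y"
        using w(2) s(1) by (simp only: norm_of_real)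
      moreover have "?u \<in> l2 R" unfolding u by (intro l2_diff(1) l2_scale x w y)
      ultimately have "l2_norm R y \<le> M * (2 * l2_norm R x + (s - g) * l2_norm R y)"
        using inv[OF y] S[of ?u] M by (simp del: distrib_left_numeral) (smt (verit) mult_left_mono)
      also have "\<dots> = 2 * M * l2_norm R x + ((s - g) * M) * l2_norm R y" by (simp add: algebra_simps)
      also have "\<dots> \<le> 2 * M * l2_norm R x + (1 / 2) * l2_norm R y"
        using s by (intro add_left_mono mult_right_mono) auto
      finally have "l2_norm R y \<le> 4 * M * l2_norm R x" by simp
      then show "mat_op R N x \<in> l2 R \<and> l2_norm R (mat_op R N x) \<le> 4 * M * l2_norm R x"
        using y unfolding y_def by simp
    qed (use M op_boundD(2,3)[OF N_bdd] in auto)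
    have le: "real (k + 1) / s ^ (k + 2) * ?P k i j \<le> mat_mult R N N i j" for i j
    proof -
      \<comment> \<open>Each product A^l A^(k-l) is an infinite sum over its middle index
        \<open>p\<close>; the comparison with the square of \<open>N\<close> is made termwise in
        \<open>p\<close> and then passes to the limit.\<close>
      have "((\<lambda>F. \<Sum>l\<le>k. \<Sum>p\<in>F. ?P l i p * ?P (k - l) p j) \<longlongrightarrow>
          (\<Sum>l\<le>k. mat_mult R (?P l) (?P (k - l)) i j)) (finite_subsets_at_top R)"
        unfolding mat_mult_def by (intro tendsto_intros infsum_tendsto mat_mult_summable[OF P P])
      then have "((\<lambda>F. (1 / s ^ (k + 2)) * (\<Sum>l\<le>k. \<Sum>p\<in>F. ?P l i p * ?P (k - l) p j)) \<longlongrightarrow>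
          (1 / s ^ (k + 2)) * (\<Sum>l\<le>k. mat_mult R (?P l) (?P (k - l)) i j)) (finite_subsets_at_top R)"
        by (rule tendsto_mult[OF tendsto_const])
      moreover have "\<forall>\<^sub>F F in finite_subsets_at_top R.
          (1 / s ^ (k + 2)) * (\<Sum>l\<le>k. \<Sum>p\<in>F. ?P l i p * ?P (k - l) p j) \<le> mat_mult R N N i j"
      proof (rule eventually_finite_subsets_at_top_weakI)
        fix F assume F: "finite F" "F \<subseteq> R"
        have "(1 / s ^ (k + 2)) * (\<Sum>l\<le>k. ?P l i p * ?P (k - l) p j) \<le> N i p * N p j" for p
        proof -
          have "(1 / s ^ (k + 2)) * (\<Sum>l\<le>k. ?P l i p * ?P (k - l) p j)
              = (\<Sum>l\<le>k. ((1 / s ^ (l + 1)) * ?P l i p) * ((1 / s ^ ((k - l) + 1)) * ?P (k - l) p j))"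
            unfolding sum_distrib_left
          proof (rule sum.cong)
            fix l assume "l \<in> {..k}"
            then have "s ^ (k + 2) = s ^ (l + 1) * s ^ ((k - l) + 1)" by (simp flip: power_add)
            then show "1 / s ^ (k + 2) * (?P l i p * ?P (k - l) p j) =
              ((1 / s ^ (l + 1)) * ?P l i p) * ((1 / s ^ ((k - l) + 1)) * ?P (k - l) p j)"
              by simp
          qed simp
          also have "\<dots> \<le> (\<Sum>l\<le>k. ((1 / s ^ (l + 1)) * ?P l i p) * N p j)"
            unfolding N_def using K(1) s0 op_boundD(2)[OF P]
            by (intro sum_mono mult_left_mono member_le_sum[of _ "{..<K}" "\<lambda>l. 1 / s ^ (l + 1) * ?P l p j"]) auto
          also have "\<dots> \<le> (\<Sum>l<K. ((1 / s ^ (l + 1)) * ?P l i p) * N p j)"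
            using K(1) s0 op_boundD(2)[OF P] op_boundD(2)[OF N] by (intro sum_mono2) auto
          also have "\<dots> = N i p * N p j" unfolding N_def by (simp add: sum_distrib_right)
          finally show ?thesis .
        qed
        then have "(\<Sum>p\<in>F. (1 / s ^ (k + 2)) * (\<Sum>l\<le>k. ?P l i p * ?P (k - l) p j)) \<le> (\<Sum>p\<in>F. N i p * N p j)"
          by (rule sum_mono)
        also have "\<dots> \<le> mat_mult R N N i j"
          unfolding mat_mult_def using F op_boundD(2)[OF N] mat_mult_summable[OF N N]
          by (intro finite_sum_le_infsum) auto
        finally show "(1 / s ^ (k + 2)) * (\<Sum>l\<le>k. \<Sum>p\<in>F. ?P l i p * ?P (k - l) p j) \<le> mat_mult R N N i j"
          unfolding sum_distrib_left[symmetric] by (subst sum.swap)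
      qed
      ultimately have "(1 / s ^ (k + 2)) * (\<Sum>l\<le>k. mat_mult R (?P l) (?P (k - l)) i j) \<le> mat_mult R N N i j"
        by (rule tendsto_upperbound) simp
      moreover have "(\<Sum>l\<le>k. mat_mult R (?P l) (?P (k - l)) i j) = (\<Sum>l\<le>k. ?P k i j)"
        by (intro sum.cong) (auto simp flip: mat_power_add[OF A])
      ultimately show ?thesis by simp
    qed
    have "op_bound R (\<lambda>i j. real (k + 1) / s ^ (k + 2) * ?P k i j) (4 * M * (4 * M))"
      using s0 op_boundD(2)[OF P] by (intro op_bound_mono[OF op_bound_mult[OF N N]] le) auto
    from op_bound_scale[OF this, of "s ^ (k + 2) / real (k + 1)"] s0
    have "op_bound R (?P k) (s ^ (k + 2) / real (k + 1) * (4 * M * (4 * M)))" by simp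
    then show ?thesis by (simp add: power2_eq_square mult_ac)
  qed
  show ?thesis
  proof (rule op_bound_closed)
    fix d assume d: "g ^ (k + 2) * (16 * M\<^sup>2) / real (k + 1) < d"
    have lim: "((\<lambda>s. s ^ (k + 2) * (16 * M\<^sup>2) / real (k + 1)) \<longlongrightarrow> g ^ (k + 2) * (16 * M\<^sup>2) / real (k + 1)) (at_right g)"
      "((\<lambda>s. (s - g) * M) \<longlongrightarrow> 0) (at_right g)"
      by (auto intro!: tendsto_eq_intros)
    have "\<forall>\<^sub>F s in at_right g. s ^ (k + 2) * (16 * M\<^sup>2) / real (k + 1) < d"
      "\<forall>\<^sub>F s in at_right g. (s - g) * M < 1 / 2"
      using order_tendstoD(2)[OF lim(1) d] order_tendstoD(2)[OF lim(2), of "1 / 2"] by simp_all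
    then have "\<forall>\<^sub>F s in at_right g. g < s \<and> (s - g) * M < 1 / 2 \<and> s ^ (k + 2) * (16 * M\<^sup>2) / real (k + 1) < d"
      using eventually_at_right_less[of g] by eventually_elim auto
    then obtain s where "g < s" "(s - g) * M < 1 / 2" "s ^ (k + 2) * (16 * M\<^sup>2) / real (k + 1) < d"
      by (metis (mono_tags, lifting) eventually_happens' trivial_limit_at_right_real)
    then show "op_bound R (?P k) d" using P_s[of s] by (auto intro: op_bound_weaken)
  qed (use g in auto)
qed

lemma op_norm_finiteE:
  assumes "op_norm R T < top"
  obtains C where "0 < C" "\<And>x. x \<in> l2 R \<Longrightarrow> T x \<in> l2 R \<and> l2_norm R (T x) \<le> C * l2_norm R x"
proof -
  obtain C where C: "0 \<le> C" "\<And>x. x \<in> l2 R \<Longrightarrow> T x \<in> l2 R \<and> l2_norm R (T x) \<le> C * l2_norm R x"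
    using assms unfolding op_norm_def Inf_less_iff by blast
  show thesis
  proof (rule that[of "C + 1"])
    show "T x \<in> l2 R \<and> l2_norm R (T x) \<le> (C + 1) * l2_norm R x" if "x \<in> l2 R" for x
      using C(2)[OF that] by (simp add: distrib_right add_increasing2)
  qed (use C in auto)
qed

text \<open>A positive growth rate \<open>g\<close> is itself a spectral value. Otherwise
  \<open>resolvent_bounds_powers\<close> bounds A^k by g^k \<open>\<theta>\<close> with
  \<open>\<theta>\<close> of order 1/k, and a single \<open>k\<close> with \<open>\<theta>\<close> <
  1 already forces the growth rate below \<open>g\<close>.\<close>

lemma growth_le_spectral_radius:
  assumes A: "op_bound R A c"
  shows "growth (mat_norm R) R {A} \<le> spectral_radius R (mat_op R A)"
proof -
  have "growth (mat_norm R) R {A} \<le> ennreal (c + 1)"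
    using op_boundD(1)[OF A] by (intro growth_norm_le_bound) (auto intro: op_bound_weaken[OF A])
  then obtain g where g: "0 \<le> g" "growth (mat_norm R) R {A} = ennreal g"
    by (metis ennreal_cases ennreal_less_top leD)
  show ?thesis
  proof (cases "g = 0")
    case False
    then have g0: "0 < g" using g by simp
    have "complex_of_real g \<in> op_spectrum R (mat_op R A)"
    proof (rule ccontr)
      assume "complex_of_real g \<notin> op_spectrum R (mat_op R A)"
      then obtain S where S: "bounded_operator R S"
        and inv: "\<And>x. x \<in> l2 R \<Longrightarrow> S (\<lambda>i. complex_of_real g * x i - mat_op R A x i) = x"
        unfolding op_spectrum_def by blast
      obtain M where M: "0 < M" "\<And>x. x \<in> l2 R \<Longrightarrow> S x \<in> l2 R \<and> l2_norm R (S x) \<le> M * l2_norm R x"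
        using S unfolding bounded_operator_def by (auto elim: op_norm_finiteE)
      obtain k :: nat where k: "16 * M\<^sup>2 * g\<^sup>2 < real k" using reals_Archimedean2 by blast
      define \<theta> where "\<theta> = 16 * M\<^sup>2 * g\<^sup>2 / real (k + 1)"
      have \<theta>: "0 < \<theta>" "\<theta> < 1" using k M g0 by (auto simp: \<theta>_def divide_less_eq)
      have k0: "0 < k"
        using order.strict_trans1[OF _ k, of 0] by simp
      define t where "t = g * \<theta> powr (1 / real k)"
      have "t ^ k = g ^ k * \<theta>"
        using \<theta> k0 by (simp add: t_def power_mult_distrib powr_powr flip: powr_realpow)
      then have "op_bound R (mat_power R A k) (t ^ k)"
        using resolvent_bounds_powers[OF A g0 g(2) M(1) M(2) inv, of k]
        by (simp add: \<theta>_def power_add power2_eq_square mult_ac)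
      moreover have "0 < t" using \<theta> g0 by (simp add: t_def)
      ultimately have "growth (mat_norm R) R {A} \<le> ennreal t"
        by (intro growth_norm_le[OF bdd_mats_singleton[OF A] k0]) (auto simp: set_power_singleton)
      then have "g \<le> t" unfolding g using \<open>0 < t\<close> by simp
      moreover have "\<theta> powr (1 / real k) < 1" using powr_less_mono2[of "1 / real k" \<theta> 1] \<theta> k0 by simp
      ultimately show False using g0 by (simp add: t_def)
    qed
    then have "ennreal (cmod (complex_of_real g)) \<le> spectral_radius R (mat_op R A)"
      unfolding spectral_radius_def by (rule SUP_upper)
    then show ?thesis using g by simp
  qed (use g in simp)
qed

text \<open>The Weierstrass test in l2, carried out coordinatewise: partial sums are bounded on
  finite sections, and only finitely many coordinates take part in each limit.\<close>

lemma l2_suminf: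
  assumes v: "\<And>k. v k \<in> l2 R" "\<And>k. l2_norm R (v k) \<le> B k" and B: "summable B"
  shows "summable (\<lambda>k. v k i)" "(\<lambda>i. \<Sum>k. v k i) \<in> l2 R" "l2_norm R (\<lambda>i. \<Sum>k. v k i) \<le> suminf B"
proof -
  have B0: "0 \<le> B k" for k using v(2)[of k] l2_norm_nonneg order_trans by blast
  have sm: "summable (\<lambda>k. v k i)" for i
    using order_trans[OF cmod_le_l2_norm[OF v(1)] v(2)]
    by (intro summable_comparison_test[OF _ B]) auto
  then show "summable (\<lambda>k. v k i)" .
  have le: "L2_set (\<lambda>i. cmod (\<Sum>k. v k i)) F \<le> suminf B" if F: "finite F" for F
  proof (rule tendsto_upperbound)
    show "(\<lambda>K. L2_set (\<lambda>i. cmod (\<Sum>k<K. v k i)) F) \<longlonglongrightarrow> L2_set (\<lambda>i. cmod (\<Sum>k. v k i)) F"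
      unfolding L2_set_def by (intro tendsto_intros summable_LIMSEQ sm)
    have "L2_set (\<lambda>i. cmod (\<Sum>k<K. v k i)) F \<le> suminf B" for K
    proof -
      have "L2_set (\<lambda>i. cmod (\<Sum>k<K. v k i)) F \<le> l2_norm R (\<lambda>i. \<Sum>k<K. v k i)"
        by (intro L2_set_le_l2_norm l2_sum v F) simp
      also have "\<dots> \<le> (\<Sum>k<K. l2_norm R (v k))" by (intro l2_sum v) simp
      also have "\<dots> \<le> (\<Sum>k<K. B k)" by (intro sum_mono v)
      also have "\<dots> \<le> suminf B" using B B0 by (intro sum_le_suminf) auto
      finally show ?thesis .
    qed
    then show "\<forall>\<^sub>F K in sequentially. L2_set (\<lambda>i. cmod (\<Sum>k<K. v k i)) F \<le> suminf B" by simp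
  qed simp
  have out: "(\<Sum>k. v k i) = 0" if "i \<notin> R" for i using l2_outside[OF v(1) that] by simp
  show "(\<lambda>i. \<Sum>k. v k i) \<in> l2 R" "l2_norm R (\<lambda>i. \<Sum>k. v k i) \<le> suminf B"
    by (rule l2I; use out le in auto)+
qed

text \<open>Continuity of the operator: the remainder \<open>u\<close> of the series has norm at
  most the tail of \<open>B\<close>.\<close>

lemma mat_op_suminf:
  assumes A: "op_bound R A c"
    and v: "\<And>k. v k \<in> l2 R" "\<And>k. l2_norm R (v k) \<le> B k" and B: "summable B"
  shows "mat_op R A (\<lambda>i. \<Sum>k. v k i) i = (\<Sum>k. mat_op R A (v k) i)"
proof -
  define w where "w = (\<lambda>i. \<Sum>k. v k i)"
  have w: "w \<in> l2 R" unfolding w_def by (rule l2_suminf(2)[OF v B])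
  have "(\<lambda>K. (\<Sum>k<K. mat_op R A (v k) i) - mat_op R A w i) \<longlonglongrightarrow> 0"
  proof (rule Lim_null_comparison)
    show "(\<lambda>K. c * (\<Sum>k. B (k + K))) \<longlonglongrightarrow> 0"
      using suminf_exist_split2[OF B] by (rule tendsto_mult_right_zero)
    have "norm ((\<Sum>k<K. mat_op R A (v k) i) - mat_op R A w i) \<le> c * (\<Sum>k. B (k + K))" for K
    proof -
      define u where "u = (\<lambda>i. \<Sum>k. v (k + K) i)"
      have B': "summable (\<lambda>k. B (k + K))" using B by (rule summable_ignore_initial_segment)
      have u: "u \<in> l2 R" "l2_norm R u \<le> (\<Sum>k. B (k + K))"
        unfolding u_def using l2_suminf(2,3)[OF v(1) v(2) B'] by blast+
      have s: "(\<lambda>i. \<Sum>k<K. v k i) \<in> l2 R" by (intro l2_sum v) simp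
      have "w = (\<lambda>i. (\<Sum>k<K. v k i) + u i)"
        unfolding w_def u_def by (intro ext) (simp add: suminf_split_initial_segment[OF l2_suminf(1)[OF v B], of _ K] add.commute)
      then have "mat_op R A w i = (\<Sum>k<K. mat_op R A (v k) i) + mat_op R A u i"
        using mat_op_add[OF A s u(1)] mat_op_sum[OF A, of "{..<K}" v] v(1) by simp
      then have "norm ((\<Sum>k<K. mat_op R A (v k) i) - mat_op R A w i) = cmod (mat_op R A u i)"
        by (simp add: norm_minus_commute)
      also have "\<dots> \<le> l2_norm R (mat_op R A u)" by (rule cmod_le_l2_norm[OF op_bound_mat_op(1)[OF A u(1)]])
      also have "\<dots> \<le> c * l2_norm R u" by (rule op_bound_mat_op(2)[OF A u(1)])
      also have "\<dots> \<le> c * (\<Sum>k. B (k + K))" by (intro mult_left_mono u op_boundD(1)[OF A])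
      finally show ?thesis .
    qed
    then show "\<forall>\<^sub>F K in sequentially. norm ((\<Sum>k<K. mat_op R A (v k) i) - mat_op R A w i) \<le> c * (\<Sum>k. B (k + K))"
      by simp
  qed
  then have "(\<lambda>k. mat_op R A (v k) i) sums mat_op R A w i" unfolding sums_def by (simp add: LIM_zero_iff)
  then show ?thesis unfolding w_def by (rule sums_unique)
qed

text \<open>For |z| above the growth rate the Neumann series, the sum of z^(-k-1) A^k, converges in
  norm and inverts z - A.\<close>

lemma spectral_radius_le_growth:
  assumes A: "op_bound R A c"
  shows "spectral_radius R (mat_op R A) \<le> growth (mat_norm R) R {A}"
  unfolding spectral_radius_def
proof (intro SUP_least leI notI)
  fix z assume z: "z \<in> op_spectrum R (mat_op R A)" and less: "growth (mat_norm R) R {A} < ennreal (cmod z)"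
  then obtain y where y: "growth (mat_norm R) R {A} < y" "y < ennreal (cmod z)" using dense by blast
  then obtain t where "0 \<le> t" "y = ennreal t" by (cases y) auto
  with y have t: "growth (mat_norm R) R {A} < ennreal t" "0 < t" "t < cmod z"
    by (auto simp: ennreal_less_iff order_le_less)
  let ?P = "mat_power R A"
  note P = op_bound_mat_power[OF A]
  have "\<forall>\<^sub>F k in sequentially. op_bound R (?P k) (t ^ k)"
    using growth_norm_less[OF bdd_mats_singleton[OF A] t(1,2)] by (simp add: set_power_singleton)
  then obtain n where n: "0 < n" "op_bound R (?P n) (t ^ n)"
    by (metis (no_types, lifting) eventually_at_top_linorder eventually_gt_at_top eventually_conj_iff order_refl)
  \<comment> \<open>A bound for every \<open>k\<close>, not only for late ones, majorises the whole
    series by a geometric one of ratio \<open>q\<close>.\<close>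
  obtain C where C: "0 < C" "\<And>k. op_bound R (?P k) (C * t ^ k)"
    using set_power_submult[OF bdd_mats_singleton[OF A] n(1) t(2)] n(2) by (auto simp: set_power_singleton)
  have z0: "z \<noteq> 0" using t by auto
  define q where "q = t / cmod z"
  have q: "0 < q" "q < 1" using t z0 by (auto simp: q_def)
  define v where "v = (\<lambda>x k i. inverse z ^ Suc k * mat_op R (?P k) x i)"
  define B where "B = (\<lambda>x k. C * l2_norm R x / cmod z * q ^ k)"
  have v: "v x k \<in> l2 R" "l2_norm R (v x k) \<le> B x k" if x: "x \<in> l2 R" for x k
  proof -
    show "v x k \<in> l2 R" unfolding v_def by (intro l2_scale op_bound_mat_op[OF P x])
    have "l2_norm R (v x k) \<le> cmod (inverse z ^ Suc k) * l2_norm R (mat_op R (?P k) x)"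
      unfolding v_def by (intro l2_scale op_bound_mat_op[OF P x])
    also have "\<dots> \<le> cmod (inverse z ^ Suc k) * (C * t ^ k * l2_norm R x)"
      by (intro mult_left_mono op_bound_mat_op[OF C(2) x]) simp
    also have "\<dots> = B x k"
      using z0 by (simp add: B_def q_def norm_power norm_mult norm_inverse norm_divide power_divide field_simps)
    finally show "l2_norm R (v x k) \<le> B x k" .
  qed
  have sB: "summable (B x)" for x unfolding B_def using q by (intro summable_mult summable_geometric) simp
  define S where "S = (\<lambda>x i. \<Sum>k. v x k i)"
  have S_add: "S (\<lambda>i. x i + y i) = (\<lambda>i. S x i + S y i)" if "x \<in> l2 R" "y \<in> l2 R" for x y
  proof -
    have "v (\<lambda>i. x i + y i) k i = v x k i + v y k i" for k i
      by (simp add: v_def mat_op_add[OF P that] distrib_left)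
    then show ?thesis
      unfolding S_def using that by (auto simp: suminf_add l2_suminf(1)[OF v sB])
  qed
  have S_scale: "S (\<lambda>i. a * x i) = (\<lambda>i. a * S x i)" if "x \<in> l2 R" for a x
    unfolding S_def
    by (subst suminf_mult[OF l2_suminf(1)[OF v[OF that] sB], symmetric]) (simp add: v_def mat_op_scale mult.left_commute)
  have S_norm: "S x \<in> l2 R \<and> l2_norm R (S x) \<le> (C / cmod z * (\<Sum>k. q ^ k)) * l2_norm R x" if x: "x \<in> l2 R" for x
  proof -
    have "suminf (B x) = (C / cmod z * (\<Sum>k. q ^ k)) * l2_norm R x"
      unfolding B_def using q by (subst suminf_mult) (auto intro: summable_geometric)
    then show ?thesis unfolding S_def using l2_suminf(2,3)[OF v[OF x] sB] by simp
  qed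
  have "0 \<le> C / cmod z * (\<Sum>k. q ^ k)" using C q by (intro mult_nonneg_nonneg suminf_nonneg summable_geometric) auto
  then have "op_norm R S \<le> ennreal (C / cmod z * (\<Sum>k. q ^ k))"
    unfolding op_norm_def using S_norm by (intro Inf_lower) blast
  then have bdd: "bounded_operator R S"
    unfolding bounded_operator_def using S_add S_scale by (auto simp: le_less_trans[OF _ ennreal_less_top])
  have inv1: "S (\<lambda>i. z * x i - mat_op R A x i) = x" if x: "x \<in> l2 R" for x
  proof
    fix i
    \<comment> \<open>The series for S (z - A) x telescopes in \<open>a\<close>, which starts at x
      and tends to 0.\<close>
    define a where "a = (\<lambda>k. inverse z ^ k * mat_op R (?P k) x i)"
    have "a \<longlonglongrightarrow> 0"
    proof (rule Lim_null_comparison)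
      show "(\<lambda>k. C * l2_norm R x * q ^ k) \<longlonglongrightarrow> 0" using q by (intro tendsto_mult_right_zero LIMSEQ_realpow_zero) auto
      have "norm (a k) \<le> C * l2_norm R x * q ^ k" for k
      proof -
        have "cmod (mat_op R (?P k) x i) \<le> C * t ^ k * l2_norm R x"
          using cmod_le_l2_norm[OF op_bound_mat_op(1)[OF P x]] op_bound_mat_op(2)[OF C(2) x] by (rule order_trans)
        then have "norm (a k) \<le> cmod (inverse z ^ k) * (C * t ^ k * l2_norm R x)"
          unfolding a_def norm_mult by (intro mult_left_mono) auto
        also have "\<dots> = C * l2_norm R x * q ^ k"
          using z0 by (simp add: q_def norm_power norm_inverse norm_divide power_divide field_simps)
        finally show ?thesis .
      qed
      then show "\<forall>\<^sub>F k in sequentially. norm (a k) \<le> C * l2_norm R x * q ^ k" by simp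
    qed
    from telescope_sums'[OF this] have "(\<lambda>k. a k - a (Suc k)) sums x i"
      using x by (simp add: a_def mat_op_one)
    moreover have "v (\<lambda>i. z * x i - mat_op R A x i) k i = a k - a (Suc k)" for k
    proof -
      have "mat_op R (?P k) (\<lambda>i. z * x i - mat_op R A x i) = (\<lambda>i. z * mat_op R (?P k) x i - mat_op R (?P (Suc k)) x i)"
        using mat_op_diff[OF P l2_scale(1)[OF x] op_bound_mat_op(1)[OF A x], of k z]
        by (simp add: mat_op_scale mat_op_mat_power(2)[OF A x])
      then show ?thesis using z0 by (simp add: v_def a_def right_diff_distrib)
    qed
    ultimately show "S (\<lambda>i. z * x i - mat_op R A x i) i = x i"
      unfolding S_def by (simp add: sums_iff)
  qed
  have inv2: "(\<lambda>i. z * S x i - mat_op R A (S x) i) = x" if x: "x \<in> l2 R" for x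
  proof -
    have Ax: "mat_op R A x \<in> l2 R" by (rule op_bound_mat_op(1)[OF A x])
    \<comment> \<open>\<open>A\<close> commutes with every term of the series, so the left inverse
      is a right inverse as well.\<close>
    have "mat_op R A (v x k) = v (mat_op R A x) k" for k
      unfolding v_def by (simp add: mat_op_scale mat_op_mat_power[OF A x, symmetric])
    then have "mat_op R A (S x) = S (mat_op R A x)"
      unfolding S_def by (intro ext) (simp add: mat_op_suminf[OF A v[OF x] sB])
    moreover have "S (\<lambda>i. z * x i - mat_op R A x i) = (\<lambda>i. z * S x i - S (mat_op R A x) i)"
      using S_add[OF l2_scale(1)[OF x] l2_scale(1)[OF Ax, of "-1"], of z] S_scale[OF x] S_scale[OF Ax, of "-1"] by simp
    ultimately show ?thesis using inv1[OF x] by simp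
  qed
  show False using z bdd inv1 inv2 unfolding op_spectrum_def by blast
qed

lemma spectral_radius_eq_growth:
  assumes "op_bound R A c"
  shows "spectral_radius R (mat_op R A) = growth (mat_norm R) R {A}"
  using growth_le_spectral_radius[OF assms] spectral_radius_le_growth[OF assms] by (rule antisym[rotated])

section \<open>Growth rates of the norm and of the spectral radius\<close>

abbreviation spec_rad :: "nat set \<Rightarrow> rmat \<Rightarrow> ennreal" where
  "spec_rad R A \<equiv> spectral_radius R (mat_op R A)"

lemma epowr_epowr: "(x epowr a) epowr b = x epowr (a * b)"
  by (simp add: epowr_def powr_powr)

lemma epowr_one [simp]: "x epowr 1 = x"
  by (cases x) (auto simp: epowr_def)

lemma le_epowr_inverse:
  assumes "\<And>t. 0 < t \<Longrightarrow> x < ennreal (t ^ n) \<Longrightarrow> y \<le> ennreal t" "0 < n"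
  shows "y \<le> x epowr (1 / real n)"
proof (rule dense_ge)
  fix w assume w: "x epowr (1 / real n) < w"
  show "y \<le> w"
  proof (cases w)
    case (real t)
    then have t: "0 < t" using w by (metis ennreal_0 not_less_zero order_le_less)
    have "x < ennreal (t ^ n)"
    proof (rule ccontr)
      assume "\<not> x < ennreal (t ^ n)"
      then have "ennreal (t ^ n) epowr (1 / real n) \<le> x epowr (1 / real n)" by (intro epowr_mono) auto
      moreover have "ennreal (t ^ n) epowr (1 / real n) = ennreal t"
        using t assms(2) by (simp add: epowr_ennreal powr_powr flip: powr_realpow)
      ultimately show False using w real by simp
    qed
    then show ?thesis using assms(1) t real by simp
  qed simp
qed

lemma growth_mono:
  assumes "\<And>k A. 0 < k \<Longrightarrow> A \<in> set_power R \<Phi> k \<Longrightarrow> \<exists>B\<in>set_power R \<Psi> k. \<phi> A \<le> \<phi> B"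
  shows "growth \<phi> R \<Phi> \<le> growth \<phi> R \<Psi>"
  unfolding growth_def
proof (rule Limsup_mono)
  show "\<forall>\<^sub>F k in sequentially. (SUP A\<in>set_power R \<Phi> k. \<phi> A) epowr (1 / real k)
      \<le> (SUP A\<in>set_power R \<Psi> k. \<phi> A) epowr (1 / real k)"
    using eventually_gt_at_top[of 0]
    by eventually_elim (intro epowr_mono SUP_mono assms; simp)
qed

lemma set_mult_singleton [simp]: "set_mult R {A} {B} = {mat_mult R A B}"
  by (simp add: set_mult_def)

lemma set_mult_iff: "X \<in> set_mult R \<Phi> \<Psi> \<longleftrightarrow> (\<exists>A\<in>\<Phi>. \<exists>B\<in>\<Psi>. X = mat_mult R A B)"
  unfolding set_mult_def by blast

text \<open>Regrouping U V U V ... U V as U (V U ... V U) V: only the two end factors stand in the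
  way of cyclic invariance.\<close>

lemma set_power_cyclic:
  assumes U: "bdd_mats R U" and V: "bdd_mats R V"
  shows "set_power R (set_mult R U V) (Suc k) = set_mult R U (set_mult R (set_power R (set_mult R V U) k) V)"
proof (induction k)
  case 0
  then show ?case using set_mult_one[OF V] set_mult_one[OF bdd_mats_mult[OF U V]] by (simp add: set_power_Suc)
next
  case (Suc k)
  note b = bdd_mats_mult bdd_mats_power U V
  show ?case
    unfolding set_power_Suc[of R "set_mult R U V" "Suc k"] Suc set_power_Suc[of R "set_mult R V U" k]
    by (simp add: set_mult_assoc b)
qed

text \<open>What the chain needs to know about the quantity inside the supremum; the instances are
  the norm and the spectral radius. Cyclicity is required for growth rates of sets, since the norm
  of a single product is not cyclic. \<open>gauge_power\<close> lets a bound on products of length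
  \<open>k\<close> control the spectral radius of each single member of the set.\<close>

locale matrix_gauge =
  fixes R :: "nat set" and \<phi> :: "rmat \<Rightarrow> ennreal"
  assumes gauge_mono: "op_bound R B c \<Longrightarrow> (\<And>i j. 0 \<le> A i j) \<Longrightarrow> A \<le> B \<Longrightarrow> \<phi> A \<le> \<phi> B"
    and gauge_adjoint: "op_bound R A c \<Longrightarrow> \<phi> (mat_adjoint A) \<le> \<phi> A"
    and gauge_hadamard: "finite (J :: nat set) \<Longrightarrow> J \<noteq> {} \<Longrightarrow> 1 \<le> real (card J) * \<beta> \<Longrightarrow> 0 < t \<Longrightarrow>
      (\<And>j. j \<in> J \<Longrightarrow> op_bound R (M j) c) \<Longrightarrow> (\<And>j. j \<in> J \<Longrightarrow> \<phi> (M j) \<le> ennreal t) \<Longrightarrow>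
      \<phi> (hadamard J (\<lambda>_. \<beta>) M) \<le> ennreal (t powr (real (card J) * \<beta>))"
    and gauge_power: "op_bound R A c \<Longrightarrow> 0 < k \<Longrightarrow> 0 < t \<Longrightarrow> \<phi> (mat_power R A k) \<le> ennreal (t ^ k) \<Longrightarrow>
      spec_rad R A \<le> ennreal t"
    and growth_cyclic: "bdd_mats R U \<Longrightarrow> bdd_mats R V \<Longrightarrow>
      growth \<phi> R (set_mult R U V) \<le> growth \<phi> R (set_mult R V U)"
    and growth_power_less: "bdd_mats R \<Phi> \<Longrightarrow> 0 < n \<Longrightarrow> 0 < t \<Longrightarrow>
      growth \<phi> R (set_power R \<Phi> n) < ennreal (t ^ n) \<Longrightarrow> growth \<phi> R \<Phi> \<le> ennreal t"
begin

lemma growth_dominated: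
  assumes "bdd_mats R \<Phi>" "bdd_mats R \<Psi>" "dominated \<Phi> \<Psi>"
  shows "growth \<phi> R \<Phi> \<le> growth \<phi> R \<Psi>"
proof (rule growth_mono)
  fix k A assume A: "A \<in> set_power R \<Phi> k"
  obtain B where B: "B \<in> set_power R \<Psi> k" "A \<le> B"
    using dominated_power[OF assms] A unfolding dominated_def by blast
  moreover have "0 \<le> A i j" for i j
    using bdd_mats_power[OF assms(1)] A op_boundD(2) unfolding bdd_mats_def by blast
  moreover obtain c where "op_bound R B c"
    using bdd_mats_power[OF assms(2)] B unfolding bdd_mats_def by blast
  ultimately show "\<exists>B\<in>set_power R \<Psi> k. \<phi> A \<le> \<phi> B" using gauge_mono by blast
qed

lemma growth_adjoint:
  assumes "bdd_mats R \<Phi>"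
  shows "growth \<phi> R (set_adjoint \<Phi>) \<le> growth \<phi> R \<Phi>"
proof (rule growth_mono)
  fix k A assume "A \<in> set_power R (set_adjoint \<Phi>) k"
  then obtain B where B: "B \<in> set_power R \<Phi> k" "A = mat_adjoint B"
    by (auto simp: set_adjoint_power[OF assms, symmetric] set_adjoint_def[of "set_power _ _ _"])
  then show "\<exists>B\<in>set_power R \<Phi> k. \<phi> A \<le> \<phi> B"
    using bdd_mats_power[OF assms] gauge_adjoint unfolding bdd_mats_def by blast
qed

text \<open>The k-th power of the Hadamard product is dominated by the Hadamard product of the k-th
  powers. \<open>J\<close> being finite, the bounds s^k hold for all slots at once for late
  \<open>k\<close>, and \<open>s\<close> then decreases to \<open>q0\<close>.\<close>

lemma growth_hadamard:
  fixes J :: "nat set"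
  assumes J: "finite J" "J \<noteq> {}" and \<beta>: "1 \<le> real (card J) * \<beta>"
    and \<Phi>: "\<And>j. j \<in> J \<Longrightarrow> bdd_mats R (\<Phi> j)" "\<And>j. j \<in> J \<Longrightarrow> growth \<phi> R (\<Phi> j) \<le> q"
  shows "growth \<phi> R (set_hadamard J (\<lambda>_. \<beta>) \<Phi>) \<le> q epowr (real (card J) * \<beta>)"
proof (cases q)
  case (real q0)
  let ?b = "real (card J) * \<beta>"
  have le: "growth \<phi> R (set_hadamard J (\<lambda>_. \<beta>) \<Phi>) \<le> ennreal (s powr ?b)" if s: "q0 < s" for s
  proof (rule growth_le[where C = 1])
    have s0: "0 < s" using real s by simp
    then show "0 < s powr ?b" by simp
    have "growth \<phi> R (\<Phi> j) < ennreal s" if "j \<in> J" for j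
      using \<Phi>(2)[OF that] s unfolding real by (auto simp: ennreal_less_iff real(1) elim: le_less_trans)
    then have "\<forall>\<^sub>F k in sequentially. \<forall>j\<in>J. \<forall>A\<in>set_power R (\<Phi> j) k. \<phi> A \<le> ennreal (s ^ k)"
      using s0 by (intro eventually_ball_finite J ballI growth_less) auto
    then show "\<forall>\<^sub>F k in sequentially. \<forall>A\<in>set_power R (set_hadamard J (\<lambda>_. \<beta>) \<Phi>) k. \<phi> A \<le> ennreal (1 * (s powr ?b) ^ k)"
    proof eventually_elim
      case (elim k)
      show ?case
      proof
        fix A assume A: "A \<in> set_power R (set_hadamard J (\<lambda>_. \<beta>) \<Phi>) k"
        have "dominated (set_power R (set_hadamard J (\<lambda>_. \<beta>) \<Phi>) k) (set_hadamard J (\<lambda>_. \<beta>) (\<lambda>j. set_power R (\<Phi> j) k))"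
          \<comment> \<open>Only the length of the index list matters here, as the family is the
            same in every factor.\<close>
          using dominated_hadamard_prod[OF J \<beta>, of "replicate k ()" R "\<lambda>_. \<Phi>"] \<Phi>(1)
          by (simp add: set_power_eq_set_prod map_replicate)
        then obtain B where B: "\<forall>j\<in>J. B j \<in> set_power R (\<Phi> j) k" "A \<le> hadamard J (\<lambda>_. \<beta>) B"
          using A unfolding dominated_def set_hadamard_def by blast
        obtain c where c: "\<And>j. j \<in> J \<Longrightarrow> op_bound R (B j) c"
          using bdd_mats_uniform[of J R "\<lambda>j. set_power R (\<Phi> j) k"] \<Phi>(1) bdd_mats_power J B(1) by blast
        have "bdd_mats R (set_power R (set_hadamard J (\<lambda>_. \<beta>) \<Phi>) k)"
          by (intro bdd_mats_power bdd_mats_hadamard J \<beta> \<Phi>)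
        then have "0 \<le> A i j" for i j using A op_boundD(2) unfolding bdd_mats_def by blast
        moreover have "op_bound R (hadamard J (\<lambda>_. \<beta>) B) (max c 1 powr ?b)"
          by (intro op_bound_hadamard J \<beta> op_bound_weaken[OF c]) auto
        ultimately have "\<phi> A \<le> \<phi> (hadamard J (\<lambda>_. \<beta>) B)" using gauge_mono B(2) by blast
        also have "\<dots> \<le> ennreal ((s ^ k) powr ?b)"
          using elim B(1) s0 by (intro gauge_hadamard[where c = c] J \<beta> c) auto
        also have "(s ^ k) powr ?b = (s powr ?b) ^ k"
          using s0 by (simp add: powr_powr mult.commute flip: powr_realpow)
        finally show "\<phi> A \<le> ennreal (1 * (s powr ?b) ^ k)" by simp
      qed
    qed
  qed simp
  have "((\<lambda>s. s powr ?b) \<longlongrightarrow> q0 powr ?b) (at_right q0)"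
    using \<beta> real by (intro tendsto_powr2 tendsto_intros) (auto intro: eventually_mono[OF eventually_at_right_less])
  then have "((\<lambda>s. ennreal (s powr ?b)) \<longlongrightarrow> ennreal (q0 powr ?b)) (at_right q0)" by (rule tendsto_ennrealI)
  moreover have "\<forall>\<^sub>F s in at_right q0. growth \<phi> R (set_hadamard J (\<lambda>_. \<beta>) \<Phi>) \<le> ennreal (s powr ?b)"
    using eventually_at_right_less[of q0] by eventually_elim (rule le)
  ultimately have "growth \<phi> R (set_hadamard J (\<lambda>_. \<beta>) \<Phi>) \<le> ennreal (q0 powr ?b)"
    by (rule tendsto_lowerbound) simp
  then show ?thesis using real by (simp add: epowr_ennreal)
qed (simp add: epowr_def)

lemma growth_power:
  assumes "bdd_mats R \<Phi>" "0 < n"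
  shows "growth \<phi> R \<Phi> \<le> growth \<phi> R (set_power R \<Phi> n) epowr (1 / real n)"
  using growth_power_less[OF assms] assms(2) by (rule le_epowr_inverse)

text \<open>A^k is one of the products in the k-th power of the set, so late bounds on that power
  reach it. This leads from the single matrix A^T A to the radius of a set, for either choice of
  \<open>r\<close>.\<close>

lemma spec_rad_le_growth:
  assumes \<Phi>: "bdd_mats R \<Phi>" and A: "A \<in> \<Phi>"
  shows "spec_rad R A \<le> growth \<phi> R \<Phi>"
proof -
  obtain c where c: "op_bound R A c" using assms unfolding bdd_mats_def by blast
  have "spec_rad R A \<le> growth \<phi> R \<Phi> epowr (1 / real 1)"
  proof (rule le_epowr_inverse)
    fix t :: real assume t: "0 < t" "growth \<phi> R \<Phi> < ennreal (t ^ 1)"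
    then have "\<forall>\<^sub>F k in sequentially. 0 < k \<and> (\<forall>A\<in>set_power R \<Phi> k. \<phi> A \<le> ennreal (t ^ k))"
      by (intro eventually_conj eventually_gt_at_top growth_less) auto
    then obtain k where k: "0 < k" "\<forall>A\<in>set_power R \<Phi> k. \<phi> A \<le> ennreal (t ^ k)"
      by (metis (mono_tags, lifting) eventually_happens' sequentially_bot)
    have "mat_power R A k \<in> set_power R \<Phi> k"
      using set_power_mono[of "{A}" \<Phi> R k] A by (auto simp: set_power_singleton)
    then show "spec_rad R A \<le> ennreal t" using gauge_power[OF c k(1) t(1)] k(2) by blast
  qed simp
  then show ?thesis by simp
qed

end

section \<open>The norm and the spectral radius satisfy the laws\<close>

lemma ennreal_le_of_less:
  assumes "\<And>t. 0 < t \<Longrightarrow> x < ennreal t \<Longrightarrow> y \<le> ennreal t"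
  shows "y \<le> x"
  using le_epowr_inverse[of x 1 y] assms by simp

interpretation norm_gauge: matrix_gauge R "mat_norm R" for R
proof
  fix A B :: rmat and c
  assume B: "op_bound R B c" and A: "\<And>i j. 0 \<le> A i j" "A \<le> B"
  show "mat_norm R A \<le> mat_norm R B"
  proof (rule ennreal_le_of_less)
    fix t :: real assume t: "0 < t" "mat_norm R B < ennreal t"
    then have "op_bound R B t" using op_bound_iff_op_norm[OF B] by (simp add: mat_norm_def)
    then have "op_bound R A t" using A by (auto intro: op_bound_mono simp: le_fun_def)
    then show "mat_norm R A \<le> ennreal t" unfolding mat_norm_def by (rule op_norm_le)
  qed
next
  fix A c assume A: "op_bound R A c"
  show "mat_norm R (mat_adjoint A) \<le> mat_norm R A"
  proof (rule ennreal_le_of_less)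
    fix t :: real assume t: "0 < t" "mat_norm R A < ennreal t"
    then have "op_bound R A t" using op_bound_iff_op_norm[OF A] by (simp add: mat_norm_def)
    then show "mat_norm R (mat_adjoint A) \<le> ennreal t"
      unfolding mat_norm_def by (intro op_norm_le op_bound_adjoint)
  qed
next
  fix J :: "nat set" and \<beta> t c and A :: "nat \<Rightarrow> rmat"
  assume J: "finite J" "J \<noteq> {}" "1 \<le> real (card J) * \<beta>" and t: "0 < t"
    and A: "\<And>j. j \<in> J \<Longrightarrow> op_bound R (A j) c" "\<And>j. j \<in> J \<Longrightarrow> mat_norm R (A j) \<le> ennreal t"
  have "op_bound R (A j) t" if "j \<in> J" for j
    using op_bound_iff_op_norm[OF A(1)] A(2) that t by (simp add: mat_norm_def)
  then show "mat_norm R (hadamard J (\<lambda>_. \<beta>) A) \<le> ennreal (t powr (real (card J) * \<beta>))"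
    unfolding mat_norm_def by (intro op_norm_le op_bound_hadamard J t)
next
  fix A c and k :: nat and t :: real
  assume A: "op_bound R A c" and k: "0 < k" and t: "0 < t" "mat_norm R (mat_power R A k) \<le> ennreal (t ^ k)"
  then have "op_bound R (mat_power R A k) (t ^ k)"
    using op_bound_iff_op_norm[OF op_bound_mat_power[OF A]] by (simp add: mat_norm_def)
  then show "spec_rad R A \<le> ennreal t"
    unfolding spectral_radius_eq_growth[OF A]
    by (intro growth_norm_le[OF bdd_mats_singleton[OF A] k t(1)]) (simp add: set_power_singleton)
next
  fix U V assume UV: "bdd_mats R U" "bdd_mats R V"
  obtain u v where u: "0 < u" "\<And>A. A \<in> U \<Longrightarrow> op_bound R A u" and v: "0 < v" "\<And>A. A \<in> V \<Longrightarrow> op_bound R A v"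
    using UV by (metis bdd_matsE)
  show "growth (mat_norm R) R (set_mult R U V) \<le> growth (mat_norm R) R (set_mult R V U)"
  proof (rule ennreal_le_of_less)
    fix t :: real assume t: "0 < t" "growth (mat_norm R) R (set_mult R V U) < ennreal t"
    have "\<forall>\<^sub>F k in sequentially. \<forall>A\<in>set_power R (set_mult R V U) k. op_bound R A (t ^ k)"
      using UV t by (intro growth_norm_less bdd_mats_mult) auto
    \<comment> \<open>The end factors of U (V U)^k V cost the constant \<open>u * v\<close>; the
      division by \<open>t\<close> pays for the shift from \<open>k\<close> to
      \<open>Suc k\<close>.\<close>
    then have "\<forall>\<^sub>F k in sequentially. (\<lambda>k. \<forall>A\<in>set_power R (set_mult R U V) k.
        mat_norm R A \<le> ennreal (u * v / t * t ^ k)) (Suc k)"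
    proof eventually_elim
      case (elim k)
      have "\<forall>A\<in>set_power R (set_mult R U V) (Suc k). mat_norm R A \<le> ennreal (u * v / t * t ^ Suc k)"
      proof
        fix A assume "A \<in> set_power R (set_mult R U V) (Suc k)"
        then obtain X Y Z where "X \<in> U" "Y \<in> set_power R (set_mult R V U) k" "Z \<in> V"
          "A = mat_mult R X (mat_mult R Y Z)"
          by (auto simp: set_power_cyclic[OF UV] set_mult_iff)
        then have "op_bound R A (u * (t ^ k * v))" using elim u v by (auto intro!: op_bound_mult)
        then show "mat_norm R A \<le> ennreal (u * v / t * t ^ Suc k)"
          unfolding mat_norm_def using t by (intro op_norm_le) (simp add: mult_ac)
      qed
      then show ?case .
    qed
    from eventually_sequentially_Suc[THEN iffD1, OF this]
    show "growth (mat_norm R) R (set_mult R U V) \<le> ennreal t"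
      using u v t(1) by (intro growth_le[where C = "u * v / t"]) (simp_all only: divide_pos_pos mult_pos_pos)
  qed
next
  fix \<Phi> and n :: nat and t :: real
  assume \<Phi>: "bdd_mats R \<Phi>" and n: "0 < n" and t: "0 < t"
    "growth (mat_norm R) R (set_power R \<Phi> n) < ennreal (t ^ n)"
  have "\<forall>\<^sub>F k in sequentially. 0 < k \<and> (\<forall>A\<in>set_power R (set_power R \<Phi> n) k. op_bound R A ((t ^ n) ^ k))"
    using t by (intro eventually_conj eventually_gt_at_top growth_norm_less bdd_mats_power \<Phi>) auto
  then obtain k where k: "0 < k" "\<forall>A\<in>set_power R (set_power R \<Phi> n) k. op_bound R A ((t ^ n) ^ k)"
    by (metis (mono_tags, lifting) eventually_happens' sequentially_bot)
  show "growth (mat_norm R) R \<Phi> \<le> ennreal t"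
    by (rule growth_norm_le[OF \<Phi> _ t(1), of "n * k"]) (use k n in \<open>auto simp: set_power_power[OF \<Phi>] power_mult\<close>)
qed

text \<open>The spectral radius of A is the norm growth rate of {A}, so laws about single matrices
  are the consequences of \<open>norm_gauge\<close> for singletons.\<close>

interpretation spec_gauge: matrix_gauge R "spec_rad R" for R
proof
  fix A B :: rmat and c
  assume B: "op_bound R B c" and A: "\<And>i j. 0 \<le> A i j" "A \<le> B"
  have A': "op_bound R A c" using A by (auto intro: op_bound_mono[OF B] simp: le_fun_def)
  show "spec_rad R A \<le> spec_rad R B"
    unfolding spectral_radius_eq_growth[OF B] spectral_radius_eq_growth[OF A']
    by (intro norm_gauge.growth_dominated bdd_mats_singleton[OF B] bdd_mats_singleton[OF A'])
       (simp add: dominated_def A)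
next
  fix A c assume A: "op_bound R A c"
  show "spec_rad R (mat_adjoint A) \<le> spec_rad R A"
    unfolding spectral_radius_eq_growth[OF A] spectral_radius_eq_growth[OF op_bound_adjoint[OF A]]
    using norm_gauge.growth_adjoint[OF bdd_mats_singleton[OF A]] by (simp add: set_adjoint_def)
next
  fix J :: "nat set" and \<beta> t c and A :: "nat \<Rightarrow> rmat"
  assume J: "finite J" "J \<noteq> {}" "1 \<le> real (card J) * \<beta>" and t: "0 < t"
    and A: "\<And>j. j \<in> J \<Longrightarrow> op_bound R (A j) c" "\<And>j. j \<in> J \<Longrightarrow> spec_rad R (A j) \<le> ennreal t"
  have H: "op_bound R (hadamard J (\<lambda>_. \<beta>) A) (max c 1 powr (real (card J) * \<beta>))"
    by (intro op_bound_hadamard J op_bound_weaken[OF A(1)]) auto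
  have "set_hadamard J (\<lambda>_. \<beta>) (\<lambda>j. {A j}) = {hadamard J (\<lambda>_. \<beta>) A}"
    unfolding set_hadamard_def by (auto simp: hadamard_def fun_eq_iff cong: prod.cong)
  then show "spec_rad R (hadamard J (\<lambda>_. \<beta>) A) \<le> ennreal (t powr (real (card J) * \<beta>))"
    using norm_gauge.growth_hadamard[OF J, of R "\<lambda>j. {A j}" "ennreal t"] A t
    by (simp add: spectral_radius_eq_growth[OF H] spectral_radius_eq_growth[OF A(1)] bdd_mats_singleton[OF A(1)] epowr_ennreal)
next
  fix A c and k :: nat and t :: real
  assume A: "op_bound R A c" and k: "0 < k" and t: "0 < t" "spec_rad R (mat_power R A k) \<le> ennreal (t ^ k)"
  show "spec_rad R A \<le> ennreal t"
  proof (rule le_ennreal_of_gt)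
    fix s assume s: "t < s"
    have "ennreal (t ^ k) < ennreal (s ^ k)"
      using s t k by (auto simp: ennreal_less_iff intro: power_strict_mono)
    then show "spec_rad R A \<le> ennreal s"
      using norm_gauge.growth_power_less[OF bdd_mats_singleton[OF A] k, of s] s t
      by (simp add: spectral_radius_eq_growth[OF A] spectral_radius_eq_growth[OF op_bound_mat_power[OF A]] set_power_singleton)
  qed (use t in simp)
next
  fix U V assume UV: "bdd_mats R U" "bdd_mats R V"
  show "growth (spec_rad R) R (set_mult R U V) \<le> growth (spec_rad R) R (set_mult R V U)"
  proof (rule growth_mono)
    fix k A assume k: "0 < k" and A: "A \<in> set_power R (set_mult R U V) k"
    then obtain l where l: "k = Suc l" by (cases k) auto
    obtain X Y Z where XYZ: "X \<in> U" "Y \<in> set_power R (set_mult R V U) l" "Z \<in> V"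
      "A = mat_mult R X (mat_mult R Y Z)"
      using A by (auto simp: l set_power_cyclic[OF UV] set_mult_iff)
    obtain x y z where b: "op_bound R X x" "op_bound R Y y" "op_bound R Z z"
      using XYZ UV bdd_mats_power[OF bdd_mats_mult[OF UV(2,1)]] unfolding bdd_mats_def by metis
    note YZ = op_bound_mult[OF b(2,3)]
    \<comment> \<open>Unlike the norm, the spectral radius is cyclic on single matrices: moving X to
      the end gives a member of the same power of V U, and no constant is lost.\<close>
    have "spec_rad R A \<le> spec_rad R (mat_mult R (mat_mult R Y Z) X)"
      unfolding XYZ(4) spectral_radius_eq_growth[OF op_bound_mult[OF b(1) YZ]]
        spectral_radius_eq_growth[OF op_bound_mult[OF YZ b(1)]]
      using norm_gauge.growth_cyclic[OF bdd_mats_singleton[OF b(1)] bdd_mats_singleton[OF YZ]] by simp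
    moreover have "mat_mult R (mat_mult R Y Z) X \<in> set_power R (set_mult R V U) (l + 1)"
      unfolding set_power_add[OF bdd_mats_mult[OF UV(2,1)]] set_power_1[OF bdd_mats_mult[OF UV(2,1)]]
        mat_mult_assoc[OF b(2,3,1)] using XYZ unfolding set_mult_def by blast
    ultimately show "\<exists>B\<in>set_power R (set_mult R V U) k. spec_rad R A \<le> spec_rad R B" using l by auto
  qed
next
  fix \<Phi> and n :: nat and t :: real
  assume \<Phi>: "bdd_mats R \<Phi>" and n: "0 < n" and t: "0 < t"
    "growth (spec_rad R) R (set_power R \<Phi> n) < ennreal (t ^ n)"
  have "\<forall>\<^sub>F k in sequentially. \<forall>A\<in>set_power R (set_power R \<Phi> n) k. spec_rad R A \<le> ennreal ((t ^ n) ^ k)"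
    using t by (intro growth_less) auto
  then have "\<forall>\<^sub>F k in sequentially. \<forall>A\<in>set_power R \<Phi> k. spec_rad R A \<le> ennreal (1 * t ^ k)"
  proof eventually_elim
    case (elim k)
    show ?case
    proof
      fix A assume A: "A \<in> set_power R \<Phi> k"
      obtain c where c: "op_bound R A c" using A bdd_mats_power[OF \<Phi>] unfolding bdd_mats_def by blast
      \<comment> \<open>The two exponents change places: A^n is a product of n k factors, hence also
        a k-fold product of members of the n-th power.\<close>
      have "mat_power R A n \<in> set_power R (set_power R \<Phi> k) n"
        using set_power_mono[of "{A}" "set_power R \<Phi> k" R n] A by (simp add: set_power_singleton)
      then have "spec_rad R (mat_power R A n) \<le> ennreal ((t ^ n) ^ k)"
        using elim by (simp add: set_power_power[OF \<Phi>] mult.commute)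
      then have "growth (mat_norm R) R (set_power R {A} n) \<le> ennreal ((t ^ k) ^ n)"
        by (simp add: set_power_singleton spectral_radius_eq_growth[OF op_bound_mat_power[OF c]] mult.commute flip: power_mult)
      note le = this
      have "spec_rad R A \<le> ennreal (t ^ k)"
      proof (rule le_ennreal_of_gt)
        fix s assume s: "t ^ k < s"
        have s0: "0 < s" using s t zero_less_power[of t k] by linarith
        have "ennreal ((t ^ k) ^ n) < ennreal (s ^ n)"
          using s t n by (auto simp: ennreal_less_iff intro: power_strict_mono)
        then show "spec_rad R A \<le> ennreal s"
          using norm_gauge.growth_power_less[OF bdd_mats_singleton[OF c] n s0] le
          by (simp add: spectral_radius_eq_growth[OF c])
      qed (use t in simp)
      then show "spec_rad R A \<le> ennreal (1 * t ^ k)" by simp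
    qed
  qed
  then show "growth (spec_rad R) R \<Phi> \<le> ennreal t" using t by (intro growth_le[where C = 1]) auto
qed

section \<open>The chain of inequalities\<close>

lemma mat_adjoint_mat_power:
  assumes "op_bound R A c" "mat_adjoint A = A"
  shows "mat_adjoint (mat_power R A k) = mat_power R A k"
proof -
  have "set_adjoint {mat_power R A k} = {mat_power R A k}"
    using set_adjoint_power[OF bdd_mats_singleton[OF assms(1)], of k] assms(2)
    by (simp add: set_power_singleton set_adjoint_def)
  then show ?thesis by (simp add: set_adjoint_def)
qed

text \<open>For symmetric A the power 2^(p+1) is B^T B with B = A^(2^p), so the C*-argument halves
  the exponent at every step.\<close>

lemma op_bound_of_symmetric_power:
  assumes A: "op_bound R A c" "mat_adjoint A = A" and t: "0 < t"
    and bound: "op_bound R (mat_power R A (2 ^ p)) (t ^ 2 ^ p)"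
  shows "op_bound R A t"
  using bound
proof (induction p)
  case 0
  then show ?case by (simp add: mat_power_Suc mat_mult_one[OF A(1)])
next
  case (Suc p)
  have "mat_power R A (2 ^ Suc p) = mat_mult R (mat_adjoint (mat_power R A (2 ^ p))) (mat_power R A (2 ^ p))"
    using mat_power_add[OF A(1), of "2 ^ p" "2 ^ p"] by (simp add: mat_adjoint_mat_power[OF A] mult_2)
  moreover have "t ^ 2 ^ Suc p = (t ^ 2 ^ p)\<^sup>2" by (simp add: power_mult[symmetric] mult.commute)
  ultimately have "op_bound R (mat_power R A (2 ^ p)) (t ^ 2 ^ p)"
    using Suc.prems t by (intro op_bound_cstar[OF op_bound_mat_power[OF A(1)]]) auto
  then show ?case by (rule Suc.IH)
qed

text \<open>S = A^T A is symmetric, so its norm is controlled by its growth rate, which is its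
  spectral radius; the C*-argument once more passes from S to A.\<close>

lemma mat_norm_le_spec_rad:
  assumes A: "op_bound R A c"
  shows "mat_norm R A \<le> spec_rad R (mat_mult R (mat_adjoint A) A) epowr (1 / real 2)"
proof (rule le_epowr_inverse)
  define S where "S = mat_mult R (mat_adjoint A) A"
  have S: "op_bound R S (c * c)" unfolding S_def by (rule op_bound_mult[OF op_bound_adjoint[OF A] A])
  have sym: "mat_adjoint S = S" unfolding S_def by (simp add: mat_adjoint_mult)
  fix t :: real assume t: "0 < t" "spec_rad R (mat_mult R (mat_adjoint A) A) < ennreal (t ^ 2)"
  then have "\<forall>\<^sub>F k in sequentially. op_bound R (mat_power R S k) ((t\<^sup>2) ^ k)"
    using growth_norm_less[OF bdd_mats_singleton[OF S], of "t\<^sup>2"]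
    by (simp add: spectral_radius_eq_growth[OF S] set_power_singleton flip: S_def)
  then obtain N where N: "\<And>k. N \<le> k \<Longrightarrow> op_bound R (mat_power R S k) ((t\<^sup>2) ^ k)"
    unfolding eventually_sequentially by blast
  \<comment> \<open>The bounds are available for late powers only; 2^N is a power of two beyond
    \<open>N\<close>.\<close>
  have "op_bound R (mat_power R S (2 ^ N)) ((t\<^sup>2) ^ 2 ^ N)"
    by (rule N) (simp add: less_imp_le less_exp)
  then have "op_bound R S (t\<^sup>2)" using t by (intro op_bound_of_symmetric_power[OF S sym]) auto
  then have "op_bound R A t" using t unfolding S_def by (intro op_bound_cstar[OF A]) auto
  then show "mat_norm R A \<le> ennreal t" unfolding mat_norm_def by (rule op_norm_le)
qed simp

lemma set_prod_mono: "list_all2 (\<subseteq>) \<Phi>s \<Psi>s \<Longrightarrow> set_prod R \<Phi>s \<subseteq> set_prod R \<Psi>s"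
  by (induction rule: list_all2_induct) (auto intro: set_mult_mono[THEN subsetD])

lemma set_prod_pair:
  assumes "bdd_mats R \<Psi>"
  shows "set_prod R [\<Phi>, \<Psi>] = set_mult R \<Phi> \<Psi>"
  by (simp add: set_mult_one[OF assms])

text \<open>The two halves become the two factors of a Hadamard product with exponents 1 and 1,
  whose sum 2 is the origin of the square root in the chain.\<close>

lemma set_hadamard_split:
  assumes J: "finite J" "finite K" "J \<inter> K = {}"
  shows "set_hadamard (J \<union> K) (\<lambda>_. \<beta>) \<Phi> \<subseteq>
    set_hadamard {0, 1} (\<lambda>_. 1) (\<lambda>i. set_hadamard (if i = 0 then J else K) (\<lambda>_. \<beta>) \<Phi>)"
proof
  fix X assume "X \<in> set_hadamard (J \<union> K) (\<lambda>_. \<beta>) \<Phi>"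
  then obtain A where A: "\<forall>j\<in>J \<union> K. A j \<in> \<Phi> j" "X = hadamard (J \<union> K) (\<lambda>_. \<beta>) A"
    unfolding set_hadamard_def by blast
  define B where "B = (\<lambda>i::nat. hadamard (if i = 0 then J else K) (\<lambda>_. \<beta>) A)"
  have "X = hadamard {0, 1} (\<lambda>_. 1) B"
    \<comment> \<open>x powr 1 = x holds for nonnegative x only.\<close>
    using hadamard_nonneg[of J \<beta> A] hadamard_nonneg[of K \<beta> A]
    by (simp add: A(2) B_def hadamard_def prod.union_disjoint[OF J] fun_eq_iff)
  moreover have "\<forall>i\<in>{0, 1}. B i \<in> set_hadamard (if i = 0 then J else K) (\<lambda>_. \<beta>) \<Phi>"
    using A(1) unfolding B_def set_hadamard_def by auto
  ultimately show "X \<in> set_hadamard {0, 1} (\<lambda>_. 1) (\<lambda>i. set_hadamard (if i = 0 then J else K) (\<lambda>_. \<beta>) \<Phi>)"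
    unfolding set_hadamard_def by blast
qed

context matrix_gauge
begin

text \<open>The same A is used in both factors of A^T A, but its Hadamard factors are listed along
  \<open>\<pi>\<close> in A^T and along \<open>\<pi>'\<close> in A; Hoelder's inequality then puts
  A^T A below a member of the set on the right.\<close>

lemma set_norm_hadamard_le:
  fixes J :: "nat set"
  assumes J: "finite J" "J \<noteq> {}" and \<beta>: "1 \<le> real (card J) * \<beta>"
    and \<Psi>: "\<And>j. j \<in> J \<Longrightarrow> bdd_mats R (\<Psi> j)"
    and \<pi>: "bij_betw \<pi> J J" "bij_betw \<pi>' J J"
  shows "set_norm R (set_hadamard J (\<lambda>_. \<beta>) \<Psi>) \<le>
    growth \<phi> R (set_hadamard J (\<lambda>_. \<beta>) (\<lambda>j. set_mult R (set_adjoint (\<Psi> (\<pi> j))) (\<Psi> (\<pi>' j)))) epowr (1 / 2)"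
  unfolding set_norm_def
proof (rule SUP_least)
  let ?H = "set_hadamard J (\<lambda>_. \<beta>)"
  let ?T = "?H (\<lambda>j. set_mult R (set_adjoint (\<Psi> (\<pi> j))) (\<Psi> (\<pi>' j)))"
  fix A assume A: "A \<in> ?H \<Psi>"
  have \<Psi>': "bdd_mats R (\<Psi> (\<pi> j))" "bdd_mats R (\<Psi> (\<pi>' j))" if "j \<in> J" for j
    using \<Psi> bij_betwE[OF \<pi>(1)] bij_betwE[OF \<pi>(2)] that by auto
  obtain c where c: "op_bound R A c"
    using bdd_mats_hadamard[of J \<beta> R \<Psi>, OF J \<beta> \<Psi>] A unfolding bdd_mats_def by blast
  have "A \<in> ?H (\<lambda>j. \<Psi> (\<pi> j))" using A set_hadamard_reindex[OF \<pi>(1), of \<beta> \<Psi>] by blast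
  then have "mat_adjoint A \<in> ?H (\<lambda>j. set_adjoint (\<Psi> (\<pi> j)))"
    unfolding set_adjoint_hadamard[symmetric] set_adjoint_def[of "?H _"] by blast
  moreover have "A \<in> ?H (\<lambda>j. \<Psi> (\<pi>' j))" using A set_hadamard_reindex[OF \<pi>(2), of \<beta> \<Psi>] by blast
  ultimately have "mat_mult R (mat_adjoint A) A \<in> set_mult R (?H (\<lambda>j. set_adjoint (\<Psi> (\<pi> j)))) (?H (\<lambda>j. \<Psi> (\<pi>' j)))"
    unfolding set_mult_iff by blast
  moreover have "dominated (set_mult R (?H (\<lambda>j. set_adjoint (\<Psi> (\<pi> j)))) (?H (\<lambda>j. \<Psi> (\<pi>' j)))) ?T"
    by (intro dominated_hadamard_mult J \<beta> bdd_mats_adjoint \<Psi>')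
  ultimately obtain B where B: "B \<in> ?T" "mat_mult R (mat_adjoint A) A \<le> B"
    unfolding dominated_def by blast
  have T: "bdd_mats R ?T"
    by (intro bdd_mats_hadamard J \<beta> bdd_mats_mult bdd_mats_adjoint \<Psi>')
  then obtain b where b: "op_bound R B b" using B(1) unfolding bdd_mats_def by blast
  have "op_norm R (mat_op R A) \<le> spec_rad R (mat_mult R (mat_adjoint A) A) epowr (1 / 2)"
    using mat_norm_le_spec_rad[OF c] by (simp add: mat_norm_def)
  also have "\<dots> \<le> spec_rad R B epowr (1 / 2)"
    using B(2) op_boundD(2)[OF op_bound_mult[OF op_bound_adjoint[OF c] c]]
    by (intro epowr_mono spec_gauge.gauge_mono[OF b]) auto
  also have "\<dots> \<le> growth \<phi> R ?T epowr (1 / 2)"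
    by (intro epowr_mono spec_rad_le_growth T B) simp
  finally show "op_norm R (mat_op R A) \<le> growth \<phi> R ?T epowr (1 / 2)" .
qed

text \<open>The half over \<open>K\<close> consists of adjoints of members of the half over
  \<open>J\<close>, so both halves have growth rate at most that of the first, and their Hadamard
  product at most its square.\<close>

lemma growth_hadamard_adjoint_le:
  fixes J K :: "nat set"
  assumes J: "finite J" "J \<noteq> {}" "finite K" "J \<inter> K = {}" and \<beta>: "1 \<le> real (card J) * \<beta>"
    and \<pi>: "bij_betw \<pi> J K"
    and \<Phi>: "\<And>j. j \<in> J \<Longrightarrow> bdd_mats R (\<Phi> j)" "\<And>j. j \<in> J \<Longrightarrow> \<Phi> (\<pi> j) = set_adjoint (\<Phi> j)"
  shows "growth \<phi> R (set_hadamard (J \<union> K) (\<lambda>_. \<beta>) \<Phi>) epowr (1 / 2) \<le> growth \<phi> R (set_hadamard J (\<lambda>_. \<beta>) \<Phi>)"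
proof -
  let ?H = "\<lambda>i::nat. set_hadamard (if i = 0 then J else K) (\<lambda>_. \<beta>) \<Phi>"
  have H: "bdd_mats R (?H 0)" by (simp add: bdd_mats_hadamard J \<beta> \<Phi>)
  have K: "?H 1 \<subseteq> set_adjoint (?H 0)"
    using set_hadamard_reindex[OF \<pi>, of \<beta> \<Phi>]
    by (simp add: set_adjoint_hadamard \<Phi>(2) cong: set_hadamard_cong)
  have b: "bdd_mats R (?H i)" if "i \<in> {0, 1}" for i
    using that H bdd_mats_subset[OF bdd_mats_adjoint[OF H] K] by auto
  have g: "growth \<phi> R (?H i) \<le> growth \<phi> R (?H 0)" if "i \<in> {0, 1}" for i
  proof -
    have "growth \<phi> R (?H 1) \<le> growth \<phi> R (set_adjoint (?H 0))"
      using K by (intro growth_dominated b bdd_mats_adjoint H dominated_subset) auto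
    also have "\<dots> \<le> growth \<phi> R (?H 0)" by (rule growth_adjoint[OF H])
    finally show ?thesis using that by auto
  qed
  have "growth \<phi> R (set_hadamard (J \<union> K) (\<lambda>_. \<beta>) \<Phi>) \<le> growth \<phi> R (set_hadamard {0, 1} (\<lambda>_. 1) ?H)"
  proof (rule growth_dominated)
    show "bdd_mats R (set_hadamard {0, 1} (\<lambda>_. 1) ?H)" by (intro bdd_mats_hadamard b) auto
    then show "bdd_mats R (set_hadamard (J \<union> K) (\<lambda>_. \<beta>) \<Phi>)"
      using set_hadamard_split[OF J(1,3,4)] by (rule bdd_mats_subset)
    show "dominated (set_hadamard (J \<union> K) (\<lambda>_. \<beta>) \<Phi>) (set_hadamard {0, 1} (\<lambda>_. 1) ?H)"
      by (intro dominated_subset set_hadamard_split J)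
  qed
  also have "\<dots> \<le> growth \<phi> R (?H 0) epowr (real (card {0::nat, 1}) * 1)"
    by (intro growth_hadamard b g) auto
  finally have "growth \<phi> R (set_hadamard (J \<union> K) (\<lambda>_. \<beta>) \<Phi>) \<le> growth \<phi> R (?H 0) epowr 2" by simp
  then have "growth \<phi> R (set_hadamard (J \<union> K) (\<lambda>_. \<beta>) \<Phi>) epowr (1 / 2) \<le> (growth \<phi> R (?H 0) epowr 2) epowr (1 / 2)"
    by (rule epowr_mono) simp
  then show ?thesis by (simp add: epowr_epowr)
qed

text \<open>In a power of the Hadamard product each copy may list its slots in its own order
  \<open>\<sigma> l\<close>; Hoelder's inequality multiplies slot by slot, and the root undoes the
  power.\<close>

lemma growth_hadamard_le_shuffled:
  fixes J :: "nat set"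
  assumes J: "finite J" "J \<noteq> {}" and \<beta>: "1 \<le> real (card J) * \<beta>" and ls: "ls \<noteq> []"
    and \<Phi>: "\<And>j. j \<in> J \<Longrightarrow> bdd_mats R (\<Phi> j)"
    and \<sigma>: "\<And>l. l \<in> set ls \<Longrightarrow> bij_betw (\<sigma> l) J J"
  shows "growth \<phi> R (set_hadamard J (\<lambda>_. \<beta>) \<Phi>) \<le>
    growth \<phi> R (set_hadamard J (\<lambda>_. \<beta>) (\<lambda>j. set_prod R (map (\<lambda>l. \<Phi> (\<sigma> l j)) ls))) epowr (1 / real (length ls))"
proof -
  let ?H = "set_hadamard J (\<lambda>_. \<beta>)"
  let ?T = "?H (\<lambda>j. set_prod R (map (\<lambda>l. \<Phi> (\<sigma> l j)) ls))"
  have \<Phi>\<sigma>: "bdd_mats R (\<Phi> (\<sigma> l j))" if "l \<in> set ls" "j \<in> J" for l j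
    using \<Phi> bij_betwE[OF \<sigma>[OF that(1)]] that by blast
  have H: "bdd_mats R (?H \<Phi>)" by (intro bdd_mats_hadamard J \<beta> \<Phi>)
  have T: "bdd_mats R ?T" by (intro bdd_mats_hadamard J \<beta> bdd_mats_prod) (auto intro: \<Phi>\<sigma>)
  have "list_all2 (\<subseteq>) (replicate (length ls) (?H \<Phi>)) (map (\<lambda>l. ?H (\<lambda>j. \<Phi> (\<sigma> l j))) ls)"
    using set_hadamard_reindex[OF \<sigma>] by (auto simp: list_all2_conv_all_nth)
  then have "dominated (set_power R (?H \<Phi>) (length ls)) (set_prod R (map (\<lambda>l. ?H (\<lambda>j. \<Phi> (\<sigma> l j))) ls))"
    unfolding set_power_eq_set_prod by (intro dominated_subset set_prod_mono)
  also have "dominated \<dots> ?T" by (intro dominated_hadamard_prod J \<beta> \<Phi>\<sigma>)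
  finally (dominated_trans) have dom: "dominated (set_power R (?H \<Phi>) (length ls)) ?T" .
  have "growth \<phi> R (?H \<Phi>) \<le> growth \<phi> R (set_power R (?H \<Phi>) (length ls)) epowr (1 / real (length ls))"
    using ls by (intro growth_power H) auto
  also have "\<dots> \<le> growth \<phi> R ?T epowr (1 / real (length ls))"
    by (intro epowr_mono growth_dominated bdd_mats_power H T dom) simp
  finally show ?thesis .
qed

lemma growth_rotate_le:
  assumes "\<And>\<Phi>. \<Phi> \<in> set xs \<union> set ys \<Longrightarrow> bdd_mats R \<Phi>"
  shows "growth \<phi> R (set_prod R (xs @ ys)) \<le> growth \<phi> R (set_prod R (ys @ xs))"
proof -
  have "bdd_mats R (set_prod R xs)" "bdd_mats R (set_prod R ys)" using assms by (auto intro: bdd_mats_prod)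
  moreover have "set_prod R (xs @ ys) = set_mult R (set_prod R xs) (set_prod R ys)"
    "set_prod R (ys @ xs) = set_mult R (set_prod R ys) (set_prod R xs)"
    using assms by (auto intro!: set_prod_append)
  ultimately show ?thesis using growth_cyclic by simp
qed

end

text \<open>Reads the index list of \<open>\<Theta> i\<close> position by position: the l-th entry
  is i + l wrapped into 1..n, so for fixed l it is a cyclic shift of i. Counting l from 0 makes the
  first shift the identity.\<close>

lemma cyclic_interval_eq:
  fixes i n :: nat
  assumes "i \<in> {1..n}"
  shows "[i..<n + 1] @ [1..<i] = map (\<lambda>l. if i + l \<le> n then i + l else i + l - n) [0..<n]"
  using assms by (intro nth_equalityI) (auto simp: nth_append)

lemma bij_betw_cyclic_shift:
  fixes l n :: nat
  assumes "l < n"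
  shows "bij_betw (\<lambda>i. if i + l \<le> n then i + l else i + l - n) {1..n} {1..n}"
proof -
  have "inj_on (\<lambda>i. if i + l \<le> n then i + l else i + l - n) {1..n}"
    using assms by (auto simp: inj_on_def split: if_splits)
  moreover have "(\<lambda>i. if i + l \<le> n then i + l else i + l - n) ` {1..n} \<subseteq> {1..n}"
    using assms by auto
  ultimately show ?thesis by (simp only: bij_betw_def endo_inj_surj finite_atLeastAtMost simp_thms)
qed

text \<open>For every j up to m the set \<open>\<Sigma> j\<close> is the adjoint of
  \<open>\<Psi>\<close> at the first map times \<open>\<Psi>\<close> at the second. The first map
  runs through \<open>\<tau>\<close> at the odd places and then at the even ones, the second the
  other way round.\<close>

lemma bij_betw_pairing:
  fixes n :: nat
  assumes \<tau>: "\<tau> permutes {1..2 * n}"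
  shows "bij_betw (\<lambda>j. if j \<le> n then \<tau> (2 * j - 1) else \<tau> (2 * (j - n))) {1..2 * n} {1..2 * n}" (is "bij_betw ?f _ _")
    and "bij_betw (\<lambda>j. if j \<le> n then \<tau> (2 * j) else \<tau> (2 * (j - n) - 1)) {1..2 * n} {1..2 * n}" (is "bij_betw ?g _ _")
proof -
  have "bij_betw (\<lambda>j. if j \<le> n then 2 * j - 1 else 2 * (j - n)) {1..2 * n} {1..2 * n}" (is "bij_betw ?p _ _")
  proof -
    have "inj_on ?p {1..2 * n}" by (auto simp: inj_on_def split: if_splits) presburger+
    moreover have "?p ` {1..2 * n} \<subseteq> {1..2 * n}" by auto
    ultimately show ?thesis by (simp only: bij_betw_def endo_inj_surj finite_atLeastAtMost simp_thms)
  qed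
  from bij_betw_trans[OF this permutes_imp_bij[OF \<tau>]] show "bij_betw ?f {1..2 * n} {1..2 * n}"
    by (rule bij_betw_cong[THEN iffD1, rotated]) auto
  have "bij_betw (\<lambda>j. if j \<le> n then 2 * j else 2 * (j - n) - 1) {1..2 * n} {1..2 * n}" (is "bij_betw ?q _ _")
  proof -
    have "inj_on ?q {1..2 * n}" by (auto simp: inj_on_def split: if_splits) presburger+
    moreover have "?q ` {1..2 * n} \<subseteq> {1..2 * n}" by auto
    ultimately show ?thesis by (simp only: bij_betw_def endo_inj_surj finite_atLeastAtMost simp_thms)
  qed
  from bij_betw_trans[OF this permutes_imp_bij[OF \<tau>]] show "bij_betw ?g {1..2 * n} {1..2 * n}"
    by (rule bij_betw_cong[THEN iffD1, rotated]) auto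
qed

theorem theorem3p11:
  fixes R :: "nat set" and m :: nat and \<alpha> :: real and \<tau> :: "nat \<Rightarrow> nat"
    and \<Psi> \<Sigma> \<Theta> :: "nat \<Rightarrow> rmat set" and r :: "rmat set \<Rightarrow> ennreal"
  assumes "index_set R"
    and "m \<ge> 1" and "even m" and "\<alpha> \<ge> 2 / real m"
    and "\<tau> permutes {1..m}"
    and "\<And>j. j \<in> {1..m} \<Longrightarrow> \<Psi> j \<subseteq> nonneg_operator_matrices R \<and> bounded_set R (\<Psi> j)"
    and "\<And>j. j \<in> {1..m div 2} \<Longrightarrow>
           \<Sigma> j = set_prod R [set_adjoint (\<Psi> (\<tau> (2 * j - 1))), \<Psi> (\<tau> (2 * j))]"
    and "\<And>j. j \<in> {1..m div 2} \<Longrightarrow>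
           \<Sigma> (m div 2 + j) = set_prod R [set_adjoint (\<Psi> (\<tau> (2 * j))), \<Psi> (\<tau> (2 * j - 1))]"
    and "\<And>i. i \<in> {1..m div 2} \<Longrightarrow>
           \<Theta> i = set_prod R (map \<Sigma> ([i..<m div 2 + 1] @ [1..<i]))"
    and "r \<in> {generalized_spectral_radius R, joint_spectral_radius R}"
  shows "(\<forall>j\<in>{1..m div 2}. \<Sigma> (m div 2 + j) = set_adjoint (\<Sigma> j)) \<and>
    set_norm R (set_hadamard {1..m} (\<lambda>_. \<alpha>) \<Psi>)
      \<le> r (set_hadamard {1..m} (\<lambda>_. \<alpha>) \<Sigma>) epowr (1 / 2) \<and>
    r (set_hadamard {1..m} (\<lambda>_. \<alpha>) \<Sigma>) epowr (1 / 2)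
      \<le> r (set_hadamard {1..m div 2} (\<lambda>_. \<alpha>) \<Sigma>) \<and>
    r (set_hadamard {1..m div 2} (\<lambda>_. \<alpha>) \<Sigma>)
      = r (set_hadamard {1..m div 2} (\<lambda>_. \<alpha>)
             (\<lambda>j. set_prod R [set_adjoint (\<Psi> (\<tau> (2 * j - 1))), \<Psi> (\<tau> (2 * j))])) \<and>
    r (set_hadamard {1..m div 2} (\<lambda>_. \<alpha>)
             (\<lambda>j. set_prod R [set_adjoint (\<Psi> (\<tau> (2 * j - 1))), \<Psi> (\<tau> (2 * j))]))
      \<le> r (set_hadamard {1..m div 2} (\<lambda>_. \<alpha>) \<Theta>) epowr (2 / real m) \<and>
    r (set_hadamard {1..m div 2} (\<lambda>_. \<alpha>) \<Theta>) epowr (2 / real m)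
      \<le> r (set_prod R (concat (map (\<lambda>j. [set_adjoint (\<Psi> (\<tau> (2 * j - 1))), \<Psi> (\<tau> (2 * j))])
                                     [1..<m div 2 + 1]))) epowr \<alpha>"
proof -
  note \<Psi> = assms(6) and \<Sigma> = assms(7,8) and \<Theta> = assms(9) and r = assms(10)
  define n where "n = m div 2"
  have m: "m = 2 * n" and n: "1 \<le> n" using assms(2,3) by (auto simp: n_def)
  have \<alpha>n: "1 \<le> real n * \<alpha>" and \<alpha>m: "1 \<le> real m * \<alpha>" and \<alpha>0: "0 < \<alpha>"
  proof -
    show "0 < \<alpha>" using assms(4) n less_le_trans[of 0 "2 / real m" \<alpha>] by (simp add: m)
    show *: "1 \<le> real n * \<alpha>" using assms(4) n by (simp add: m divide_le_eq mult.commute)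
    have "real n * \<alpha> \<le> real m * \<alpha>" using \<open>0 < \<alpha>\<close> by (intro mult_right_mono) (auto simp: m)
    then show "1 \<le> real m * \<alpha>" using * by linarith
  qed
  note S1 = \<Sigma>(1)[folded n_def] and S2 = \<Sigma>(2)[folded n_def] and T = \<Theta>[folded n_def]
  have \<tau>: "\<tau> permutes {1..2 * n}" using assms(5) by (simp add: m)
  have b\<Psi>: "bdd_mats R (\<Psi> j)" if "j \<in> {1..m}" for j
    using \<Psi>[OF that] by (intro bdd_mats_bounded_set) auto
  have b\<tau>: "bdd_mats R (\<Psi> (\<tau> j))" if "j \<in> {1..m}" for j
    using b\<Psi>[of "\<tau> j"] permutes_in_image[OF assms(5), of j] that by auto
  have pair: "bdd_mats R (\<Psi> (\<tau> (2 * j - 1)))" "bdd_mats R (\<Psi> (\<tau> (2 * j)))" if "j \<in> {1..n}" for j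
    using that by (auto intro!: b\<tau> simp: m)
  have adj: "\<Sigma> (n + j) = set_adjoint (\<Sigma> j)" if "j \<in> {1..n}" for j
    unfolding S1[OF that] S2[OF that] using pair[OF that]
    by (simp only: set_prod_pair set_adjoint_mult set_adjoint_adjoint)
  have b\<Sigma>: "bdd_mats R (\<Sigma> j)" if "j \<in> {1..n}" for j
    unfolding S1[OF that] set_prod_pair[OF pair(2)[OF that]]
    by (intro bdd_mats_mult bdd_mats_adjoint pair that)
  have b\<Sigma>': "bdd_mats R (\<Sigma> j)" if "j \<in> {1..m}" for j
  proof (cases "j \<le> n")
    case False
    then have "j - n \<in> {1..n}" "n + (j - n) = j" using that by (auto simp: m)
    then show ?thesis using adj[of "j - n"] b\<Sigma>[of "j - n"] by (simp add: bdd_mats_adjoint)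
  qed (use that b\<Sigma> in auto)
  have b\<Theta>: "bdd_mats R (\<Theta> j)" if "j \<in> {1..n}" for j
    unfolding T[OF that] using that by (intro bdd_mats_prod) (auto intro: b\<Sigma>)
  let ?Q = "set_prod R (concat (map (\<lambda>j. [set_adjoint (\<Psi> (\<tau> (2 * j - 1))), \<Psi> (\<tau> (2 * j))]) [1..<n + 1]))"
  \<comment> \<open>Grouped in pairs, the last product is that of \<open>\<Sigma> 1\<close> to
    \<open>\<Sigma> n\<close>, whose rotations are the sets \<open>\<Theta> i\<close>.\<close>
  have Q: "?Q = set_prod R (map \<Sigma> [1..<n + 1])"
  proof -
    have "?Q = set_prod R (map (set_prod R) (map (\<lambda>j. [set_adjoint (\<Psi> (\<tau> (2 * j - 1))), \<Psi> (\<tau> (2 * j))]) [1..<n + 1]))"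
      by (rule set_prod_concat[symmetric]) (use pair in \<open>auto intro!: bdd_mats_adjoint\<close>)
    also have "map (set_prod R) (map (\<lambda>j. [set_adjoint (\<Psi> (\<tau> (2 * j - 1))), \<Psi> (\<tau> (2 * j))]) [1..<n + 1]) = map \<Sigma> [1..<n + 1]"
      unfolding map_map by (intro map_cong refl) (auto simp: S1 simp del: set_prod_Cons)
    finally show ?thesis .
  qed
  have eq: "set_hadamard {1..n} (\<lambda>_. \<alpha>) (\<lambda>j. set_prod R [set_adjoint (\<Psi> (\<tau> (2 * j - 1))), \<Psi> (\<tau> (2 * j))])
      = set_hadamard {1..n} (\<lambda>_. \<alpha>) \<Sigma>"
    by (intro set_hadamard_cong S1[symmetric])
  have bdd: "bdd_mats R (set_hadamard {1..m} (\<lambda>_. \<alpha>) \<Sigma>)" "bdd_mats R (set_hadamard {1..n} (\<lambda>_. \<alpha>) \<Sigma>)"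
    "bdd_mats R (set_hadamard {1..n} (\<lambda>_. \<alpha>) \<Theta>)" "bdd_mats R ?Q"
    unfolding Q using n \<alpha>n \<alpha>m assms(2)
    by (intro bdd_mats_hadamard bdd_mats_prod b\<Sigma> b\<Sigma>' b\<Theta>; auto intro: b\<Sigma>)+
  \<comment> \<open>From here on both choices of \<open>r\<close> are one growth rate. The
    identification of the joint spectral radius rests on boundedness, hence the facts
    \<open>bdd\<close>.\<close>
  obtain \<phi> where \<phi>: "matrix_gauge R \<phi>" and r_eq: "\<And>\<Phi>. bdd_mats R \<Phi> \<Longrightarrow> r \<Phi> = growth \<phi> R \<Phi>"
  proof (cases "r = joint_spectral_radius R")
    case True
    then show thesis using that[OF norm_gauge.matrix_gauge_axioms] joint_spectral_radius_eq_growth by simp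
  next
    case False
    then have "r \<Phi> = growth (spec_rad R) R \<Phi>" for \<Phi>
      using r by (auto simp: generalized_spectral_radius_def growth_def)
    then show thesis using that[OF spec_gauge.matrix_gauge_axioms] by blast
  qed
  interpret matrix_gauge R \<phi> by fact
  have "set_norm R (set_hadamard {1..m} (\<lambda>_. \<alpha>) \<Psi>) \<le> growth \<phi> R (set_hadamard {1..m} (\<lambda>_. \<alpha>) \<Sigma>) epowr (1 / 2)"
  proof -
    let ?f = "\<lambda>j. if j \<le> n then \<tau> (2 * j - 1) else \<tau> (2 * (j - n))"
    let ?g = "\<lambda>j. if j \<le> n then \<tau> (2 * j) else \<tau> (2 * (j - n) - 1)"
    have "set_mult R (set_adjoint (\<Psi> (?f j))) (\<Psi> (?g j)) = \<Sigma> j" if "j \<in> {1..m}" for j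
    proof (cases "j \<le> n")
      case True
      then have j: "j \<in> {1..n}" using that by auto
      show ?thesis unfolding S1[OF j] set_prod_pair[OF pair(2)[OF j]] using True by simp
    next
      case False
      then have j: "j - n \<in> {1..n}" using that by (auto simp: m)
      show ?thesis using S2[OF j] unfolding set_prod_pair[OF pair(1)[OF j]] using False by simp
    qed
    then have "set_hadamard {1..m} (\<lambda>_. \<alpha>) (\<lambda>j. set_mult R (set_adjoint (\<Psi> (?f j))) (\<Psi> (?g j)))
        = set_hadamard {1..m} (\<lambda>_. \<alpha>) \<Sigma>"
      by (rule set_hadamard_cong)
    then show ?thesis
      using set_norm_hadamard_le[of "{1..m}" \<alpha> \<Psi> ?f ?g] b\<Psi> bij_betw_pairing[OF \<tau>] assms(2) \<alpha>m by (simp add: m)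
  qed
  moreover have "growth \<phi> R (set_hadamard {1..m} (\<lambda>_. \<alpha>) \<Sigma>) epowr (1 / 2) \<le> growth \<phi> R (set_hadamard {1..n} (\<lambda>_. \<alpha>) \<Sigma>)"
  proof -
    have "bij_betw ((+) n) {1..n} {n + 1..m}"
      using bij_betw_add[of n "{1..n}" "{n + 1..m}"] by (simp add: m mult_2 add.commute)
    moreover have "{1..n} \<union> {n + 1..m} = {1..m}" using n by (auto simp: m)
    ultimately show ?thesis
      using growth_hadamard_adjoint_le[of "{1..n}" "{n + 1..m}" \<alpha> "(+) n" \<Sigma>] n \<alpha>n b\<Sigma> adj by auto
  qed
  moreover have "growth \<phi> R (set_hadamard {1..n} (\<lambda>_. \<alpha>) \<Sigma>) \<le> growth \<phi> R (set_hadamard {1..n} (\<lambda>_. \<alpha>) \<Theta>) epowr (2 / real m)"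
  proof -
    \<comment> \<open>Copy l is shifted by l, so slot j receives the factors of
      \<open>\<Theta> j\<close> in the right order; the n copies give the exponent 1/n =
      2/m.\<close>
    let ?s = "\<lambda>l i. if i + l \<le> n then i + l else i + l - n"
    have "set_prod R (map (\<lambda>l. \<Sigma> (?s l j)) [0..<n]) = \<Theta> j" if "j \<in> {1..n}" for j
      unfolding T[OF that] cyclic_interval_eq[OF that] map_map comp_def ..
    then have "set_hadamard {1..n} (\<lambda>_. \<alpha>) (\<lambda>j. set_prod R (map (\<lambda>l. \<Sigma> (?s l j)) [0..<n]))
        = set_hadamard {1..n} (\<lambda>_. \<alpha>) \<Theta>"
      by (rule set_hadamard_cong)
    moreover have "2 / real m = 1 / real (length [0..<n])" by (simp add: m)
    ultimately show ?thesis
      using growth_hadamard_le_shuffled[of "{1..n}" \<alpha> "[0..<n]" \<Sigma> ?s] n \<alpha>n b\<Sigma> bij_betw_cyclic_shift by simp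
  qed
  moreover have "growth \<phi> R (set_hadamard {1..n} (\<lambda>_. \<alpha>) \<Theta>) epowr (2 / real m) \<le> growth \<phi> R ?Q epowr \<alpha>"
  proof -
    have "growth \<phi> R (\<Theta> i) \<le> growth \<phi> R ?Q" if i: "i \<in> {1..n}" for i
    proof -
      have "growth \<phi> R (\<Theta> i) \<le> growth \<phi> R (set_prod R (map \<Sigma> [1..<i] @ map \<Sigma> [i..<n + 1]))"
        unfolding T[OF i] map_append using i by (intro growth_rotate_le) (auto intro: b\<Sigma>)
      also have "map \<Sigma> [1..<i] @ map \<Sigma> [i..<n + 1] = map \<Sigma> [1..<n + 1]"
        using i upt_add_eq_append[of 1 i "n + 1 - i"] by (simp flip: map_append)
      finally show ?thesis unfolding Q .
    qed
    \<comment> \<open>The n slots share one bound, which yields the exponent n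
      \<open>\<alpha>\<close>; the outer power 2/m = 1/n reduces it to
      \<open>\<alpha>\<close>.\<close>
    then have "growth \<phi> R (set_hadamard {1..n} (\<lambda>_. \<alpha>) \<Theta>) \<le> growth \<phi> R ?Q epowr (real (card {1..n}) * \<alpha>)"
      using n \<alpha>n by (intro growth_hadamard b\<Theta>) auto
    then have "growth \<phi> R (set_hadamard {1..n} (\<lambda>_. \<alpha>) \<Theta>) epowr (2 / real m) \<le> (growth \<phi> R ?Q epowr (real n * \<alpha>)) epowr (2 / real m)"
      by (intro epowr_mono) auto
    moreover have "real n * \<alpha> * (2 / real m) = \<alpha>" using n by (simp add: m)
    ultimately show ?thesis by (simp only: epowr_epowr)
  qed
  ultimately show ?thesis
    using adj unfolding n_def[symmetric] by (simp only: eq r_eq[OF bdd(1)] r_eq[OF bdd(2)] r_eq[OF bdd(3)] r_eq[OF bdd(4)]) blast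
qed

end
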